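(* Given an $n$-vertex graph $G \in \mathcal{C}$ and an integer $k$, one can in $n^{\mathcal{O}(k)}$ time compute a family $\mathcal{F}_1$ of subsets of $V(G)$ of size $\mathcal{O}(n^{2k+12})$ such that for every $k$-colorable induced subgraph $F$ of $G$ and every minimal separator $S$ of $G$ there exists $\widehat{S}\in\mathcal{F}_1$ that is an $F$-container for $S$.
   Context: $\mathcal{C}$ is the class of graphs with no induced cycle of length at least $6$ and no induced extended $C_5$ (a five-vertex induced cycle plus a vertex adjacent to exactly one or exactly two consecutive of its vertices). A minimal separator of $G$ is a set $S$ such that $G-S$ has at least two connected components $D$ with $N(D)=S$, where $N(\cdot)$ is the open neighborhood. A graph is $k$-colorable if its vertex set partitions into $k$ independent sets. For an induced subgraph $F$ of $G$, $A$ is an $F$-container for $S$ if $S\subseteq A$ and $A\cap V(F)=S\cap V(F)$. *)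

theory Defs
  imports "Graph_Theory.Graph_Theory"
begin

section \<open>Graphs\<close>

text \<open>
  Finite simple undirected graphs are the objects satisfying \<open>pair_graph\<close>: an undirected edge is a
  pair of opposite arcs, and in such a symmetric digraph the strongly connected components are
  exactly the connected components.
\<close>

definition nbhd :: "'a pair_pre_digraph \<Rightarrow> 'a set \<Rightarrow> 'a set" where
  "nbhd G D = {v \<in> pverts G - D. \<exists>u\<in>D. (u, v) \<in> parcs G}"

definition induced_cycle :: "'a pair_pre_digraph \<Rightarrow> 'a list \<Rightarrow> bool" where
  "induced_cycle G vs \<longleftrightarrow> 3 \<le> length vs \<and> distinct vs \<and> set vs \<subseteq> pverts G \<and>
     (\<forall>i<length vs. \<forall>j<length vs. (vs ! i, vs ! j) \<in> parcs G \<longleftrightarrow>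
        j = Suc i mod length vs \<or> i = Suc j mod length vs)"

definition induced_extended_C5 :: "'a pair_pre_digraph \<Rightarrow> 'a list \<Rightarrow> 'a \<Rightarrow> bool" where
  "induced_extended_C5 G vs v \<longleftrightarrow> induced_cycle G vs \<and> length vs = 5 \<and>
     v \<in> pverts G - set vs \<and>
     (\<exists>i<5. nbhd G {v} \<inter> set vs = {vs ! i} \<or>
            nbhd G {v} \<inter> set vs = {vs ! i, vs ! (Suc i mod 5)})"

definition class_C :: "'a pair_pre_digraph \<Rightarrow> bool" where
  "class_C G \<longleftrightarrow> pair_graph G \<and>
     \<not> (\<exists>vs. induced_cycle G vs \<and> 6 \<le> length vs) \<and>
     \<not> (\<exists>vs v. induced_extended_C5 G vs v)"

definition components_minus :: "'a pair_pre_digraph \<Rightarrow> 'a set \<Rightarrow> 'a set set" where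
  "components_minus G S = pre_digraph.sccs_verts (with_proj G \<restriction> (pverts G - S))"

definition minimal_separator :: "'a pair_pre_digraph \<Rightarrow> 'a set \<Rightarrow> bool" where
  "minimal_separator G S \<longleftrightarrow> S \<subseteq> pverts G \<and>
     (\<exists>D\<in>components_minus G S. \<exists>D'\<in>components_minus G S.
        D \<noteq> D' \<and> nbhd G D = S \<and> nbhd G D' = S)"

definition independent_set :: "'a pair_pre_digraph \<Rightarrow> 'a set \<Rightarrow> bool" where
  "independent_set G I \<longleftrightarrow> I \<subseteq> pverts G \<and> (\<forall>u\<in>I. \<forall>v\<in>I. (u, v) \<notin> parcs G)"

text \<open>As usual for colourings, colour classes may be empty.\<close>

definition colorable :: "nat \<Rightarrow> 'a pair_pre_digraph \<Rightarrow> bool" where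
  "colorable k G \<longleftrightarrow> (\<exists>I :: nat \<Rightarrow> 'a set. (\<Union>i<k. I i) = pverts G \<and>
     (\<forall>i<k. \<forall>j<k. i \<noteq> j \<longrightarrow> I i \<inter> I j = {}) \<and> (\<forall>i<k. independent_set G (I i)))"

definition container :: "'a pair_pre_digraph \<Rightarrow> 'a set \<Rightarrow> 'a set \<Rightarrow> bool" where
  "container F S A \<longleftrightarrow> S \<subseteq> A \<and> A \<inter> pverts F = S \<inter> pverts F"


section \<open>Model of computation\<close>

text \<open>
  Jones's language WHILE: imperative programs over binary trees, with a step count. Every operation
  is elementary (constructing or taking apart one node, testing for the empty tree), so that
  step counts agree with running times of Turing machines up to a polynomial.
\<close>

datatype data = DNil | DCons data data

fun dhd :: "data \<Rightarrow> data" where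
  "dhd DNil = DNil"
| "dhd (DCons a b) = a"

fun dtl :: "data \<Rightarrow> data" where
  "dtl DNil = DNil"
| "dtl (DCons a b) = b"

type_synonym store = "nat \<Rightarrow> data"

datatype expr = EVar nat | ENil | ECons expr expr | EHd expr | ETl expr

primrec eval_expr :: "expr \<Rightarrow> store \<Rightarrow> data" where
  "eval_expr (EVar x) s = s x"
| "eval_expr ENil s = DNil"
| "eval_expr (ECons e f) s = DCons (eval_expr e s) (eval_expr f s)"
| "eval_expr (EHd e) s = dhd (eval_expr e s)"
| "eval_expr (ETl e) s = dtl (eval_expr e s)"

primrec expr_cost :: "expr \<Rightarrow> nat" where
  "expr_cost (EVar x) = 1"
| "expr_cost ENil = 1"
| "expr_cost (ECons e f) = 1 + expr_cost e + expr_cost f"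
| "expr_cost (EHd e) = 1 + expr_cost e"
| "expr_cost (ETl e) = 1 + expr_cost e"

datatype com = CSkip | CAssign nat expr | CSeq com com | CIf expr com com | CWhile expr com

text \<open>\<open>exec c s t s'\<close>: started in \<open>s\<close>, the command \<open>c\<close> halts in \<open>s'\<close> after exactly \<open>t\<close> steps.\<close>

inductive exec :: "com \<Rightarrow> store \<Rightarrow> nat \<Rightarrow> store \<Rightarrow> bool" where
  skip: "exec CSkip s 1 s"
| assign: "exec (CAssign x e) s (1 + expr_cost e) (s(x := eval_expr e s))"
| seq: "exec c s t s' \<Longrightarrow> exec d s' t' s'' \<Longrightarrow> exec (CSeq c d) s (1 + t + t') s''"
| if_true: "eval_expr e s \<noteq> DNil \<Longrightarrow> exec c s t s' \<Longrightarrow>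
    exec (CIf e c d) s (1 + expr_cost e + t) s'"
| if_false: "eval_expr e s = DNil \<Longrightarrow> exec d s t s' \<Longrightarrow>
    exec (CIf e c d) s (1 + expr_cost e + t) s'"
| while_false: "eval_expr e s = DNil \<Longrightarrow> exec (CWhile e c) s (1 + expr_cost e) s"
| while_true: "eval_expr e s \<noteq> DNil \<Longrightarrow> exec c s t s' \<Longrightarrow> exec (CWhile e c) s' t' s'' \<Longrightarrow>
    exec (CWhile e c) s (1 + expr_cost e + t + t') s''"

inductive_cases exec_skipE: "exec CSkip s t s'"
inductive_cases exec_assignE: "exec (CAssign x e) s t s'"
inductive_cases exec_seqE: "exec (CSeq c d) s t s'"
inductive_cases exec_ifE: "exec (CIf e c d) s t s'"
inductive_cases exec_whileE: "exec (CWhile e c) s t s'"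

lemma exec_deterministic:
  "exec c s t s' \<Longrightarrow> exec c s u r \<Longrightarrow> u = t \<and> r = s'"
proof (induction arbitrary: u r rule: exec.induct)
  case (skip s)
  then show ?case by (auto elim: exec_skipE)
next
  case (assign x e s)
  then show ?case by (auto elim: exec_assignE)
next
  case (seq c s t s' d t' s'')
  from seq.prems obtain v v' q where "exec c s v q" "exec d q v' r" "u = 1 + v + v'"
    by (elim exec_seqE) auto
  with seq.IH show ?case by metis
next
  case (if_true e s c t s' d)
  from if_true.prems if_true.hyps obtain v where "exec c s v r" "u = 1 + expr_cost e + v"
    by (elim exec_ifE) auto
  with if_true.IH show ?case by metis
next
  case (if_false e s d t s' c)
  from if_false.prems if_false.hyps obtain v where "exec d s v r" "u = 1 + expr_cost e + v"
    by (elim exec_ifE) auto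
  with if_false.IH show ?case by metis
next
  case (while_false e s c)
  then show ?case by (auto elim: exec_whileE)
next
  case (while_true e s c t s' t' s'')
  obtain v v' q
    where "exec c s v q" "exec (CWhile e c) q v' r" "u = 1 + expr_cost e + v + v'"
    using while_true.hyps by (rule_tac exec_whileE[OF while_true.prems]) auto
  with while_true.IH show ?case by metis
qed

text \<open>Variable \<open>0\<close> holds the input at the start and the output at the end.\<close>

definition runs_in :: "com \<Rightarrow> data \<Rightarrow> nat \<Rightarrow> data \<Rightarrow> bool" where
  "runs_in P x t y \<longleftrightarrow> (\<exists>s. exec P ((\<lambda>_. DNil)(0 := x)) t s \<and> s 0 = y)"


section \<open>Encoding of inputs and outputs\<close>

definition enc_list :: "data list \<Rightarrow> data" where
  "enc_list ds = foldr DCons ds DNil"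

definition enc_bool :: "bool \<Rightarrow> data" where
  "enc_bool b = (if b then DCons DNil DNil else DNil)"

text \<open>Unary.\<close>

definition enc_nat :: "nat \<Rightarrow> data" where
  "enc_nat k = enc_list (replicate k DNil)"

text \<open>A subset of \<open>{..<n}\<close> is given by its characteristic vector.\<close>

definition enc_vset :: "nat \<Rightarrow> nat set \<Rightarrow> data" where
  "enc_vset n A = enc_list (map (\<lambda>i. enc_bool (i \<in> A)) [0..<n])"

text \<open>A graph with vertex set \<open>{..<n}\<close> is given by its adjacency matrix.\<close>

definition enc_graph :: "nat \<Rightarrow> nat pair_pre_digraph \<Rightarrow> data" where
  "enc_graph n G = enc_list (map (\<lambda>i. enc_vset n {j. (i, j) \<in> parcs G}) [0..<n])"

definition enc_input :: "nat \<Rightarrow> nat pair_pre_digraph \<Rightarrow> nat \<Rightarrow> data" where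
  "enc_input n G k = DCons (enc_graph n G) (enc_nat k)"

text \<open>A family of subsets of \<open>{..<n}\<close> is given by a list of its members, in any order.\<close>

definition encodes_family :: "nat \<Rightarrow> nat set set \<Rightarrow> data \<Rightarrow> bool" where
  "encodes_family n \<F> d \<longleftrightarrow> \<F> \<subseteq> Pow {..<n} \<and>
     (\<exists>As. set As = \<F> \<and> d = enc_list (map (enc_vset n) As))"

lemma enc_list_inject: "enc_list xs = enc_list ys \<longleftrightarrow> xs = ys"
proof (induction xs arbitrary: ys)
  case Nil then show ?case by (cases ys) (auto simp: enc_list_def)
next
  case (Cons x xs) then show ?case by (cases ys) (auto simp: enc_list_def)
qed

lemma enc_vset_inj_on: "inj_on (enc_vset n) (Pow {..<n})"
proof (rule inj_onI)
  fix A B assume "A \<in> Pow {..<n}" "B \<in> Pow {..<n}" and eq: "enc_vset n A = enc_vset n B"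
  have "i \<in> A \<longleftrightarrow> i \<in> B" if "i < n" for i
    using eq that by (auto simp: enc_vset_def enc_list_inject enc_bool_def split: if_splits)
  then show "A = B" using \<open>A \<in> _\<close> \<open>B \<in> _\<close> by auto
qed

lemma encodes_family_unique:
  assumes "encodes_family n \<F> d" "encodes_family n \<G> d"
  shows "\<F> = \<G>"
proof -
  obtain As Bs where *: "set As = \<F>" "set Bs = \<G>" "map (enc_vset n) As = map (enc_vset n) Bs"
    using assms by (auto simp: encodes_family_def enc_list_inject)
  moreover have "\<F> \<subseteq> Pow {..<n}" "\<G> \<subseteq> Pow {..<n}"
    using assms by (auto simp: encodes_family_def)
  ultimately have "enc_vset n ` \<F> = enc_vset n ` \<G>" by (metis set_map)
  then show ?thesis
    using inj_on_image_eq_iff[OF enc_vset_inj_on] \<open>\<F> \<subseteq> _\<close> \<open>\<G> \<subseteq> _\<close> by blast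
qed

end

theory Submission
  imports Defs
begin

text \<open>
  Let \<open>A\<close> and \<open>B\<close> be two full components of \<open>G - S\<close>. A connected subset of \<open>A\<close> of minimum size that
  dominates \<open>S\<close> is a clique, and likewise for \<open>B\<close>. If one of these cliques has at most two vertices,
  \<open>S\<close> is definable from them by a first-order formula. Otherwise, take three vertices of each clique and
  one further vertex each (\<open>X\<close> and \<open>Y\<close>). The part of \<open>S\<close> seen by \<open>X\<close> is definable up to vertices of
  \<open>A\<close>; among those in \<open>F\<close>, nonadjacent ones have nested neighbourhoods in the part of \<open>S\<close> not seen by
  \<open>X\<close>, so that a clique of at most \<open>k\<close> vertices of \<open>F\<close> suffices to exclude them all, and symmetrically
  for \<open>Y\<close>. The part of \<open>S\<close> seen by neither \<open>X\<close> nor \<open>Y\<close> is definable exactly, with four more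
  extremal vertices as parameters. In total a container is given by a fixed first-order formula and
  \<open>2k + 12\<close> vertices, and the algorithm evaluates that formula for all choices of them.
\<close>

section \<open>Induced paths and cycles\<close>

text \<open>Adjacency is all that a formula can express, and \<open>G - S\<close> may have
  components besides \<open>A\<close> and \<open>B\<close>. So a vertex enters the container on the
  strength of a certificate, one or two neighbours that seem to lie in the two cliques, and every
  certificate must be tested against impostors outside \<open>S\<close>. An impostor seen by
  \<open>X\<close> lies in \<open>A\<close>; those are excluded only as far as they belong to
  \<open>F\<close>. An impostor seen by neither clique may lie in any component.

  The number three comes from an exchange: two vertices of \<open>A\<close> can replace all members
  of a minimum dominator that miss both ends of a certain edge, so at most two members miss both. If
  three fixed members do, the certificate of an impostor must run through two vertices of
  \<open>S\<close>, and one extremal choice among these pairs exposes all impostors of this kind.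

  On the computational side \<open>k\<close> stands in the exponent, so the list of all parameter
  tuples is not polynomial in the size of the input, and the loop producing it needs a cost analysis
  of its own.\<close>

locale C_graph =
  fixes G :: "'a pair_pre_digraph"
  assumes in_class_C: "class_C G"
begin

abbreviation adj :: "'a \<Rightarrow> 'a \<Rightarrow> bool" (infix "\<sim>" 50) where
  "u \<sim> v \<equiv> (u, v) \<in> parcs G"

lemma pair_graph: "pair_graph G"
  using in_class_C by (simp add: class_C_def)

sublocale pair_graph G by (rule pair_graph)

lemma adj_sym: "u \<sim> v \<longleftrightarrow> v \<sim> u"
  using pair_sym_arcs by (auto simp: symmetric_def sym_def)

lemma adj_irrefl [simp]: "\<not> u \<sim> u"
  using pair_no_loops by force

lemma adj_verts: "u \<sim> v \<Longrightarrow> u \<in> pverts G" "u \<sim> v \<Longrightarrow> v \<in> pverts G"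
  using arc_fst_in_verts arc_snd_in_verts by force+

fun induced_path :: "'a list \<Rightarrow> bool" where
  "induced_path [] \<longleftrightarrow> True"
| "induced_path [x] \<longleftrightarrow> x \<in> pverts G"
| "induced_path (x # y # zs) \<longleftrightarrow> x \<sim> y \<and> x \<notin> set zs \<and> (\<forall>z\<in>set zs. \<not> x \<sim> z) \<and> induced_path (y # zs)"

lemma induced_path_verts: "induced_path vs \<Longrightarrow> set vs \<subseteq> pverts G"
  by (induction vs rule: induced_path.induct) (auto simp: adj_verts)

lemma induced_path_distinct: "induced_path vs \<Longrightarrow> distinct vs"
  by (induction vs rule: induced_path.induct) auto

lemma induced_path_tl: "induced_path (x # xs) \<Longrightarrow> induced_path xs"
  by (cases xs) auto

lemma induced_path_nth:
  assumes "induced_path vs" "i < length vs" "j < length vs"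
  shows "vs ! i \<sim> vs ! j \<longleftrightarrow> j = Suc i \<or> i = Suc j"
  using assms
proof (induction vs arbitrary: i j rule: induced_path.induct)
  case (3 x y zs)
  have hd: "x \<sim> (x # y # zs) ! m \<longleftrightarrow> m = 1" if "m < length (x # y # zs)" for m
    using that "3.prems"(1) by (cases m; cases "m - 1") auto
  show ?case
  proof (cases i)
    case 0
    then show ?thesis using hd[of j] "3.prems" by simp
  next
    case (Suc i')
    show ?thesis
    proof (cases j)
      case 0
      then show ?thesis using hd[of i] "3.prems" by (auto simp: adj_sym)
    next
      case (Suc j')
      then show ?thesis using \<open>i = Suc i'\<close> "3.prems" "3.IH"[of i' j'] by simp
    qed
  qed
qed auto

text \<open>Cut \<open>vs\<close> at the last neighbour of \<open>w\<close>; everything after it is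
  nonadjacent to \<open>w\<close>.\<close>

lemma induced_path_Cons_shortcut:
  assumes "induced_path vs" "w \<notin> set vs" "\<exists>z\<in>set vs. w \<sim> z"
  obtains us where "induced_path (w # us)" "us \<noteq> []" "last us = last vs" "set us \<subseteq> set vs"
  using assms
proof (induction vs arbitrary: thesis)
  case (Cons x xs)
  show ?case
  proof (cases "\<exists>z\<in>set xs. w \<sim> z")
    case True
    then have "xs \<noteq> []" by auto
    obtain us where "induced_path (w # us)" "us \<noteq> []" "last us = last xs" "set us \<subseteq> set xs"
      using Cons.IH True Cons.prems induced_path_tl by (metis list.set_intros(2))
    then show ?thesis using Cons.prems(1)[of us] \<open>xs \<noteq> []\<close> by auto
  next
    case False
    then show ?thesis using Cons.prems by (intro Cons.prems(1)[of "x # xs"]) auto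
  qed
qed simp

lemma induced_cycle_Cons:
  assumes path: "induced_path ys" and "2 \<le> length ys" and s: "s \<in> pverts G" "s \<notin> set ys"
    and ends: "\<And>i. i < length ys \<Longrightarrow> s \<sim> ys ! i \<longleftrightarrow> i = 0 \<or> i = length ys - 1"
  shows "induced_cycle G (s # ys)"
  unfolding induced_cycle_def
proof (intro conjI allI impI)
  fix i j assume ij: "i < length (s # ys)" "j < length (s # ys)"
  let ?n = "length (s # ys)"
  have suc: "Suc m mod ?n = (if m = length ys then 0 else Suc m)" if "m < ?n" for m
    using that by auto
  show "(s # ys) ! i \<sim> (s # ys) ! j \<longleftrightarrow> j = Suc i mod ?n \<or> i = Suc j mod ?n"
  proof (cases i)
    case 0
    show ?thesis
    proof (cases j)
      case (Suc j')
      then show ?thesis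
        unfolding suc[OF ij(1)] suc[OF ij(2)] using 0 ij ends[of j'] \<open>2 \<le> _\<close> by auto
    qed (use 0 \<open>2 \<le> _\<close> in force)
  next
    case i: (Suc i')
    show ?thesis
    proof (cases j)
      case 0
      then show ?thesis
        unfolding suc[OF ij(1)] suc[OF ij(2)]
        using i ij ends[of i'] \<open>2 \<le> _\<close> adj_sym[of s "ys ! i'"] by auto
    next
      case (Suc j')
      then have "(s # ys) ! i \<sim> (s # ys) ! j \<longleftrightarrow> j = Suc i \<or> i = Suc j"
        using i ij induced_path_nth[OF path, of i' j'] by simp
      moreover have "j = Suc i mod ?n \<longleftrightarrow> j = Suc i" "i = Suc j mod ?n \<longleftrightarrow> i = Suc j"
        unfolding suc[OF ij(1)] suc[OF ij(2)] using i ij Suc by (simp_all split: if_splits)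
      ultimately show ?thesis by (simp only:)
    qed
  qed
qed (use s \<open>2 \<le> _\<close> induced_path_verts[OF path] induced_path_distinct[OF path] in auto)

section \<open>Forbidden induced subgraphs\<close>

lemma induced_cycle_short: "induced_cycle G vs \<Longrightarrow> length vs < 6"
  using in_class_C by (force simp: class_C_def)

lemma no_induced_C6:
  assumes "a \<sim> b" "b \<sim> c" "c \<sim> d" "d \<sim> e" "e \<sim> f" "f \<sim> a"
    and "\<not> a \<sim> c" "\<not> a \<sim> d" "\<not> a \<sim> e" "\<not> b \<sim> d" "\<not> b \<sim> e" "\<not> b \<sim> f"
    and "\<not> c \<sim> e" "\<not> c \<sim> f" "\<not> d \<sim> f"
  shows False
proof -
  have "induced_path [b, c, d, e, f]" using assms adj_verts by (auto simp: adj_sym)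
  moreover have "a \<notin> set [b, c, d, e, f]" using assms by (auto simp: adj_sym)
  moreover have "a \<sim> [b, c, d, e, f] ! i \<longleftrightarrow> i = 0 \<or> i = 4" if "i < 5" for i
  proof -
    have "i \<in> {0, 1, 2, 3, 4}" using that by auto
    then show ?thesis using assms(1,6,7,8,9) by (auto simp: adj_sym[of f a])
  qed
  ultimately have "induced_cycle G [a, b, c, d, e, f]"
    using adj_verts(1)[OF assms(1)] by (intro induced_cycle_Cons) auto
  from induced_cycle_short[OF this] show False by simp
qed

lemma induced_C5I:
  assumes "a \<sim> b" "b \<sim> c" "c \<sim> d" "d \<sim> e" "e \<sim> a"
    and "\<not> a \<sim> c" "\<not> a \<sim> d" "\<not> b \<sim> d" "\<not> b \<sim> e" "\<not> c \<sim> e"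
  shows "induced_cycle G [a, b, c, d, e]"
proof -
  have "induced_path [b, c, d, e]" using assms adj_verts by (auto simp: adj_sym)
  moreover have "a \<notin> set [b, c, d, e]" using assms by (auto simp: adj_sym)
  moreover have "a \<sim> [b, c, d, e] ! i \<longleftrightarrow> i = 0 \<or> i = 3" if "i < 4" for i
  proof -
    have "i \<in> {0, 1, 2, 3}" using that by auto
    then show ?thesis using assms(1,5,6,7) by (auto simp: adj_sym[of e a])
  qed
  ultimately show ?thesis
    using adj_verts(1)[OF assms(1)] by (intro induced_cycle_Cons) auto
qed

lemma no_extended_C5_one:
  assumes "a \<sim> b" "b \<sim> c" "c \<sim> d" "d \<sim> e" "e \<sim> a"
    and "\<not> a \<sim> c" "\<not> a \<sim> d" "\<not> b \<sim> d" "\<not> b \<sim> e" "\<not> c \<sim> e"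
    and "p \<sim> a" "\<not> p \<sim> b" "\<not> p \<sim> c" "\<not> p \<sim> d" "\<not> p \<sim> e"
  shows False
proof -
  have "p \<notin> set [a, b, c, d, e]" using assms by (auto simp: adj_sym)
  then have nb: "nbhd G {p} \<inter> set [a, b, c, d, e] = {a}"
    using assms(11-15) adj_verts by (auto simp: nbhd_def)
  have "induced_extended_C5 G [a, b, c, d, e] p"
    unfolding induced_extended_C5_def nb
    using induced_C5I[OF assms(1-10)] adj_verts(1)[OF assms(11)] \<open>p \<notin> _\<close>
    by (intro conjI exI[of _ 0]) simp_all
  then show False using in_class_C by (simp add: class_C_def)
qed

lemma no_extended_C5_two:
  assumes "a \<sim> b" "b \<sim> c" "c \<sim> d" "d \<sim> e" "e \<sim> a"
    and "\<not> a \<sim> c" "\<not> a \<sim> d" "\<not> b \<sim> d" "\<not> b \<sim> e" "\<not> c \<sim> e"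
    and "p \<sim> a" "p \<sim> b" "\<not> p \<sim> c" "\<not> p \<sim> d" "\<not> p \<sim> e"
  shows False
proof -
  have "p \<notin> set [a, b, c, d, e]" using assms by (auto simp: adj_sym)
  then have nb: "nbhd G {p} \<inter> set [a, b, c, d, e] = {a, b}"
    using assms(11-15) adj_verts by (auto simp: nbhd_def)
  have "induced_extended_C5 G [a, b, c, d, e] p"
    unfolding induced_extended_C5_def nb
    using induced_C5I[OF assms(1-10)] adj_verts(1)[OF assms(11)] \<open>p \<notin> _\<close>
    by (intro conjI exI[of _ 0]) simp_all
  then show False using in_class_C by (simp add: class_C_def)
qed

section \<open>Connected sets and induced paths inside them\<close>

definition arcs_in :: "'a set \<Rightarrow> 'a rel" where
  "arcs_in X = {(u, v). u \<in> X \<and> v \<in> X \<and> u \<sim> v}"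

definition connected_in :: "'a set \<Rightarrow> bool" where
  "connected_in X \<longleftrightarrow> (\<forall>u\<in>X. \<forall>v\<in>X. (u, v) \<in> (arcs_in X)\<^sup>*)"

lemma arcs_in_sym: "(u, v) \<in> (arcs_in X)\<^sup>* \<Longrightarrow> (v, u) \<in> (arcs_in X)\<^sup>*"
  by (rule symD[OF sym_rtrancl]) (auto simp: sym_def arcs_in_def adj_sym)

lemma connected_in_hubI:
  assumes "\<And>u. u \<in> X \<Longrightarrow> (h, u) \<in> (arcs_in X)\<^sup>*"
  shows "connected_in X"
  unfolding connected_in_def using assms arcs_in_sym by (meson rtrancl_trans)

lemma arcs_in_mono: "X \<subseteq> Y \<Longrightarrow> (u, v) \<in> (arcs_in X)\<^sup>* \<Longrightarrow> (u, v) \<in> (arcs_in Y)\<^sup>*"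
  by (rule rtrancl_mono[THEN subsetD, rotated]) (auto simp: arcs_in_def)

text \<open>Prepending vertices one by one keeps the path induced: a vertex already on it cuts the
  path back to itself, a new one is attached at its last neighbour.\<close>

lemma induced_path_exists:
  assumes "(u, v) \<in> (arcs_in X)\<^sup>*" "v \<in> X" "X \<subseteq> pverts G"
  obtains vs where "induced_path vs" "vs \<noteq> []" "hd vs = u" "last vs = v" "set vs \<subseteq> X"
  using assms(1)
proof (induction arbitrary: thesis rule: converse_rtrancl_induct)
  case base
  then show ?case using assms by (intro base[of "[v]"]) auto
next
  case (step y z)
  obtain vs where vs: "induced_path vs" "vs \<noteq> []" "hd vs = z" "last vs = v" "set vs \<subseteq> X"
    using step.IH by blast
  have yz: "y \<in> X" "y \<sim> z" using step.hyps by (auto simp: arcs_in_def)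
  show ?case
  proof (cases "y \<in> set vs")
    case True
    then obtain us ws where "vs = us @ y # ws" by (meson split_list)
    moreover have "induced_path ws'" if "induced_path (us' @ ws')" for us' ws'
      using that by (induction us') (auto dest: induced_path_tl)
    ultimately show ?thesis using vs by (intro step.prems[of "y # ws"]) auto
  next
    case False
    have "z \<in> set vs" using vs by (metis hd_in_set)
    then obtain us where "induced_path (y # us)" "us \<noteq> []" "last us = last vs" "set us \<subseteq> set vs"
      using induced_path_Cons_shortcut[OF vs(1) False] yz by blast
    then show ?thesis using vs yz by (intro step.prems[of "y # us"]) auto
  qed
qed

lemma induced_path_through:
  assumes X: "connected_in X" "X \<subseteq> pverts G"
    and s: "s \<notin> X" "s' \<notin> X" "s \<noteq> s'" "\<not> s \<sim> s'" "x \<in> X" "s \<sim> x" "x' \<in> X" "s' \<sim> x'"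
  obtains as where "induced_path (s # as @ [s'])" "as \<noteq> []" "set as \<subseteq> X"
proof -
  let ?Y = "insert s' X"
  have "(x, x') \<in> (arcs_in ?Y)\<^sup>*"
    using X s by (auto simp: connected_in_def intro: arcs_in_mono[of X])
  moreover have "(x', s') \<in> arcs_in ?Y" using s by (auto simp: arcs_in_def adj_sym)
  ultimately have "(x, s') \<in> (arcs_in ?Y)\<^sup>*" by simp
  moreover have "?Y \<subseteq> pverts G" using X s adj_verts by auto
  ultimately obtain vs where vs: "induced_path vs" "vs \<noteq> []" "hd vs = x" "last vs = s'" "set vs \<subseteq> ?Y"
    using induced_path_exists[of x s' ?Y] by blast
  have "x \<in> set vs" using vs by (metis hd_in_set)
  moreover have "s \<notin> set vs" using vs s by auto
  ultimately obtain us where us: "induced_path (s # us)" "us \<noteq> []" "last us = last vs" "set us \<subseteq> set vs"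
    using induced_path_Cons_shortcut[OF vs(1)] s by blast
  define as where "as = butlast us"
  have us_eq: "us = as @ [s']" using us vs by (metis as_def append_butlast_last_id)
  then have "as \<noteq> []" using us(1) s by auto
  moreover have "set as \<subseteq> X"
    using induced_path_distinct[OF us(1)] us_eq us(4) vs(5) by auto
  ultimately show ?thesis using that us(1) us_eq by blast
qed

lemma induced_path_append:
  assumes "induced_path (as @ [s])" "induced_path (s # bs)"
    and "\<And>a b. a \<in> set as \<Longrightarrow> b \<in> set bs \<Longrightarrow> a \<noteq> b \<and> \<not> a \<sim> b"
  shows "induced_path (as @ s # bs)"
  using assms
proof (induction as)
  case (Cons a as)
  have "induced_path (as @ [s])" using Cons.prems(1) induced_path_tl[of a "as @ [s]"] by simp
  then have IH: "induced_path (as @ s # bs)" using Cons by (intro Cons.IH) simp_all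
  have anti: "\<forall>b\<in>set bs. a \<noteq> b \<and> \<not> a \<sim> b" using Cons.prems(3) by simp
  show ?case
  proof (cases as)
    case Nil
    then show ?thesis using IH anti Cons.prems(1) by auto
  next
    fix a' as' assume "as = a' # as'"
    then show ?thesis using IH anti Cons.prems(1) by auto
  qed
qed simp

text \<open>Induced paths with the same ends on two anticomplete sides close up to an induced cycle.\<close>

lemma two_paths_short:
  assumes as: "induced_path (s # as @ [s'])" "as \<noteq> []"
    and bs: "induced_path (s' # bs @ [s])" "bs \<noteq> []"
    and anti: "\<And>a b. a \<in> set as \<Longrightarrow> b \<in> set bs \<Longrightarrow> a \<noteq> b \<and> \<not> a \<sim> b"
  shows "length as + length bs \<le> 3"
proof -
  have ap: "induced_path (as @ [s'])" using as(1) by (rule induced_path_tl)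
  have bp: "induced_path (s' # bs)"
  proof -
    have "induced_path xs" if "induced_path (xs @ ys)" for xs ys :: "'a list"
      using that
    proof (induction xs rule: induced_path.induct)
      case (2 x)
      then show ?case using induced_path_verts by force
    qed auto
    then show ?thesis using bs(1) by (metis append_Cons)
  qed
  let ?ys = "as @ s' # bs"
  have path: "induced_path ?ys" using induced_path_append[OF ap bp anti] .
  have s: "s \<in> pverts G" using induced_path_verts[OF as(1)] by auto
  have notin: "s \<notin> set ?ys"
    using induced_path_distinct[OF as(1)] induced_path_distinct[OF bs(1)] by auto
  have ends: "s \<sim> ?ys ! i \<longleftrightarrow> i = 0 \<or> i = length ?ys - 1" if i: "i < length ?ys" for i
  proof (cases "i \<le> length as")
    case True
    then have "?ys ! i = (s # as @ [s']) ! Suc i" by (auto simp: nth_append)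
    then have "s \<sim> ?ys ! i \<longleftrightarrow> i = 0"
      using induced_path_nth[OF as(1), of 0 "Suc i"] True by simp
    then show ?thesis using True bs(2) by (cases bs) auto
  next
    case False
    let ?j = "i - length as"
    have j: "?j < length (s' # bs @ [s])" using i False by auto
    have "?ys ! i = (s' # bs @ [s]) ! ?j"
      using i False by (auto simp: nth_append nth_Cons')
    moreover have "(s' # bs @ [s]) ! Suc (length bs) = s" by (simp add: nth_append)
    ultimately have "s \<sim> ?ys ! i \<longleftrightarrow> ?j = length bs"
      using induced_path_nth[OF bs(1), of "Suc (length bs)" ?j] j i False by auto
    then show ?thesis using False i as(2) by auto
  qed
  have "2 \<le> length ?ys" using as(2) bs(2) by (cases as) auto
  from induced_cycle_short[OF induced_cycle_Cons[OF path this s notin ends]]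
  show ?thesis by simp
qed

text \<open>Both ends of a diametral pair can be removed without disconnecting the set.\<close>

lemma nonadjacent_noncut_pair:
  assumes X: "finite X" "connected_in X" and ab: "a \<in> X" "b \<in> X" "a \<noteq> b" "\<not> a \<sim> b"
  obtains u v where "u \<in> X" "v \<in> X" "u \<noteq> v" "\<not> u \<sim> v"
    "connected_in (X - {u})" "connected_in (X - {v})"
proof -
  define R where "R = arcs_in X"
  define dist where "dist u v = (LEAST n. (u, v) \<in> R ^^ n)" for u v
  have dist: "(u, v) \<in> R ^^ dist u v" if "u \<in> X" "v \<in> X" for u v
  proof -
    have "(u, v) \<in> R\<^sup>*" using X that by (simp add: connected_in_def R_def)
    then have "\<exists>n. (u, v) \<in> R ^^ n" by (rule rtrancl_imp_relpow)
    then show ?thesis unfolding dist_def by (rule LeastI_ex)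
  qed
  have dist_le: "dist u v \<le> n" if "(u, v) \<in> R ^^ n" for u v n
    unfolding dist_def using that by (rule Least_le)
  have dist_sym: "dist u v = dist v u" for u v
  proof -
    have "(v, u) \<in> R ^^ n" if "(u, v) \<in> R ^^ n" for u v n
      using that
    proof (induction n arbitrary: v)
      case (Suc n)
      then obtain z where "(u, z) \<in> R ^^ n" "(z, v) \<in> R" by auto
      moreover from this have "(v, z) \<in> R" by (auto simp: R_def arcs_in_def adj_sym)
      ultimately show ?case using Suc.IH relpow_Suc_I2 by meson
    qed simp
    then have "(u, v) \<in> R ^^ n \<longleftrightarrow> (v, u) \<in> R ^^ n" for n
      by blast
    then show ?thesis by (simp add: dist_def)
  qed
  let ?D = "(\<lambda>(w, z). dist w z) ` (X \<times> X)"
  have D: "finite ?D" "?D \<noteq> {}" using X ab by auto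
  obtain u v where uv: "u \<in> X" "v \<in> X" and "dist u v = Max ?D"
    using Max_in[OF D] by auto
  then have max: "dist w z \<le> dist u v" if "w \<in> X" "z \<in> X" for w z
    using Max_ge[OF D(1), of "dist w z"] that by force
  \<comment> \<open>\<open>u\<close> is farthest from \<open>v\<close>, so the predecessor of any
    other vertex on a shortest path from \<open>v\<close> is too close to be \<open>u\<close>;
    shortest paths from \<open>v\<close> avoid \<open>u\<close>.\<close>
  have noncut: "connected_in (X - {u})" if uv: "u \<in> X" "v \<in> X"
    and max: "\<And>w. w \<in> X \<Longrightarrow> dist v w \<le> dist v u" for u v
  proof (rule connected_in_hubI[of _ v])
    fix w assume "w \<in> X - {u}"
    moreover have "w \<in> X - {u} \<Longrightarrow> dist v w = n \<Longrightarrow> (v, w) \<in> (arcs_in (X - {u}))\<^sup>*" for n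
    proof (induction n arbitrary: w)
      case 0
      then show ?case using dist[of v w] uv by simp
    next
      case (Suc n)
      then have "(v, w) \<in> R ^^ Suc n" using dist[of v w] uv by simp
      then obtain z where z: "(v, z) \<in> R ^^ n" "(z, w) \<in> R" by auto
      then have zX: "z \<in> X" by (auto simp: R_def arcs_in_def)
      have "dist v z = n"
      proof (rule antisym)
        show "dist v z \<le> n" using z dist_le by blast
        have "(v, w) \<in> R ^^ Suc (dist v z)" using dist[OF uv(2) zX] z(2) by auto
        then show "n \<le> dist v z" using dist_le Suc.prems by fastforce
      qed
      moreover have "z \<noteq> u" using max[of w] Suc.prems calculation by auto
      ultimately have "(v, z) \<in> (arcs_in (X - {u}))\<^sup>*" using Suc.IH zX by blast
      moreover have "(z, w) \<in> arcs_in (X - {u})"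
        using z(2) \<open>z \<noteq> u\<close> Suc.prems by (auto simp: R_def arcs_in_def)
      ultimately show ?case by simp
    qed
    ultimately show "(v, w) \<in> (arcs_in (X - {u}))\<^sup>*" by blast
  qed
  have "2 \<le> dist a b"
  proof (rule ccontr)
    assume "\<not> 2 \<le> dist a b"
    then consider "dist a b = 0" | "dist a b = 1" by linarith
    then show False using dist[OF ab(1,2)] ab by cases (auto simp: R_def arcs_in_def)
  qed
  then have two: "2 \<le> dist u v" using max[OF ab(1,2)] by linarith
  have "u \<noteq> v" using dist_le[of u u 0] two by auto
  moreover have "\<not> u \<sim> v" using dist_le[of u v 1] two uv by (auto simp: R_def arcs_in_def)
  moreover have "connected_in (X - {u})" using noncut[OF uv] max uv by (metis dist_sym)
  moreover have "connected_in (X - {v})" using noncut[OF uv(2,1)] max uv by (metis dist_sym)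
  ultimately show ?thesis using that uv by blast
qed

end

section \<open>Minimal separators and their dominators\<close>

text \<open>Being a component is replaced by connectedness and a neighbourhood equal to
  \<open>S\<close>. The two sides enter symmetrically, so every result about \<open>A\<close> holds
  for \<open>B\<close> by \<open>swap\<close>.\<close>

locale full_pair = C_graph G for G :: "'a pair_pre_digraph" +
  fixes S A B :: "'a set"
  assumes A: "connected_in A" "A \<noteq> {}" "nbhd G A = S" "A \<subseteq> pverts G"
    and B: "connected_in B" "B \<noteq> {}" "nbhd G B = S" "B \<subseteq> pverts G"
    and AB: "A \<inter> B = {}"
begin

lemma swap: "full_pair G S B A"
  using A B AB by unfold_locales auto

lemma nbr_A: "a \<in> A \<Longrightarrow> a \<sim> v \<Longrightarrow> v \<in> A \<or> v \<in> S"
  using A(3) adj_verts by (auto simp: nbhd_def)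

lemma S_A: "s \<in> S \<Longrightarrow> s \<notin> A"
  using A(3) by (auto simp: nbhd_def)

lemma S_nbr_A: "s \<in> S \<Longrightarrow> \<exists>a\<in>A. s \<sim> a"
  using A(3) by (auto simp: nbhd_def adj_sym)

lemma A_not_B: "a \<in> A \<Longrightarrow> a \<notin> B"
  using AB by auto

lemma nbr_B: "b \<in> B \<Longrightarrow> b \<sim> v \<Longrightarrow> v \<in> B \<or> v \<in> S"
  using B(3) adj_verts by (auto simp: nbhd_def)

lemma S_B: "s \<in> S \<Longrightarrow> s \<notin> B"
  using B(3) by (auto simp: nbhd_def)

lemma S_nbr_B: "s \<in> S \<Longrightarrow> \<exists>b\<in>B. s \<sim> b"
  using B(3) by (auto simp: nbhd_def adj_sym)

lemma A_B_anti: "a \<in> A \<Longrightarrow> b \<in> B \<Longrightarrow> \<not> a \<sim> b" "a \<in> A \<Longrightarrow> b \<in> B \<Longrightarrow> \<not> b \<sim> a"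
  using nbr_A S_B A_not_B adj_sym by blast+

text \<open>A neighbour of \<open>s\<close> in \<open>B\<close> sees nothing of \<open>A\<close>, so
  it attaches to the five-cycle at \<open>s\<close> alone.\<close>

lemma no_C5_one_in_S:
  assumes "s \<in> S" "a \<in> A" "b \<in> A" "c \<in> A" "d \<in> A"
    and "s \<sim> a" "a \<sim> b" "b \<sim> c" "c \<sim> d" "d \<sim> s"
    and "\<not> s \<sim> b" "\<not> s \<sim> c" "\<not> a \<sim> c" "\<not> a \<sim> d" "\<not> b \<sim> d"
  shows False
proof -
  obtain z where "z \<in> B" "s \<sim> z" using S_nbr_B assms(1) by blast
  then show False
    using no_extended_C5_one[OF assms(6-15), of z] assms(2-5) A_B_anti(2) adj_sym by blast
qed

text \<open>A neighbour of \<open>s\<close> in \<open>B\<close> attaches to the five-cycle at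
  \<open>s\<close> only or at the consecutive vertices \<open>s'\<close> and \<open>s\<close>;
  either way it extends the cycle.\<close>

lemma no_C5_two_in_S:
  assumes "s \<in> S" "s' \<in> S" "a \<in> A" "b \<in> A" "c \<in> A"
    and "s' \<sim> s" "s \<sim> a" "a \<sim> b" "b \<sim> c" "c \<sim> s'"
    and "\<not> s' \<sim> a" "\<not> s' \<sim> b" "\<not> s \<sim> b" "\<not> s \<sim> c" "\<not> a \<sim> c"
  shows False
proof -
  obtain z where z: "z \<in> B" "z \<sim> s" using S_nbr_B assms(1) adj_sym by blast
  have anti: "\<not> z \<sim> a" "\<not> z \<sim> b" "\<not> z \<sim> c" using z(1) assms(3-5) A_B_anti(2) by blast+
  have "\<not> a \<sim> s'" "\<not> b \<sim> s'" using assms(11,12) adj_sym by blast+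
  show False
  proof (cases "z \<sim> s'")
    case True
    then show False
      using no_extended_C5_two[OF assms(6-15), of z] anti z by blast
  next
    case False
    then show False
      using no_extended_C5_one[OF assms(7-10) assms(6) assms(13,14,15) \<open>\<not> a \<sim> s'\<close> \<open>\<not> b \<sim> s'\<close> z(2)] anti
      by blast
  qed
qed

text \<open>\<open>s'\<close> and \<open>s\<close> are also joined through \<open>B\<close>, with at
  least one inner vertex. Both paths close to an induced cycle, and its length of at most five
  leaves two inner vertices for \<open>as\<close>.\<close>

lemma induced_path_A_short:
  assumes "induced_path (s # as @ [s'])" "as \<noteq> []" "set as \<subseteq> A" "s \<in> S" "s' \<in> S" "s \<noteq> s'" "\<not> s \<sim> s'"
  shows "length as \<le> 2"
proof -
  obtain b b' where b: "b \<in> B" "s \<sim> b" "b' \<in> B" "s' \<sim> b'" using S_nbr_B assms by meson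
  have nS: "s \<notin> B" "s' \<notin> B" using S_B assms by blast+
  have "\<not> s' \<sim> s" "s' \<noteq> s" using assms adj_sym by blast+
  then obtain bs where bs: "induced_path (s' # bs @ [s])" "bs \<noteq> []" "set bs \<subseteq> B"
    using induced_path_through[OF B(1,4) nS(2,1)] b by metis
  have "length as + length bs \<le> 3"
    using two_paths_short[OF assms(1,2) bs(1,2)] assms(3) bs(3) A_B_anti(1) A_not_B by blast
  then show ?thesis using bs(2) by (cases bs) auto
qed

lemma no_induced_path_A_three:
  assumes "s \<in> S" "a \<in> A" "b \<in> A" "c \<in> A" "s' \<in> S"
    and "s \<sim> a" "a \<sim> b" "b \<sim> c" "c \<sim> s'"
    and "\<not> s \<sim> b" "\<not> s \<sim> c" "\<not> s \<sim> s'" "\<not> a \<sim> c" "\<not> a \<sim> s'" "\<not> b \<sim> s'"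
  shows False
proof -
  have "s \<noteq> s'" using assms adj_sym by blast
  have "induced_path (s # [a, b, c] @ [s'])" using assms \<open>s \<noteq> s'\<close> adj_verts S_A by auto
  from induced_path_A_short[OF this _ _ assms(1,5) \<open>s \<noteq> s'\<close> assms(12)] show False
    using assms(2-4) by simp
qed

lemma no_induced_path_A_four:
  assumes "s \<in> S" "a \<in> A" "b \<in> A" "c \<in> A" "d \<in> A" "s' \<in> S"
    and "s \<sim> a" "a \<sim> b" "b \<sim> c" "c \<sim> d" "d \<sim> s'"
    and "\<not> s \<sim> b" "\<not> s \<sim> c" "\<not> s \<sim> d" "\<not> s \<sim> s'" "\<not> a \<sim> c" "\<not> a \<sim> d" "\<not> a \<sim> s'"
    and "\<not> b \<sim> d" "\<not> b \<sim> s'" "\<not> c \<sim> s'"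
  shows False
proof -
  have "s \<noteq> s'" using assms adj_sym by blast
  have "a \<noteq> d" using assms by blast
  have "induced_path (s # [a, b, c, d] @ [s'])" using assms \<open>s \<noteq> s'\<close> adj_verts S_A \<open>a \<noteq> d\<close> by auto
  from induced_path_A_short[OF this _ _ assms(1,6) \<open>s \<noteq> s'\<close> assms(15)] show False
    using assms(2-5) by simp
qed

text \<open>A common neighbour of \<open>s\<close> and \<open>s'\<close> in \<open>B\<close> closes the path \<open>s, x, x', s'\<close> to a five-cycle, which
  \<open>z\<close> would extend.\<close>

lemma no_triangle_on_P4_middle:
  assumes "s \<in> S" "s' \<in> S" "x \<in> A" "x' \<in> A" "z \<in> A"
    and "s \<sim> x" "x \<sim> x'" "x' \<sim> s'" "z \<sim> x" "z \<sim> x'"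
    and "\<not> s \<sim> s'" "\<not> s \<sim> x'" "\<not> x \<sim> s'" "\<not> z \<sim> s" "\<not> z \<sim> s'"
  shows False
proof -
  have ne: "s \<noteq> s'" using assms(6,13) adj_sym by blast
  obtain b b' where b: "b \<in> B" "s \<sim> b" "b' \<in> B" "s' \<sim> b'" using S_nbr_B assms by meson
  have nS: "s \<notin> B" "s' \<notin> B" using S_B assms by blast+
  have "\<not> s' \<sim> s" "s' \<noteq> s" using assms ne adj_sym by blast+
  then obtain bs where bs: "induced_path (s' # bs @ [s])" "bs \<noteq> []" "set bs \<subseteq> B"
    using induced_path_through[OF B(1,4) nS(2,1)] b by metis
  have "induced_path (s # [x, x'] @ [s'])" using assms ne adj_verts S_A by auto
  from two_paths_short[OF this _ bs(1,2)]
  have "length [x, x'] + length bs \<le> 3"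
    using assms(3,4) bs(3) A_B_anti(1) A_not_B by auto
  then have "length bs = 1" using bs(2) by (cases bs) auto
  then obtain c where "bs = [c]" by (auto simp: length_Suc_conv)
  then have c: "c \<in> B" "s' \<sim> c" "c \<sim> s" using bs by auto
  have "\<not> x \<sim> c" "\<not> x' \<sim> c" "\<not> z \<sim> c" using c assms A_B_anti by blast+
  moreover have "\<not> x' \<sim> s" "\<not> s' \<sim> s" using assms adj_sym by blast+
  ultimately show False
    using no_extended_C5_two[OF assms(7,8) c(2,3) assms(6) assms(13), of z] assms(9,10,14,15) by blast
qed

section \<open>Minimum dominators\<close>

definition dominator :: "'a set \<Rightarrow> bool" where
  "dominator X \<longleftrightarrow> X \<subseteq> A \<and> X \<noteq> {} \<and> connected_in X \<and> (\<forall>s\<in>S. \<exists>x\<in>X. s \<sim> x)"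

definition min_dominator :: "'a set \<Rightarrow> bool" where
  "min_dominator X \<longleftrightarrow> dominator X \<and> (\<forall>X'. dominator X' \<longrightarrow> card X \<le> card X')"

lemma min_dominator_exists: "\<exists>X. min_dominator X"
proof -
  have "dominator A" using A S_nbr_A by (auto simp: dominator_def)
  then show ?thesis
    using ex_has_least_nat[of dominator A card] by (auto simp: min_dominator_def)
qed

lemma finite_A: "finite A"
  using A(4) pair_finite_verts finite_subset by blast

text \<open>A non-clique contains nonadjacent \<open>u\<close>, \<open>v\<close> each of which can
  be removed without disconnecting it, so by minimality each has a private neighbour in
  \<open>S\<close>. An induced path from \<open>u\<close> to \<open>v\<close>, prolonged by both
  private neighbours, is too long if these are nonadjacent and closes to a forbidden cycle
  otherwise.\<close>

lemma min_dominator_clique: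
  assumes X: "min_dominator X" and ab: "a \<in> X" "b \<in> X" "a \<noteq> b"
  shows "a \<sim> b"
proof (rule ccontr)
  assume "\<not> a \<sim> b"
  have XA: "X \<subseteq> A" "connected_in X" "finite X"
    using X finite_A finite_subset by (auto simp: min_dominator_def dominator_def)
  have dom: "\<exists>x\<in>X. s \<sim> x" if "s \<in> S" for s
    using X that by (auto simp: min_dominator_def dominator_def)
  obtain u v where uv: "u \<in> X" "v \<in> X" "u \<noteq> v" "\<not> u \<sim> v"
    "connected_in (X - {u})" "connected_in (X - {v})"
    using nonadjacent_noncut_pair[OF XA(3,2) ab \<open>\<not> a \<sim> b\<close>] by metis
  have private_nbr: "\<exists>s\<in>S. s \<sim> u \<and> (\<forall>x\<in>X - {u}. \<not> s \<sim> x)"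
    if "u \<in> X" "v \<in> X" "u \<noteq> v" "connected_in (X - {u})" for u v
  proof (rule ccontr)
    assume "\<not> ?thesis"
    then have "\<exists>x\<in>X - {u}. s \<sim> x" if "s \<in> S" for s
      using that dom[OF that] by (metis DiffI singletonD)
    moreover have "v \<in> X - {u}" using that by simp
    ultimately have "dominator (X - {u})"
      using that(4) XA(1) unfolding dominator_def by blast
    then have "card X \<le> card (X - {u})" using X by (auto simp: min_dominator_def)
    then show False using that XA(3) by (metis card_Diff1_less leD)
  qed
  obtain s where s: "s \<in> S" "s \<sim> u" "\<And>x. x \<in> X \<Longrightarrow> x \<noteq> u \<Longrightarrow> \<not> s \<sim> x"
    using private_nbr[OF uv(1-3,5)] by blast
  obtain s' where s': "s' \<in> S" "s' \<sim> v" "\<And>x. x \<in> X \<Longrightarrow> x \<noteq> v \<Longrightarrow> \<not> s' \<sim> x"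
    using private_nbr[OF uv(2,1) uv(3)[symmetric] uv(6)] by blast
  have "(u, v) \<in> (arcs_in X)\<^sup>*" using XA(2) uv by (auto simp: connected_in_def)
  then obtain vs where vs: "induced_path vs" "vs \<noteq> []" "hd vs = u" "last vs = v" "set vs \<subseteq> X"
    using induced_path_exists[of u v X] uv(2) XA A by (metis subset_trans)
  obtain ms where ms: "vs = u # ms @ [v]"
    using vs uv(3) by (metis append_butlast_last_id last.simps list.collapse)
  have "ms \<noteq> []" using vs(1) ms uv(4) by auto
  have mem: "u \<in> X" "v \<in> X" "set ms \<subseteq> X" "u \<notin> set ms" "v \<notin> set ms"
    using vs(5) ms induced_path_distinct[OF vs(1)] by auto
  have nS: "s \<notin> X" "s' \<notin> X" "s \<noteq> s'" using S_A s s' XA(1) uv by blast+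
  have p2: "induced_path (vs @ [s'])"
  proof -
    have "induced_path ((u # ms) @ [v])" using vs(1) ms by simp
    moreover have "induced_path (v # [s'])" using s'(2) adj_sym adj_verts by auto
    moreover have "a \<noteq> b \<and> \<not> a \<sim> b" if "a \<in> set (u # ms)" "b \<in> set [s']" for a b
    proof -
      have "a \<in> X" "a \<noteq> v" "b = s'" using that mem uv(3) by auto
      then show ?thesis using s'(3) nS(2) adj_sym by blast
    qed
    ultimately have "induced_path ((u # ms) @ v # [s'])" by (rule induced_path_append)
    then show ?thesis using ms by simp
  qed
  show False
  proof (cases "s \<sim> s'")
    case False
    have "induced_path (s # vs @ [s'])"
      using p2 ms s mem nS uv(3) False by (auto dest: adj_verts)
    then have "length vs \<le> 2"
      using induced_path_A_short vs XA(1) s s' nS False by (metis subset_trans)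
    then show False using ms \<open>ms \<noteq> []\<close> by (cases ms) auto
  next
    case True
    have "induced_cycle G (s # vs @ [s'])"
    proof (rule induced_cycle_Cons[OF p2])
      fix i assume i: "i < length (vs @ [s'])"
      consider "i = 0" | "0 < i" "i < length vs" | "i = length vs" using i by fastforce
      then show "s \<sim> (vs @ [s']) ! i \<longleftrightarrow> i = 0 \<or> i = length (vs @ [s']) - 1"
      proof cases
        case 1
        then show ?thesis using s ms by simp
      next
        case 2
        then have "vs ! i \<in> X" using vs(5) by auto
        moreover have "vs ! i \<noteq> u"
          using 2 induced_path_distinct[OF vs(1)] ms by (metis distinct_conv_nth less_trans nat_neq_iff nth_Cons_0)
        ultimately show ?thesis using 2 s by (auto simp: nth_append)
      next
        case 3
        then show ?thesis using True by simp
      qed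
    qed (use adj_verts(1)[OF True] nS mem ms in auto)
    \<comment> \<open>The cycle consists of \<open>s\<close>, \<open>u\<close>, \<open>ms\<close>,
      \<open>v\<close>, \<open>s'\<close>, so it has exactly five vertices, two of them adjacent in
      \<open>S\<close>.\<close>
    from induced_cycle_short[OF this] have "length ms = 1"
      using ms \<open>ms \<noteq> []\<close> by (cases ms) auto
    then obtain w where "ms = [w]" by (auto simp: length_Suc_conv)
    then have w: "u \<sim> w" "w \<sim> v" "w \<in> X" "w \<noteq> u" "w \<noteq> v" using vs(1) ms mem by auto
    have "s' \<sim> s" "v \<sim> s'" using True s' adj_sym by blast+
    then show False
      using no_C5_two_in_S[OF s(1) s'(1), of u w v] w uv s s' XA(1) by blast
  qed
qed

end

context full_pair
begin

lemma dominatorD: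
  assumes "min_dominator X"
  shows "X \<subseteq> A" "finite X" "X \<noteq> {}" "\<And>s. s \<in> S \<Longrightarrow> \<exists>x\<in>X. s \<sim> x"
  using assms finite_A finite_subset by (auto simp: min_dominator_def dominator_def)

text \<open>In the clique, \<open>x\<close>, \<open>x'\<close> and \<open>z\<close> form a triangle
  on the middle edge of the path \<open>s, x, x', s'\<close>; a \<open>z\<close> missed by both ends
  contradicts \<open>no_triangle_on_P4_middle\<close>.\<close>

lemma dominator_covered:
  assumes X: "min_dominator X" and "s \<in> S" "s' \<in> S" "\<not> s \<sim> s'"
    and "x \<in> X" "s \<sim> x" "\<not> s' \<sim> x" "x' \<in> X" "s' \<sim> x'" "\<not> s \<sim> x'" and "z \<in> X"
  shows "z \<sim> s \<or> z \<sim> s'"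
proof (rule ccontr)
  assume n: "\<not> (z \<sim> s \<or> z \<sim> s')"
  have "x \<sim> x'" "z \<sim> x" "z \<sim> x'"
    using min_dominator_clique[OF X] assms n adj_sym by metis+
  moreover have "x \<in> A" "x' \<in> A" "z \<in> A" using dominatorD(1)[OF X] assms by auto
  ultimately show False
    using no_triangle_on_P4_middle[of s s' x x' z] assms n adj_sym by blast
qed

text \<open>Minimality as an exchange along the induced path \<open>p, x, v, y\<close>: dropping the
  counted vertices \<open>Z\<close> and adding \<open>v\<close> and \<open>x\<close> gives another
  dominator, so nothing is gained only if \<open>Z\<close> has at most two elements.\<close>

lemma dominator_exchange:
  assumes X: "min_dominator X" and "p \<in> X" and v: "v \<in> A" "x \<in> A" "y \<in> S"
    and "v \<sim> y" "\<not> v \<sim> p" "\<not> y \<sim> p" "x \<sim> v" "x \<sim> p" "\<not> x \<sim> y"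
  shows "card {z \<in> X. \<not> z \<sim> y \<and> \<not> z \<sim> v} \<le> 2"
proof -
  define Z where "Z = {z \<in> X. \<not> z \<sim> y \<and> \<not> z \<sim> v}"
  define X1 where "X1 = (X - Z) \<union> {v, x}"
  note XD = dominatorD[OF X]
  have sym: "y \<sim> v" "v \<sim> x" "\<not> y \<sim> x" "\<not> p \<sim> y" "p \<sim> x" "\<not> p \<sim> v"
    using assms adj_sym by blast+
  have pA: "p \<in> A" using XD assms by auto
  have clique: "a \<sim> b" if "a \<in> X" "b \<in> X" "a \<noteq> b" for a b
    using min_dominator_clique[OF X that] .
  have "(x, z) \<in> (arcs_in X1)\<^sup>*" if z: "z \<in> X1" for z
  proof -
    have xv: "(x, v) \<in> arcs_in X1" using assms by (auto simp: arcs_in_def X1_def)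
    consider "z = x" | "z = v" | "z \<in> X" "z \<sim> v" | "z \<in> X" "z \<sim> y" "\<not> z \<sim> v"
      using z by (auto simp: X1_def Z_def)
    then show ?thesis
    proof cases
      case 3
      then have "(v, z) \<in> arcs_in X1" using z adj_sym by (auto simp: arcs_in_def X1_def)
      then show ?thesis using xv by simp
    next
      case 4
      then have "z \<in> A" "p \<sim> z" "\<not> v \<sim> z" using clique[of p z] assms XD sym adj_sym by blast+
      \<comment> \<open>Otherwise \<open>y, v, x, p, z\<close> is an induced five-cycle that meets
        \<open>S\<close> in \<open>y\<close> alone.\<close>
      then have "x \<sim> z"
        using no_C5_one_in_S[OF v(3,1,2) pA, of z] 4 sym assms by blast
      then have "(x, z) \<in> arcs_in X1" using z by (auto simp: arcs_in_def X1_def)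
      then show ?thesis by simp
    qed (use xv in auto)
  qed
  then have "connected_in X1" by (rule connected_in_hubI)
  \<comment> \<open>An undominated \<open>s\<close> has all its neighbours in \<open>X\<close>
    inside \<open>Z\<close>. If it misses \<open>y\<close>, it starts an induced path
    \<open>s, p, x, v, y\<close>; if it sees \<open>y\<close>, it closes an induced five- or
    six-cycle with \<open>x, v, y\<close>.\<close>
  moreover have "\<exists>x\<in>X1. s \<sim> x" if s: "s \<in> S" for s
  proof (rule ccontr)
    assume "\<not> ?thesis"
    then have sv: "\<not> s \<sim> v" "\<not> s \<sim> x" and sX: "\<And>z. z \<in> X \<Longrightarrow> s \<sim> z \<Longrightarrow> z \<in> Z"
      by (auto simp: X1_def)
    obtain z where z: "z \<in> X" "s \<sim> z" using XD(4) s by blast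
    then have "z \<in> Z" using sX by blast
    then have zn: "\<not> z \<sim> y" "\<not> z \<sim> v" by (auto simp: Z_def)
    have zA: "z \<in> A" using XD z by auto
    obtain q where q: "q \<in> X" "y \<sim> q" using XD(4) v by blast
    then have "q \<notin> Z" using adj_sym by (auto simp: Z_def)
    then have sq: "\<not> s \<sim> q" using q sX by blast
    show False
    proof (cases "s \<sim> y")
      case False
      have "p \<sim> s \<or> p \<sim> y"
        using dominator_covered[OF X s v(3) False z _ q sq \<open>p \<in> X\<close>] zn adj_sym by blast
      then have "s \<sim> p" using sym adj_sym by blast
      then show False
        using no_induced_path_A_three[OF s pA v(2,1,3)] sym assms sv False by blast
    next
      case True
      then have ys: "y \<sim> s" using adj_sym by blast
      have nvs: "\<not> v \<sim> s" "\<not> x \<sim> s" "\<not> v \<sim> z" "\<not> y \<sim> z" using sv zn adj_sym by blast+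
      have three: False if "s \<sim> w" "w \<sim> x" "\<not> y \<sim> w" "\<not> w \<sim> v" "w \<in> A" for w
        using no_C5_two_in_S[OF s v(3) that(5) v(2,1) ys that(1,2)] that sv sym assms by blast
      show False
      proof (cases "z \<sim> x \<or> z = p")
        case True
        then show False using three[of z] z zn nvs zA sym by blast
      next
        case nzx: False
        have "\<not> s \<sim> p" using three[of p] pA sym assms by blast
        have "z \<sim> p" using clique nzx z assms by blast
        then show False
          using no_induced_C6[of s z p x v y] z True sv zn nzx \<open>\<not> s \<sim> p\<close> sym assms ys adj_sym by blast
      qed
    qed
  qed
  ultimately have "dominator X1" using XD(1) v by (auto simp: dominator_def X1_def)
  then have "card X \<le> card X1" using X by (simp add: min_dominator_def)
  also have "\<dots> \<le> card (X - Z) + card {v, x}" unfolding X1_def by (rule card_Un_le)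
  also have "card {v, x} \<le> 2" by (simp add: card_insert_if)
  also have "card (X - Z) = card X - card Z" by (rule card_Diff_subset) (use XD in \<open>auto simp: Z_def\<close>)
  finally have "card X \<le> card X - card Z + 2" by simp
  moreover have "card Z \<le> card X" using XD by (intro card_mono) (auto simp: Z_def)
  ultimately show ?thesis unfolding Z_def[symmetric] by linarith
qed

text \<open>The exchange tolerates two members that miss both \<open>v\<close> and \<open>y\<close>;
  three of them are a contradiction. This is why three members of each clique become
  parameters.\<close>

lemma no_dominator_exchange:
  assumes "min_dominator X" "{p, p2, p3} \<subseteq> X" "distinct [p, p2, p3]" "v \<in> A" "x \<in> A" "y \<in> S"
    and "v \<sim> y" "x \<sim> v" "x \<sim> p" "\<not> x \<sim> y"
    and "\<And>z. z \<in> {p, p2, p3} \<Longrightarrow> \<not> v \<sim> z \<and> \<not> y \<sim> z"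
  shows False
proof -
  have "card {z \<in> X. \<not> z \<sim> y \<and> \<not> z \<sim> v} \<le> 2"
    using dominator_exchange[OF assms(1), of p v x y] assms by blast
  moreover have "card {p, p2, p3} \<le> card {z \<in> X. \<not> z \<sim> y \<and> \<not> z \<sim> v}"
  proof (rule card_mono)
    show "finite {z \<in> X. \<not> z \<sim> y \<and> \<not> z \<sim> v}" using dominatorD(2)[OF assms(1)] by simp
    show "{p, p2, p3} \<subseteq> {z \<in> X. \<not> z \<sim> y \<and> \<not> z \<sim> v}"
      using assms(2,11) adj_sym by blast
  qed
  ultimately show False using assms(3) by simp
qed

text \<open>\<open>f\<close> and \<open>g\<close> are joined through one or two vertices of the
  clique. Adding \<open>w\<close> and \<open>w'\<close> gives an induced path with three or four
  inner vertices in \<open>A\<close> or, if \<open>w\<close> and \<open>w'\<close> are adjacent, an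
  induced cycle of length five or six.\<close>

lemma private_nbrs_comparable:
  assumes X: "min_dominator X0" "X \<subseteq> X0"
    and f: "f \<in> A" "x \<in> X" "f \<sim> x" and g: "g \<in> A" "x' \<in> X" "g \<sim> x'" and "\<not> f \<sim> g"
    and w: "w \<in> S" "w \<sim> f" "\<not> w \<sim> g" "\<And>x. x \<in> X \<Longrightarrow> \<not> w \<sim> x"
    and w': "w' \<in> S" "w' \<sim> g" "\<not> w' \<sim> f" "\<And>x. x \<in> X \<Longrightarrow> \<not> w' \<sim> x"
  shows False
proof -
  have sym: "\<not> g \<sim> f" "f \<sim> w" "g \<sim> w'" "x \<sim> f" "x' \<sim> g" "\<not> f \<sim> w'" using assms adj_sym by blast+
  have xw: "\<not> z \<sim> w" "\<not> z \<sim> w'" if "z \<in> X" for z using that assms adj_sym by blast+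
  have xA: "x \<in> A" "x' \<in> A" using dominatorD(1)[OF X(1)] X(2) assms by auto
  have common: False if z: "z \<in> X" "f \<sim> z" "z \<sim> g" for z
  proof -
    have zA: "z \<in> A" using dominatorD(1)[OF X(1)] X(2) z by auto
    show False
    proof (cases "w' \<sim> w")
      case True
      show False
        using no_C5_two_in_S[OF w(1) w'(1) f(1) zA g(1) True w(2) z(2,3)] z sym w w' assms(9) by blast
    next
      case False
      then have "\<not> w \<sim> w'" using adj_sym by blast
      then show False
        using no_induced_path_A_three[OF w(1) f(1) zA g(1) w'(1) w(2) z(2,3)] z sym w w' assms(9) xw by blast
    qed
  qed
  then have ne: "\<not> x \<sim> g" "\<not> f \<sim> x'" "x \<noteq> x'" using f g sym by blast+
  then have xx: "x \<sim> x'" using min_dominator_clique[OF X(1)] X(2) f g by blast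
  show False
  proof (cases "w' \<sim> w")
    case True
    then show False
      using no_induced_C6[of w f x x' g w'] w w' f g ne xx xw sym assms(9) by blast
  next
    case False
    then have "\<not> w \<sim> w'" using adj_sym by blast
    then show False
      using no_induced_path_A_four[OF w(1) f(1) xA g(1) w'(1) w(2) f(3) xx] w w' f g ne xw sym assms(9) by blast
  qed
qed

end

text \<open>An \<open>f\<close> with largest \<open>N f\<close> contains \<open>N g\<close> for
  every \<open>g\<close> not related to it, by comparability. The recursion continues among the
  elements related to \<open>f\<close>, which keeps \<open>K\<close> a clique.\<close>

lemma greedy_clique:
  fixes N :: "'a \<Rightarrow> 'b set"
  assumes "finite P" and fin: "\<And>f. finite (N f)"
    and comp: "\<And>f g. f \<in> P \<Longrightarrow> g \<in> P \<Longrightarrow> \<not> E f g \<Longrightarrow> N f \<subseteq> N g \<or> N g \<subseteq> N f"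
    and E: "\<And>f. \<not> E f f" "\<And>f g. E f g \<Longrightarrow> E g f"
  obtains K where "K \<subseteq> P" "\<And>f g. f \<in> K \<Longrightarrow> g \<in> K \<Longrightarrow> f \<noteq> g \<Longrightarrow> E f g"
    "\<And>f. f \<in> P \<Longrightarrow> N f \<subseteq> (\<Union>g\<in>K. N g)"
  using assms(1) comp
proof (induction P arbitrary: thesis rule: finite_psubset_induct)
  case (psubset P)
  show ?case
  proof (cases "P = {}")
    case True
    then show ?thesis using psubset.prems(1)[of "{}"] by simp
  next
    case False
    let ?C = "(\<lambda>f. card (N f)) ` P"
    have "Max ?C \<in> ?C" using False psubset.hyps(1) by (intro Max_in) auto
    then obtain f where f: "f \<in> P" "card (N f) = Max ?C" by (metis imageE)
    have max: "card (N g) \<le> card (N f)" if "g \<in> P" for g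
      using that psubset.hyps(1) f(2) by simp
    let ?P = "{g \<in> P. E f g}"
    have "?P \<subset> P" using f E by auto
    then obtain K where K: "K \<subseteq> ?P" "\<And>f g. f \<in> K \<Longrightarrow> g \<in> K \<Longrightarrow> f \<noteq> g \<Longrightarrow> E f g"
      "\<And>g. g \<in> ?P \<Longrightarrow> N g \<subseteq> (\<Union>g\<in>K. N g)"
      using psubset.IH[of ?P] psubset.prems(2) by (metis (no_types, lifting) mem_Collect_eq)
    show ?thesis
    proof (rule psubset.prems(1)[of "insert f K"])
      show "insert f K \<subseteq> P" using K(1) f by auto
      show "E g h" if "g \<in> insert f K" "h \<in> insert f K" "g \<noteq> h" for g h
        using that K(1,2) E(2) by blast
      show "N g \<subseteq> (\<Union>g\<in>insert f K. N g)" if g: "g \<in> P" for g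
      proof (cases "E f g")
        case True
        then show ?thesis using K(3) g by blast
      next
        case False
        then have "N g \<subseteq> N f"
          using psubset.prems(2)[OF f(1) g] max[OF g] card_seteq[OF fin, of "N f" g] by blast
        then show ?thesis by blast
      qed
    qed
  qed
qed

lemma (in C_graph) colorable_clique_card:
  assumes F: "induced_subgraph (with_proj F) (with_proj G)" "colorable k F"
    and K: "K \<subseteq> pverts F" "\<And>f g. f \<in> K \<Longrightarrow> g \<in> K \<Longrightarrow> f \<noteq> g \<Longrightarrow> f \<sim> g"
  shows "card K \<le> k"
proof -
  obtain I where I: "(\<Union>i<k. I i) = pverts F" "\<And>i. i < k \<Longrightarrow> independent_set F (I i)"
    using F(2) by (auto simp: colorable_def)
  have arcs: "(f, g) \<in> parcs F" if "f \<in> pverts F" "g \<in> pverts F" "f \<sim> g" for f g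
    using F(1) that unfolding induced_subgraph_def by (auto simp: arcs_ends_def)
  obtain c where c: "\<And>v. v \<in> K \<Longrightarrow> c v < k \<and> v \<in> I (c v)"
    using I(1) K(1) by (metis UN_E lessThan_iff subsetD)
  have "inj_on c K"
  proof (rule inj_onI, rule ccontr)
    fix f g assume fg: "f \<in> K" "g \<in> K" "c f = c g" "f \<noteq> g"
    then have "(f, g) \<in> parcs F" using arcs K by blast
    moreover have "(f, g) \<notin> parcs F"
      using I(2)[of "c f"] c[OF fg(1)] c[OF fg(2)] fg(3) by (auto simp: independent_set_def)
    ultimately show False by blast
  qed
  moreover have "c ` K \<subseteq> {..<k}" using c by auto
  ultimately show ?thesis using card_inj_on_le[of c K "{..<k}"] by simp
qed

text \<open>The greedy clique, taken among the vertices of \<open>F\<close> in \<open>A\<close> that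
  \<open>X\<close> sees, is a clique of \<open>F\<close>, so colourability bounds it by
  \<open>k\<close>. It sees whatever part of \<open>S\<close> these vertices see and
  \<open>X\<close> does not.\<close>

lemma (in full_pair) private_nbrs_cover:
  assumes X: "min_dominator X0" "set X \<subseteq> X0" "p \<in> set X"
    and F: "induced_subgraph (with_proj F) (with_proj G)" "colorable k F"
  obtains K where "length K = k" "set K \<subseteq> A"
    "\<And>f w x. f \<in> pverts F \<Longrightarrow> f \<in> A \<Longrightarrow> x \<in> set X \<Longrightarrow> f \<sim> x \<Longrightarrow> w \<in> S \<Longrightarrow> w \<sim> f \<Longrightarrow>
       \<exists>y\<in>set X \<union> set K. w \<sim> y"
proof -
  define N where "N f = {w \<in> S. w \<sim> f \<and> (\<forall>x\<in>set X. \<not> w \<sim> x)}" for f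
  define P where "P = {f \<in> pverts F \<inter> A. \<exists>x\<in>set X. f \<sim> x}"
  have "S \<subseteq> pverts G" using A(3) by (auto simp: nbhd_def)
  then have fin: "finite (N f)" for f
    by (intro finite_subset[OF _ pair_finite_verts]) (auto simp: N_def)
  have finP: "finite P" using finite_A by (simp add: P_def)
  have comp: "N f \<subseteq> N g \<or> N g \<subseteq> N f" if fg: "f \<in> P" "g \<in> P" "\<not> f \<sim> g" for f g
  proof (rule ccontr)
    assume "\<not> ?thesis"
    then obtain w w' where w: "w \<in> N f" "w \<notin> N g" "w' \<in> N g" "w' \<notin> N f" by blast
    obtain x x' where "x \<in> set X" "f \<sim> x" "x' \<in> set X" "g \<sim> x'"
      using fg by (auto simp: P_def)
    then show False
      using private_nbrs_comparable[OF X(1,2), of f x g x' w w'] w fg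
      by (auto simp: N_def P_def)
  qed
  obtain K where K: "K \<subseteq> P" "\<And>f g. f \<in> K \<Longrightarrow> g \<in> K \<Longrightarrow> f \<noteq> g \<Longrightarrow> f \<sim> g"
    "\<And>f. f \<in> P \<Longrightarrow> N f \<subseteq> (\<Union>g\<in>K. N g)"
  proof (rule greedy_clique[of P N adj])
    show "g \<sim> f" if "f \<sim> g" for f g using that adj_sym by blast
  qed (use finP fin comp in auto)
  have "card K \<le> k" using colorable_clique_card[OF F _ K(2)] K(1) by (auto simp: P_def)
  have "finite K" using K(1) finP finite_subset by blast
  then obtain ks where ks: "set ks = K" "distinct ks" using finite_distinct_list by blast
  \<comment> \<open>Padding with \<open>p\<close>, a member of \<open>X\<close>, makes the number of
    parameters exactly \<open>k\<close> and leaves what \<open>X\<close> and \<open>K\<close> see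
    together unchanged.\<close>
  let ?K = "ks @ replicate (k - card K) p"
  have "length ?K = k" using ks \<open>card K \<le> k\<close> by (simp flip: distinct_card)
  moreover have "set ?K \<subseteq> A"
    using ks K(1) dominatorD(1)[OF X(1)] X(2,3) by (auto simp: P_def split: if_splits)
  moreover have "\<exists>y\<in>set X \<union> set ?K. w \<sim> y"
    if "f \<in> pverts F" "f \<in> A" "x \<in> set X" "f \<sim> x" "w \<in> S" "w \<sim> f" for f w x
  proof (cases "\<exists>x\<in>set X. w \<sim> x")
    case False
    then have "w \<in> N f" using that by (auto simp: N_def)
    moreover have "f \<in> P" using that by (auto simp: P_def)
    ultimately obtain g where "g \<in> K" "w \<in> N g" using K(3) by blast
    then show ?thesis using ks by (auto simp: N_def)
  qed blast
  ultimately show ?thesis using that by blast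
qed

section \<open>Separator vertices as first-order definable sets\<close>

text \<open>For \<open>v\<close> in \<open>S\<close> the certificate is a neighbour in the clique of
  \<open>B\<close>: \<open>q\<close> itself or some \<open>u\<close> adjacent to \<open>q\<close>.
  For \<open>v\<close> in \<open>A\<close> such a \<open>u\<close> would see both sides and hence
  lie in \<open>S\<close>; if \<open>v\<close> is in \<open>F\<close>, then \<open>X\<close> or
  \<open>K\<close> sees \<open>u\<close>, and the certificate fails.\<close>

definition side :: "('a \<Rightarrow> 'a \<Rightarrow> bool) \<Rightarrow> 'a set \<Rightarrow> 'a \<Rightarrow> 'a list \<Rightarrow> 'a list \<Rightarrow> 'a \<Rightarrow> bool" where
  "side E V q X K v \<longleftrightarrow> (\<exists>x\<in>set X. E v x) \<and>
     (E v q \<or> (\<exists>u\<in>V. E u v \<and> E u q \<and> \<not> (\<exists>x\<in>set X. E u x) \<and> \<not> (\<exists>x\<in>set K. E u x)))"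

text \<open>\<open>x\<close> and \<open>y\<close> stand for neighbours of \<open>v\<close> in the
  cliques of \<open>A\<close> and \<open>B\<close>, and the conditions before the last are what
  adjacency to the parameters can say about this. The last disjunction exposes the vertices outside
  \<open>S\<close> that pass the others.\<close>

definition far :: "('a \<Rightarrow> 'a \<Rightarrow> bool) \<Rightarrow> 'a set \<Rightarrow> 'a \<Rightarrow> 'a \<Rightarrow> 'a list \<Rightarrow> 'a list \<Rightarrow>
    'a \<Rightarrow> 'a \<Rightarrow> 'a \<Rightarrow> 'a \<Rightarrow> 'a \<Rightarrow> bool" where
  "far E V p q X Y t1 t2 e r v \<longleftrightarrow> \<not> (\<exists>x\<in>set X. E v x) \<and> \<not> (\<exists>y\<in>set Y. E v y) \<and>
     (\<exists>x\<in>V. \<exists>y\<in>V. E v x \<and> E v y \<and> E p x \<and> E q y \<and> \<not> E x y \<and>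
        \<not> (\<exists>z\<in>set Y. E x z) \<and> \<not> (\<exists>z\<in>set X. E y z) \<and>
        (\<not> E y t1 \<and> \<not> E y e \<or> \<not> E x t2 \<and> \<not> E x e \<or> \<not> E x r))"

lemma (in full_pair) side_complete:
  assumes Y: "full_pair.min_dominator G S B Y" "q \<in> Y"
    and "set X \<subseteq> A" "set K \<subseteq> A" "s \<in> S" "x \<in> set X" "s \<sim> x"
  shows "side adj (pverts G) q X K s"
proof -
  interpret sw: full_pair G S B A by (rule swap)
  obtain y where y: "y \<in> Y" "s \<sim> y" using sw.dominatorD(4)[OF Y(1)] assms by blast
  have "y \<in> B" using y sw.dominatorD(1)[OF Y(1)] by auto
  then have "\<not> y \<sim> z" if "z \<in> set X \<union> set K" for z
    using that assms A_B_anti by blast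
  moreover have "y \<sim> q" if "y \<noteq> q" using sw.min_dominator_clique[OF Y(1) y(1) Y(2) that] .
  moreover have "y \<in> pverts G" "y \<sim> s" using y adj_verts adj_sym by blast+
  ultimately show ?thesis unfolding side_def using y assms by blast
qed

lemma (in full_pair) side_sound:
  assumes "q \<in> B" "set X \<subseteq> A" "v \<in> pverts F" "side adj (pverts G) q X K v"
    and cover: "\<And>f w x. f \<in> pverts F \<Longrightarrow> f \<in> A \<Longrightarrow> x \<in> set X \<Longrightarrow> f \<sim> x \<Longrightarrow> w \<in> S \<Longrightarrow> w \<sim> f \<Longrightarrow>
       \<exists>y\<in>set X \<union> set K. w \<sim> y"
  shows "v \<in> S"
proof (rule ccontr)
  assume "v \<notin> S"
  obtain x where x: "x \<in> set X" "v \<sim> x" using assms by (auto simp: side_def)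
  then have "v \<in> A" using nbr_A[of x v] assms(2) \<open>v \<notin> S\<close> adj_sym by blast
  then have "\<not> v \<sim> q" using A_B_anti assms by blast
  then obtain u where u: "u \<sim> v" "u \<sim> q" "\<not> (\<exists>y\<in>set X \<union> set K. u \<sim> y)"
    using assms(4) by (auto simp: side_def)
  then have "u \<in> S" using nbr_A[of v u] A_B_anti assms(1) \<open>v \<in> A\<close> adj_sym by blast
  then show False using cover[OF assms(3) \<open>v \<in> A\<close> x] u by blast
qed

text \<open>Covering leaves no room for a common nonneighbour \<open>z\<close>. So separator
  vertices that both miss \<open>z\<close> and are incomparable on the dominator must be adjacent;
  it is used in this form.\<close>

lemma (in full_pair) nbrs_in_dominator_nested:
  assumes "min_dominator X" "s \<in> S" "s' \<in> S" "\<not> s \<sim> s'" "z \<in> X" "\<not> s \<sim> z" "\<not> s' \<sim> z"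
    and "x \<in> X" "s \<sim> x" "\<not> s' \<sim> x" "x' \<in> X" "s' \<sim> x'" "\<not> s \<sim> x'"
  shows False
  using dominator_covered[OF assms(1-4,8-13,5)] assms(6,7) adj_sym by blast

lemma card_le_diff_nonempty:
  assumes "finite N" "card N \<le> card M" "b \<in> N" "b \<notin> M"
  obtains c where "c \<in> M" "c \<notin> N"
proof -
  have "\<not> M \<subset> N" using psubset_card_mono[OF assms(1), of M] assms(2) by auto
  then show ?thesis using that assms by blast
qed

section \<open>Impostors when both dominators are large\<close>

locale big_pair = full_pair G S A B for G :: "'a pair_pre_digraph" and S A B +
  fixes X0 Y0 :: "'a set" and p p2 p3 q q2 q3 :: 'a
  assumes X0: "min_dominator X0" and Y0: "full_pair.min_dominator G S B Y0"
    and X3: "{p, p2, p3} \<subseteq> X0" "distinct [p, p2, p3]"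
    and Y3: "{q, q2, q3} \<subseteq> Y0" "distinct [q, q2, q3]"
begin

sublocale sw: full_pair G S B A by (rule swap)

lemma swap_big: "big_pair G S B A Y0 X0 q q2 q3 p p2 p3"
  using X0 Y0 X3 Y3 sw.full_pair_axioms
  by (simp add: big_pair_def big_pair_axioms_def)

lemma mem: "p \<in> A" "p2 \<in> A" "p3 \<in> A" "q \<in> B" "q2 \<in> B" "q3 \<in> B"
    "p \<in> X0" "p2 \<in> X0" "p3 \<in> X0" "q \<in> Y0" "q2 \<in> Y0" "q3 \<in> Y0"
  using dominatorD(1)[OF X0] sw.dominatorD(1)[OF Y0] X3 Y3 by auto

text \<open>An impostor \<open>v\<close> with its certificate \<open>x\<close>, \<open>y\<close>, as
  far as the three fixed members of each clique can tell. Membership of \<open>x\<close> and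
  \<open>y\<close> in \<open>S\<close> can be included because \<open>badI\<close> derives
  it.\<close>

definition bad :: "'a \<Rightarrow> 'a \<Rightarrow> 'a \<Rightarrow> bool" where
  "bad x v y \<longleftrightarrow> x \<in> S \<and> y \<in> S \<and> \<not> x \<sim> y \<and> x \<sim> p \<and> y \<sim> q \<and> v \<notin> S \<and> v \<sim> x \<and> v \<sim> y \<and>
     (\<forall>z\<in>{q, q2, q3}. \<not> x \<sim> z) \<and> (\<forall>z\<in>{p, p2, p3}. \<not> y \<sim> z) \<and>
     (\<forall>z\<in>{p, p2, p3, q, q2, q3}. \<not> v \<sim> z)"

text \<open>An \<open>x\<close> outside \<open>S\<close> lies in \<open>A\<close>, as a neighbour of
  \<open>p\<close>, and forces \<open>v\<close> into \<open>A\<close> and \<open>y\<close> into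
  \<open>S\<close>; then \<open>p, x, v, y\<close> admits the exchange. A \<open>y\<close> outside
  \<open>S\<close> fails in the same way on the side of \<open>B\<close>.\<close>

lemma badI:
  assumes "v \<notin> S" "v \<sim> x" "v \<sim> y" "p \<sim> x" "q \<sim> y" "\<not> x \<sim> y"
    and x: "\<And>z. z \<in> {q, q2, q3} \<Longrightarrow> \<not> x \<sim> z" and y: "\<And>z. z \<in> {p, p2, p3} \<Longrightarrow> \<not> y \<sim> z"
    and v: "\<And>z. z \<in> {p, p2, p3, q, q2, q3} \<Longrightarrow> \<not> v \<sim> z"
  shows "bad x v y"
proof -
  have sym: "x \<sim> p" "y \<sim> q" "x \<sim> v" "y \<sim> v" "\<not> y \<sim> x" using assms(2-6) adj_sym by blast+
  have xy: "x \<in> A \<or> x \<in> S" "y \<in> B \<or> y \<in> S"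
    using nbr_A[OF mem(1) assms(4)] nbr_B[OF mem(4) assms(5)] by auto
  have "x \<in> S"
  proof (rule ccontr)
    assume "x \<notin> S"
    then have xA: "x \<in> A" using xy by blast
    then have vA: "v \<in> A" using nbr_A[OF _ sym(3)] assms(1) by blast
    then have "y \<in> S" using nbr_A[OF vA assms(3)] xy A_not_B by blast
    moreover have "\<not> v \<sim> z \<and> \<not> y \<sim> z" if "z \<in> {p, p2, p3}" for z using that v y by auto
    ultimately show False
      by (rule no_dominator_exchange[OF X0 X3 vA xA _ assms(3) sym(3,1) assms(6)])
  qed
  moreover have "y \<in> S"
  proof (rule ccontr)
    assume "y \<notin> S"
    then have yB: "y \<in> B" using xy by blast
    then have vB: "v \<in> B" using nbr_B[OF _ sym(4)] assms(1) by blast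
    have "\<not> v \<sim> z \<and> \<not> x \<sim> z" if "z \<in> {q, q2, q3}" for z using that v x by auto
    then show False
      by (rule sw.no_dominator_exchange[OF Y0 Y3 vB yB \<open>x \<in> S\<close> assms(2) sym(4,2,5)])
  qed
  ultimately show ?thesis using assms(1-3,6) sym(1,2) x y v by (auto simp: bad_def)
qed

text \<open>A \<open>v\<close> that sees \<open>c\<close> lies in \<open>A\<close>, and
  \<open>p, c, v, y\<close> admits the exchange. Hence \<open>v\<close> sees no more of the
  dominator than \<open>y\<close> does.\<close>

lemma bad_middle_anti:
  assumes bad: "bad x v y" and c: "c \<in> X0" "\<not> y \<sim> c"
  shows "\<not> v \<sim> c"
proof
  assume vc: "v \<sim> c"
  have "c \<in> A" using c dominatorD(1)[OF X0] by auto
  then have "v \<in> A" using nbr_A[of c v] vc adj_sym bad by (auto simp: bad_def)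
  have "c \<noteq> p" using bad vc by (auto simp: bad_def)
  then have "c \<sim> p" using min_dominator_clique[OF X0 c(1)] mem by blast
  have cs: "c \<sim> v" "\<not> c \<sim> y" using vc c adj_sym by blast+
  have *: "\<not> v \<sim> z \<and> \<not> y \<sim> z" if "z \<in> {p, p2, p3}" for z using bad that by (auto simp: bad_def)
  have "y \<in> S" "v \<sim> y" using bad by (auto simp: bad_def)
  then show False
    using no_dominator_exchange[OF X0 X3 \<open>v \<in> A\<close> \<open>c \<in> A\<close> _ _ cs(1) \<open>c \<sim> p\<close> cs(2) *] by blast
qed

lemma bad_swap: "big_pair.bad G S q q2 q3 p p2 p3 y v x \<longleftrightarrow> bad x v y"
proof -
  interpret sb: big_pair G S B A Y0 X0 q q2 q3 p p2 p3 by (rule swap_big)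
  have "\<not> x \<sim> y \<longleftrightarrow> \<not> y \<sim> x" using adj_sym by blast
  then show ?thesis unfolding sb.bad_def bad_def by auto
qed

lemma bad_middle_anti':
  assumes bad: "bad x v y" and c: "c \<in> Y0" "\<not> x \<sim> c"
  shows "\<not> v \<sim> c"
proof -
  interpret sb: big_pair G S B A Y0 X0 q q2 q3 p p2 p3 by (rule swap_big)
  show ?thesis using sb.bad_middle_anti[of y v x c] bad c bad_swap by blast
qed

end

section \<open>Extremal parameters that expose all impostors\<close>

context big_pair
begin

definition nX :: "'a \<Rightarrow> 'a set" where "nX r = {x \<in> X0. r \<sim> x}"

definition nY :: "'a \<Rightarrow> 'a set" where "nY r = {y \<in> Y0. r \<sim> y}"

lemma finite_nX [simp]: "finite (nX r)" and finite_nY [simp]: "finite (nY r)"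
  using dominatorD(2)[OF X0] sw.dominatorD(2)[OF Y0] by (auto simp: nX_def nY_def)

lemma nX_nonempty: "r \<in> S \<Longrightarrow> \<exists>x. x \<in> nX r"
  using dominatorD(4)[OF X0] by (auto simp: nX_def)

lemma nY_nonempty: "r \<in> S \<Longrightarrow> \<exists>y. y \<in> nY r"
  using sw.dominatorD(4)[OF Y0] by (auto simp: nY_def)

definition low :: "'a \<Rightarrow> 'a \<Rightarrow> 'a \<Rightarrow> bool" where
  "low t1 t2 r \<longleftrightarrow> r \<in> S \<and> nX r \<subset> nX t2 \<and> nY r \<subset> nY t1"

text \<open>The extremal choices behind the last six parameters of a container: \<open>t1\<close> and then \<open>t2\<close> see as
  few vertices of the opposite dominator as possible, and \<open>r\<close> is a lowest separator vertex strictly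
  below both, if there is one.\<close>

definition chosen :: "'a \<Rightarrow> 'a \<Rightarrow> 'a \<Rightarrow> 'a \<Rightarrow> 'a \<Rightarrow> 'a \<Rightarrow> bool" where
  "chosen t1 t2 e r a b \<longleftrightarrow> bad t1 e t2 \<and>
     (\<forall>x v y. bad x v y \<longrightarrow> card (nY t1) \<le> card (nY x)) \<and>
     (\<forall>v y. bad t1 v y \<longrightarrow> card (nX t2) \<le> card (nX y)) \<and>
     a \<in> nX t2 \<and> b \<in> nY t1 \<and>
     (low t1 t2 r \<and> a \<in> nX r \<and> b \<in> nY r \<and> (\<forall>r'. low t1 t2 r' \<longrightarrow> card (nX r) \<le> card (nX r')) \<or>
      (\<forall>r'. \<not> low t1 t2 r') \<and> r = t1)"

lemma chosen_exists:
  assumes "bad x v y"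
  shows "\<exists>t1 t2 e r a b. chosen t1 t2 e r a b"
proof -
  obtain t1 where t1: "\<exists>v y. bad t1 v y"
    and min1: "\<And>x. \<exists>v y. bad x v y \<Longrightarrow> card (nY t1) \<le> card (nY x)"
    using ex_has_least_nat[of "\<lambda>x. \<exists>v y. bad x v y" x "\<lambda>x. card (nY x)"] assms by blast
  then obtain t2' where "\<exists>v. bad t1 v t2'" by blast
  then obtain t2 where t2: "\<exists>v. bad t1 v t2"
    and min2: "\<And>y. \<exists>v. bad t1 v y \<Longrightarrow> card (nX t2) \<le> card (nX y)"
    using ex_has_least_nat[of "\<lambda>y. \<exists>v. bad t1 v y" t2' "\<lambda>y. card (nX y)"] by blast
  obtain e where e: "bad t1 e t2" using t2 by blast
  then have "t1 \<in> S" "t2 \<in> S" by (auto simp: bad_def)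
  show ?thesis
  proof (cases "\<exists>r. low t1 t2 r")
    case True
    then obtain r' where "low t1 t2 r'" by blast
    then obtain r where r: "low t1 t2 r" "\<And>r'. low t1 t2 r' \<Longrightarrow> card (nX r) \<le> card (nX r')"
      using ex_has_least_nat[of "low t1 t2" r' "\<lambda>r. card (nX r)"] by blast
    have "r \<in> S" using r by (simp add: low_def)
    from nX_nonempty[OF this] nY_nonempty[OF this] obtain a b where ab: "a \<in> nX r" "b \<in> nY r" by blast
    have "a \<in> nX t2" "b \<in> nY t1" using ab r(1) by (auto simp: low_def)
    then have "chosen t1 t2 e r a b" unfolding chosen_def using ab r e min1 min2 by blast
    then show ?thesis by blast
  next
    case False
    obtain a b where ab: "a \<in> nX t2" "b \<in> nY t1"
      using nY_nonempty[OF \<open>t1 \<in> S\<close>] nX_nonempty[OF \<open>t2 \<in> S\<close>] by blast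
    \<comment> \<open>The default \<open>r = t1\<close> is safe: every false certificate that avoids
      \<open>a\<close> and \<open>b\<close> has \<open>x\<close> adjacent to \<open>t1\<close>, and
      genuine separator vertices pass by one of the first two alternatives if nothing is
      low.\<close>
    then have "chosen t1 t2 e t1 a b" unfolding chosen_def using False e min1 min2 by blast
    then show ?thesis by blast
  qed
qed

text \<open>A neighbour of \<open>s\<close> in a dominator that \<open>t2\<close>, respectively
  \<open>t1\<close>, misses is also missed by \<open>e\<close>. If there is none, \<open>a\<close>
  and \<open>b\<close> make both inclusions strict, so \<open>s\<close> is low. As \<open>r\<close>
  sees \<open>a\<close> and \<open>s\<close> does not, minimality of \<open>r\<close> leaves a
  neighbour of \<open>s\<close> that \<open>r\<close> misses.\<close>

lemma chosen_complete:
  assumes ch: "chosen t1 t2 e r a b" and s: "s \<in> S" "\<not> s \<sim> a" "\<not> s \<sim> b"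
  obtains x y where "x \<in> nX s" "y \<in> nY s" "\<not> y \<sim> t1 \<and> \<not> y \<sim> e \<or> \<not> x \<sim> t2 \<and> \<not> x \<sim> e \<or> \<not> x \<sim> r"
proof -
  have bad: "bad t1 e t2" using ch by (simp add: chosen_def)
  obtain x0 y0 where xy: "x0 \<in> nX s" "y0 \<in> nY s"
    using nX_nonempty[OF s(1)] nY_nonempty[OF s(1)] by blast
  show ?thesis
  proof (cases "nX s \<subseteq> nX t2")
    case False
    then obtain x where x: "x \<in> nX s" "x \<in> X0" "\<not> t2 \<sim> x" by (auto simp: nX_def)
    then have "\<not> x \<sim> t2" "\<not> x \<sim> e" using bad_middle_anti[OF bad x(2,3)] adj_sym by blast+
    then show ?thesis using that x(1) xy by blast
  next
    case X: True
    show ?thesis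
    proof (cases "nY s \<subseteq> nY t1")
      case False
      then obtain y where y: "y \<in> nY s" "y \<in> Y0" "\<not> t1 \<sim> y" by (auto simp: nY_def)
      then have "\<not> y \<sim> t1" "\<not> y \<sim> e" using bad_middle_anti'[OF bad y(2,3)] adj_sym by blast+
      then show ?thesis using that y(1) xy by blast
    next
      case True
      have ab: "a \<in> nX t2" "b \<in> nY t1" using ch by (auto simp: chosen_def)
      have nab: "a \<notin> nX s" "b \<notin> nY s" using s by (auto simp: nX_def nY_def)
      have low: "low t1 t2 s" using X True ab nab s(1) by (auto simp: low_def)
      then have "a \<in> nX r" "card (nX r) \<le> card (nX s)" using ch by (auto simp: chosen_def)
      then obtain x where x: "x \<in> nX s" "x \<notin> nX r"
        using card_le_diff_nonempty[OF finite_nX _ _ nab(1)] by blast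
      then have "\<not> x \<sim> r" using adj_sym by (auto simp: nX_def)
      then show ?thesis using that x(1) xy by blast
    qed
  qed
qed

text \<open>Since \<open>t1\<close> sees \<open>b\<close> and \<open>x\<close> does not, extremality
  gives \<open>x\<close> a neighbour in \<open>Y0\<close> that \<open>t1\<close> misses. Both miss
  \<open>q\<close>, so they are not nested and must be adjacent. The other adjacencies combine this
  argument with forbidden cycles through \<open>p\<close> or \<open>q\<close>.\<close>

lemma chosen_sound:
  assumes ch: "chosen t1 t2 e r a b" and bad: "bad x v y"
    and xb: "\<not> x \<sim> b" and ya: "\<not> y \<sim> a" and vb: "\<not> v \<sim> b"
  shows "(y \<sim> t1 \<or> y \<sim> e) \<and> (x \<sim> t2 \<or> x \<sim> e) \<and> x \<sim> r"
proof -
  have e: "bad t1 e t2" using ch by (simp add: chosen_def)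
  note bads = bad[unfolded bad_def] e[unfolded bad_def]
  have inS: "x \<in> S" "y \<in> S" "t1 \<in> S" "t2 \<in> S" using bads by auto
  have ab: "a \<in> nX t2" "b \<in> nY t1" using ch by (auto simp: chosen_def)
  have nq: "\<not> x \<sim> q" "\<not> t1 \<sim> q" "\<not> y \<sim> p" "\<not> t2 \<sim> p" "\<not> v \<sim> q" "\<not> e \<sim> p" "\<not> e \<sim> q"
    using bads by auto
  have adjs: "x \<sim> p" "y \<sim> q" "v \<sim> x" "v \<sim> y" "t1 \<sim> p" "t2 \<sim> q" "e \<sim> t1" "e \<sim> t2"
    "\<not> x \<sim> y" "\<not> t1 \<sim> t2" using bads by auto
  have bY: "b \<in> Y0" "t1 \<sim> b" "b \<noteq> q" "b \<sim> q" and aX: "a \<in> X0" "t2 \<sim> a"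
    using ab nq sw.min_dominator_clique[OF Y0 _ mem(10)] by (auto simp: nX_def nY_def)
  have cY: "card (nY t1) \<le> card (nY x)" using ch bad by (auto simp: chosen_def)
  have bx: "b \<notin> nY x" using xb by (simp add: nY_def)
  obtain b' where "b' \<in> nY x" "b' \<notin> nY t1"
    using card_le_diff_nonempty[OF finite_nY cY ab(2) bx] by blast
  then have b': "b' \<in> Y0" "x \<sim> b'" "\<not> t1 \<sim> b'" by (auto simp: nY_def)
  have xt1: "x \<sim> t1"
    using sw.nbrs_in_dominator_nested[OF Y0 inS(1,3) _ mem(10) nq(1,2) b' bY(1,2) xb] by blast
  have xr: "x \<sim> r"
  proof (cases "low t1 t2 r")
    case False
    then show ?thesis using ch xt1 by (auto simp: chosen_def)
  next
    case True
    then have r: "r \<in> S" "nY r \<subset> nY t1" "b \<in> nY r" using ch by (auto simp: low_def chosen_def)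
    then have nrq: "\<not> r \<sim> q" "r \<sim> b" using nq(2) mem(10) by (auto simp: nY_def)
    have "card (nY r) \<le> card (nY x)"
      using psubset_card_mono[OF finite_nY r(2)] cY by linarith
    then obtain c where "c \<in> nY x" "c \<notin> nY r"
      using card_le_diff_nonempty[OF finite_nY _ r(3) bx] by blast
    then have c: "c \<in> Y0" "x \<sim> c" "\<not> r \<sim> c" by (auto simp: nY_def)
    show ?thesis
      using sw.nbrs_in_dominator_nested[OF Y0 inS(1) r(1) _ mem(10) nq(1) nrq(1) c bY(1) nrq(2) xb] by blast
  qed
  \<comment> \<open>Otherwise \<open>y, b, t1, x, v\<close> is a five-cycle extended by
    \<open>q\<close>, or \<open>v, y, q, b, t1, x\<close> is an induced six-cycle. The adjacency
    yields \<open>bad t1 v y\<close>, which brings in the minimality of \<open>t2\<close>.\<close>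
  have vt1: "v \<sim> t1" if "\<not> y \<sim> t1"
  proof (rule ccontr)
    assume "\<not> v \<sim> t1"
    have sym: "b \<sim> t1" "t1 \<sim> x" "x \<sim> v" "\<not> b \<sim> x" "\<not> y \<sim> x" "q \<sim> y" "q \<sim> b" "\<not> q \<sim> t1" "\<not> q \<sim> x" "\<not> q \<sim> v"
      using bY xt1 adjs xb nq adj_sym by blast+
    show False
    proof (cases "y \<sim> b")
      case True
      have "\<not> t1 \<sim> v" "\<not> x \<sim> y" "\<not> b \<sim> v" using \<open>\<not> v \<sim> t1\<close> adjs vb adj_sym by blast+
      then show False
        using no_extended_C5_two[OF True sym(1,2,3) adjs(4) that sym(5,4) _ _ sym(6-10)] by blast
    next
      case False
      then show False
        using no_induced_C6[of v y q b t1 x] adjs sym that \<open>\<not> v \<sim> t1\<close> vb nq by blast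
    qed
  qed
  have "y \<sim> t1 \<or> y \<sim> e"
  proof (rule ccontr)
    assume n: "\<not> (y \<sim> t1 \<or> y \<sim> e)"
    then have "v \<sim> t1" using vt1 by blast
    moreover have "\<not> t1 \<sim> y" using n adj_sym by blast
    ultimately have "bad t1 v y" using bads by (auto simp: bad_def)
    then have cX: "card (nX t2) \<le> card (nX y)" using ch by (auto simp: chosen_def)
    have "a \<notin> nX y" using ya by (simp add: nX_def)
    then obtain a' where "a' \<in> nX y" "a' \<notin> nX t2"
      using card_le_diff_nonempty[OF finite_nX cX ab(1)] by blast
    then have a': "a' \<in> X0" "y \<sim> a'" "\<not> t2 \<sim> a'" by (auto simp: nX_def)
    have yt2: "y \<sim> t2"
      using nbrs_in_dominator_nested[OF X0 inS(2,4) _ mem(7) nq(3,4) a' aX ya] by blast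
    have "\<not> e \<sim> a'" using bad_middle_anti[OF e a'(1,3)] .
    have "p \<sim> a'" using min_dominator_clique[OF X0 mem(7) a'(1)] a' nq by blast
    have sym: "\<not> a' \<sim> e" "a' \<sim> y" "t2 \<sim> e" "\<not> y \<sim> e" "\<not> y \<sim> t1" "\<not> a' \<sim> t2" "p \<sim> t1" "\<not> p \<sim> y" "\<not> p \<sim> t2" "\<not> p \<sim> e"
        "\<not> t1 \<sim> y" "\<not> e \<sim> y"
      using \<open>\<not> e \<sim> a'\<close> a' adjs n nq adj_sym by blast+
    \<comment> \<open>The cycle \<open>t1, a', y, t2, e\<close> is extended by \<open>p\<close> at
      the edge from \<open>t1\<close> to \<open>a'\<close>; if that edge is missing, the detour
      through \<open>p\<close> is an induced six-cycle.\<close>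
    show False
    proof (cases "t1 \<sim> a'")
      case True
      show False
        using no_extended_C5_two[OF True sym(2) yt2 sym(3) adjs(7) sym(11) adjs(10) sym(6,1,4,7)
            \<open>p \<sim> a'\<close> sym(8,9,10)] .
    next
      case False
      then show False
        using no_induced_C6[of e t1 p a' y t2] adjs sym \<open>p \<sim> a'\<close> yt2 \<open>\<not> e \<sim> a'\<close> nq by blast
    qed
  qed
  moreover have "x \<sim> t2 \<or> x \<sim> e"
  proof (rule ccontr)
    assume n: "\<not> (x \<sim> t2 \<or> x \<sim> e)"
    have "\<not> e \<sim> b'" using bad_middle_anti'[OF e b'(1,3)] .
    have "q \<sim> b'" using sw.min_dominator_clique[OF Y0 mem(10) b'(1)] b' nq by blast
    have sym: "\<not> b' \<sim> e" "b' \<sim> x" "t1 \<sim> e" "\<not> x \<sim> e" "\<not> x \<sim> t2" "\<not> b' \<sim> t1" "q \<sim> t2" "\<not> q \<sim> x" "\<not> q \<sim> t1" "\<not> q \<sim> e"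
        "\<not> t2 \<sim> x" "\<not> e \<sim> x" "\<not> t2 \<sim> t1"
      using \<open>\<not> e \<sim> b'\<close> b' adjs n nq adj_sym by blast+
    show False
    proof (cases "t2 \<sim> b'")
      case True
      show False
        using no_extended_C5_two[OF True sym(2) xt1 sym(3) adjs(8) sym(11,13) sym(6,1,4,7)
            \<open>q \<sim> b'\<close> sym(8,9,10)] .
    next
      case False
      then show False
        using no_induced_C6[of e t2 q b' x t1] adjs sym \<open>q \<sim> b'\<close> xt1 \<open>\<not> e \<sim> b'\<close> nq by blast
    qed
  qed
  ultimately show ?thesis using xr by blast
qed

lemma far_exact:
  obtains a b t1 t2 e r where "a \<in> X0" "b \<in> Y0" "{t1, t2, e, r} \<subseteq> pverts G"
    "\<And>v. far adj (pverts G) p q [p, p2, p3, a] [q, q2, q3, b] t1 t2 e r v \<Longrightarrow> v \<in> S"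
    "\<And>v. v \<in> S \<Longrightarrow> \<not> (\<exists>x\<in>set [p, p2, p3, a]. v \<sim> x) \<Longrightarrow> \<not> (\<exists>y\<in>set [q, q2, q3, b]. v \<sim> y) \<Longrightarrow>
       far adj (pverts G) p q [p, p2, p3, a] [q, q2, q3, b] t1 t2 e r v"
proof -
  have farD: "\<exists>x y. bad x v y \<and> \<not> x \<sim> b \<and> \<not> y \<sim> a \<and> \<not> v \<sim> b \<and>
       (\<not> y \<sim> t1 \<and> \<not> y \<sim> e \<or> \<not> x \<sim> t2 \<and> \<not> x \<sim> e \<or> \<not> x \<sim> r)"
    if "v \<notin> S" "far adj (pverts G) p q [p, p2, p3, a] [q, q2, q3, b] t1 t2 e r v" for a b t1 t2 e r v
  proof -
    from that(2) obtain x y where *: "v \<sim> x" "v \<sim> y" "p \<sim> x" "q \<sim> y" "\<not> x \<sim> y"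
      "\<forall>z\<in>{q, q2, q3, b}. \<not> x \<sim> z" "\<forall>z\<in>{p, p2, p3, a}. \<not> y \<sim> z"
      "\<forall>z\<in>{p, p2, p3, a, q, q2, q3, b}. \<not> v \<sim> z"
      and c: "\<not> y \<sim> t1 \<and> \<not> y \<sim> e \<or> \<not> x \<sim> t2 \<and> \<not> x \<sim> e \<or> \<not> x \<sim> r"
      by (auto simp: far_def)
    have "bad x v y" by (rule badI[OF that(1) *(1-5)]) (use *(6-8) in auto)
    moreover have "\<not> x \<sim> b \<and> \<not> y \<sim> a \<and> \<not> v \<sim> b" using *(6-8) by simp
    ultimately show ?thesis using c by blast
  qed
  have farI: "far adj (pverts G) p q [p, p2, p3, a] [q, q2, q3, b] t1 t2 e r v"
    if ab: "a \<in> X0" "b \<in> Y0" and v: "v \<in> S"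
      "\<not> (\<exists>x\<in>set [p, p2, p3, a]. v \<sim> x)" "\<not> (\<exists>y\<in>set [q, q2, q3, b]. v \<sim> y)"
      and xy: "x \<in> nX v" "y \<in> nY v" "\<not> y \<sim> t1 \<and> \<not> y \<sim> e \<or> \<not> x \<sim> t2 \<and> \<not> x \<sim> e \<or> \<not> x \<sim> r"
    for a b t1 t2 e r v x y
  proof -
    have x: "x \<in> X0" "v \<sim> x" and y: "y \<in> Y0" "v \<sim> y" using xy by (auto simp: nX_def nY_def)
    have "x \<noteq> p" "y \<noteq> q" using x y v by auto
    then have pq: "p \<sim> x" "q \<sim> y"
      using min_dominator_clique[OF X0 mem(7) x(1)] sw.min_dominator_clique[OF Y0 mem(10) y(1)] by auto
    have xA: "x \<in> A" and yB: "y \<in> B"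
      using x y dominatorD(1)[OF X0] sw.dominatorD(1)[OF Y0] by auto
    have setA: "set [p, p2, p3, a] \<subseteq> A" and setB: "set [q, q2, q3, b] \<subseteq> B"
      using mem ab dominatorD(1)[OF X0] sw.dominatorD(1)[OF Y0] by auto
    have "\<not> (\<exists>z\<in>set [q, q2, q3, b]. x \<sim> z)" "\<not> (\<exists>z\<in>set [p, p2, p3, a]. y \<sim> z)" "\<not> x \<sim> y"
      using setA setB xA yB A_B_anti by blast+
    moreover have "x \<in> pverts G" "y \<in> pverts G" using x y adj_verts by blast+
    ultimately show ?thesis unfolding far_def using v(2,3) x(2) y(2) pq xy(3) by blast
  qed
  show ?thesis
  proof (cases "\<exists>x v y. bad x v y")
    case True
    then obtain t1 t2 e r a b where ch: "chosen t1 t2 e r a b" using chosen_exists by blast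
    have ab: "a \<in> X0" "b \<in> Y0" using ch by (auto simp: chosen_def nX_def nY_def)
    have e: "bad t1 e t2" using ch by (simp add: chosen_def)
    have "r \<in> S" using ch e by (auto simp: chosen_def low_def bad_def)
    moreover have "t1 \<in> S" "t2 \<in> S" "e \<sim> t1" using e by (auto simp: bad_def)
    ultimately have V: "{t1, t2, e, r} \<subseteq> pverts G"
      using A(3) adj_verts by (auto simp: nbhd_def)
    show ?thesis
    proof (rule that[OF ab V])
      fix v assume f: "far adj (pverts G) p q [p, p2, p3, a] [q, q2, q3, b] t1 t2 e r v"
      show "v \<in> S"
      proof (rule ccontr)
        assume "v \<notin> S"
        from farD[OF this f] show False using chosen_sound[OF ch] by blast
      qed
    next
      fix v assume v: "v \<in> S" "\<not> (\<exists>x\<in>set [p, p2, p3, a]. v \<sim> x)" "\<not> (\<exists>y\<in>set [q, q2, q3, b]. v \<sim> y)"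
      then have "\<not> v \<sim> a" "\<not> v \<sim> b" by auto
      with ch v(1) obtain x y where "x \<in> nX v" "y \<in> nY v"
        "\<not> y \<sim> t1 \<and> \<not> y \<sim> e \<or> \<not> x \<sim> t2 \<and> \<not> x \<sim> e \<or> \<not> x \<sim> r"
        by (rule chosen_complete)
      then show "far adj (pverts G) p q [p, p2, p3, a] [q, q2, q3, b] t1 t2 e r v"
        by (rule farI[OF ab v])
    qed
  next
    case False
    \<comment> \<open>There are no impostors to expose here, only the last clause of
      \<open>far\<close> to satisfy: with \<open>r = q\<close> it holds because \<open>x\<close> is
      in \<open>A\<close> and \<open>q\<close> in \<open>B\<close>.\<close>
    have V: "{q, q, q, q} \<subseteq> pverts G" using mem B by auto
    show ?thesis
    proof (rule that[OF mem(7,10) V])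
      fix v assume f: "far adj (pverts G) p q [p, p2, p3, p] [q, q2, q3, q] q q q q v"
      show "v \<in> S"
      proof (rule ccontr)
        assume "v \<notin> S"
        from farD[OF this f] show False using False by blast
      qed
    next
      fix v assume v: "v \<in> S" "\<not> (\<exists>x\<in>set [p, p2, p3, p]. v \<sim> x)" "\<not> (\<exists>y\<in>set [q, q2, q3, q]. v \<sim> y)"
      obtain x y where xy: "x \<in> nX v" "y \<in> nY v"
        using nX_nonempty[OF v(1)] nY_nonempty[OF v(1)] by blast
      then have "x \<in> A" using dominatorD(1)[OF X0] by (auto simp: nX_def)
      then have "\<not> x \<sim> q" using A_B_anti mem by blast
      then have "\<not> y \<sim> q \<and> \<not> y \<sim> q \<or> \<not> x \<sim> q \<and> \<not> x \<sim> q \<or> \<not> x \<sim> q" by blast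
      then show "far adj (pverts G) p q [p, p2, p3, p] [q, q2, q3, q] q q q q v"
        by (rule farI[OF mem(7,10) v xy])
    qed
  qed
qed

end

text \<open>The conjunct \<open>E q q2\<close> is a switch. Distinct clique members are adjacent, so
  it is on for large dominators; a small one is encoded with \<open>q2 = q\<close>, which leaves
  only the first \<open>side\<close>. The parameters come in the order in which pairs of vertices
  are enumerated later.\<close>

definition shat :: "('a \<Rightarrow> 'a \<Rightarrow> bool) \<Rightarrow> 'a set \<Rightarrow> 'a \<Rightarrow> 'a \<Rightarrow> 'a \<Rightarrow> 'a \<Rightarrow> 'a \<Rightarrow> 'a \<Rightarrow> 'a \<Rightarrow> 'a \<Rightarrow>
    'a \<Rightarrow> 'a \<Rightarrow> 'a \<Rightarrow> 'a \<Rightarrow> 'a list \<Rightarrow> 'a list \<Rightarrow> 'a \<Rightarrow> bool" where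
  "shat E V p q p2 q2 p3 q3 a b t1 t2 e r KA KB v \<longleftrightarrow> side E V q [p, p2, p3, a] KA v \<or>
     E q q2 \<and> (side E V p [q, q2, q3, b] KB v \<or> far E V p q [p, p2, p3, a] [q, q2, q3, b] t1 t2 e r v)"

definition (in C_graph) has_container_tuple :: "nat \<Rightarrow> 'a pair_pre_digraph \<Rightarrow> 'a set \<Rightarrow> bool" where
  "has_container_tuple k F S \<longleftrightarrow> (\<exists>p q p2 q2 p3 q3 a b t1 t2 e r KA KB.
     set [p, q, p2, q2, p3, q3, a, b, t1, t2, e, r] \<union> set KA \<union> set KB \<subseteq> pverts G \<and>
     length KA = k \<and> length KB = k \<and>
     container F S {v \<in> pverts G. shat adj (pverts G) p q p2 q2 p3 q3 a b t1 t2 e r KA KB v})"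

text \<open>A component is a class of mutual reachability in the restricted digraph. Any walk
  between two of its vertices stays inside, since each vertex on the walk is mutually reachable with
  the ends; so arcs of \<open>D\<close> itself connect \<open>D\<close>.\<close>

lemma (in C_graph) minimal_separator_full_pair:
  assumes "minimal_separator G S"
  shows "\<exists>A B. full_pair G S A B"
proof -
  obtain A B where AB: "A \<in> components_minus G S" "B \<in> components_minus G S" "A \<noteq> B"
    "nbhd G A = S" "nbhd G B = S"
    using assms by (auto simp: minimal_separator_def)
  let ?H = "with_proj G \<restriction> (pverts G - S)"
  have comp: "connected_in D \<and> D \<noteq> {} \<and> D \<subseteq> pverts G" if D: "D \<in> components_minus G S" for D
  proof -
    have D': "D \<noteq> {}" "\<And>u v. u \<in> D \<Longrightarrow> v \<in> D \<Longrightarrow> u \<rightarrow>\<^sup>*\<^bsub>?H\<^esub> v"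
      "\<And>u v. u \<in> D \<Longrightarrow> v \<notin> D \<Longrightarrow> \<not> u \<rightarrow>\<^sup>*\<^bsub>?H\<^esub> v \<or> \<not> v \<rightarrow>\<^sup>*\<^bsub>?H\<^esub> u"
      using D unfolding components_minus_def pre_digraph.sccs_verts_def by auto
    have verts: "u \<in> pverts G" if "u \<in> D" for u
      using D'(2)[OF that that] by (auto simp: reachable_def dest: in_rtrancl_on_in_F)
    have arc: "u \<sim> v" if "u \<rightarrow>\<^bsub>?H\<^esub> v" for u v
      using that by (auto simp: arcs_ends_def arc_to_ends_def)
    have "(u, v) \<in> (arcs_in D)\<^sup>*" if uv: "u \<in> D" "v \<in> D" for u v
    proof -
      have "u \<rightarrow>\<^sup>*\<^bsub>?H\<^esub> v" using D' uv by blast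
      then have "(u, v) \<in> rtrancl_on (verts ?H) (arcs_ends ?H)" by (simp add: reachable_def)
      then have "v \<in> D \<longrightarrow> (u, v) \<in> (arcs_in D)\<^sup>*"
      proof (induction rule: rtrancl_on_induct)
        case (step y z)
        show ?case
        proof
          assume "z \<in> D"
          have "u \<rightarrow>\<^sup>*\<^bsub>?H\<^esub> y" using step by (simp add: reachable_def)
          moreover have "y \<rightarrow>\<^sup>*\<^bsub>?H\<^esub> z"
            unfolding reachable_def using step by (meson rtrancl_on.intros)
          then have "y \<rightarrow>\<^sup>*\<^bsub>?H\<^esub> u"
            unfolding reachable_def using D'(2)[OF \<open>z \<in> D\<close> uv(1)]
            by (metis reachable_def rtrancl_on_trans)
          ultimately have "y \<in> D" using D'(3)[OF uv(1), of y] by blast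
          then have "(y, z) \<in> arcs_in D" using \<open>z \<in> D\<close> arc step by (simp add: arcs_in_def)
          then show "(u, z) \<in> (arcs_in D)\<^sup>*" using step \<open>y \<in> D\<close> by simp
        qed
      qed simp
      then show ?thesis using uv by blast
    qed
    then show ?thesis using D'(1) verts by (auto simp: connected_in_def)
  qed
  have "A \<inter> B = {}"
    using AB(1-3) unfolding components_minus_def pre_digraph.sccs_verts_def by safe meson+
  then have "full_pair G S A B"
    using comp[OF AB(1)] comp[OF AB(2)] AB(4,5) by unfold_locales auto
  then show ?thesis by blast
qed

text \<open>One or two vertices see all of \<open>S\<close>, so \<open>X\<close> by itself provides
  the cover that \<open>side_sound\<close> asks for, and \<open>side\<close> defines
  \<open>S\<close> exactly.\<close>

lemma (in full_pair) container_small: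
  assumes X0: "min_dominator X0" "card X0 \<le> 2"
  shows "has_container_tuple k F S"
proof -
  interpret sw: full_pair G S B A by (rule swap)
  obtain Y0 where Y0: "sw.min_dominator Y0" using sw.min_dominator_exists by blast
  note XD = dominatorD[OF X0(1)] and YD = sw.dominatorD[OF Y0]
  obtain q where q: "q \<in> Y0" using YD(3) by blast
  have "card X0 = 1 \<or> card X0 = 2" using X0(2) XD(2,3) card_gt_0_iff[of X0] by linarith
  then obtain p p2 where p: "X0 = {p, p2}" by (auto simp: card_1_singleton_iff card_2_iff)
  let ?X = "[p, p2, p, p]" and ?K = "replicate k p"
  have pA: "p \<in> A" "p2 \<in> A" and qB: "q \<in> B" using XD(1) YD(1) p q by auto
  have nbr: "\<exists>x\<in>set ?X. s \<sim> x" if "s \<in> S" for s using XD(4)[OF that] p by auto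
  have "side adj (pverts G) q ?X ?K v \<longleftrightarrow> v \<in> S" for v
  proof
    assume "v \<in> S"
    with nbr obtain x where "x \<in> set ?X" "v \<sim> x" by blast
    then show "side adj (pverts G) q ?X ?K v"
      using pA \<open>v \<in> S\<close> by (intro side_complete[OF Y0 q]) auto
  next
    assume v: "side adj (pverts G) q ?X ?K v"
    then have "v \<in> pverts G" using adj_verts by (auto simp: side_def)
    moreover have "set ?X \<subseteq> A" using pA by simp
    moreover have "\<exists>y\<in>set ?X \<union> set ?K. w \<sim> y" if "w \<in> S" for w using nbr[OF that] by blast
    \<comment> \<open>Taking \<open>G\<close> for \<open>F\<close> turns correctness on the vertices
      of \<open>F\<close> into correctness everywhere.\<close>
    ultimately show "v \<in> S" by (intro side_sound[OF qB _ _ v, of G])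
  qed
  moreover have "S \<subseteq> pverts G" using A(3) by (auto simp: nbhd_def)
  ultimately have "{v \<in> pverts G. shat adj (pverts G) p q p2 q p q p q q q q q ?K ?K v} = S"
    by (auto simp: shat_def)
  then have "container F S {v \<in> pverts G. shat adj (pverts G) p q p2 q p q p q q q q q ?K ?K v}"
    by (simp add: container_def)
  moreover have "set [p, q, p2, q, p, q, p, q, q, q, q, q] \<union> set ?K \<union> set ?K \<subseteq> pverts G"
    using pA qB A(4) B(4) by (auto split: if_splits)
  moreover have "length ?K = k" by simp
  ultimately show ?thesis unfolding has_container_tuple_def by blast
qed

lemma (in full_pair) container_big:
  assumes X0: "min_dominator X0" "2 < card X0" and Y0: "full_pair.min_dominator G S B Y0" "2 < card Y0"
    and F: "induced_subgraph (with_proj F) (with_proj G)" "colorable k F"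
  shows "has_container_tuple k F S"
proof -
  have three: "\<exists>p p2 p3. {p, p2, p3} \<subseteq> Z \<and> distinct [p, p2, p3]" if "2 < card Z" for Z :: "'a set"
  proof -
    have "3 \<le> card Z" using that by simp
    then obtain Z' where "Z' \<subseteq> Z" "card Z' = 3" by (rule obtain_subset_with_card_n)
    then show ?thesis by (auto simp: card_3_iff)
  qed
  obtain p p2 p3 where P: "{p, p2, p3} \<subseteq> X0" "distinct [p, p2, p3]" using three[OF X0(2)] by blast
  obtain q q2 q3 where Q: "{q, q2, q3} \<subseteq> Y0" "distinct [q, q2, q3]" using three[OF Y0(2)] by blast
  interpret big_pair G S A B X0 Y0 p p2 p3 q q2 q3
    using X0 Y0 P Q by unfold_locales auto
  let ?V = "pverts G"
  obtain a b t1 t2 e r where ab: "a \<in> X0" "b \<in> Y0" and V: "{t1, t2, e, r} \<subseteq> ?V"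
    and far_sound: "\<And>v. far adj ?V p q [p, p2, p3, a] [q, q2, q3, b] t1 t2 e r v \<Longrightarrow> v \<in> S"
    and far_complete: "\<And>v. v \<in> S \<Longrightarrow> \<not> (\<exists>x\<in>set [p, p2, p3, a]. v \<sim> x) \<Longrightarrow>
       \<not> (\<exists>y\<in>set [q, q2, q3, b]. v \<sim> y) \<Longrightarrow> far adj ?V p q [p, p2, p3, a] [q, q2, q3, b] t1 t2 e r v"
    by (rule far_exact) blast
  let ?X = "[p, p2, p3, a]" and ?Y = "[q, q2, q3, b]"
  have XX: "set ?X \<subseteq> X0" "p \<in> set ?X" and YY: "set ?Y \<subseteq> Y0" "q \<in> set ?Y" using P Q ab by auto
  obtain KA where KA: "length KA = k" "set KA \<subseteq> A"
    and coverA: "\<And>f w x. f \<in> pverts F \<Longrightarrow> f \<in> A \<Longrightarrow> x \<in> set ?X \<Longrightarrow> f \<sim> x \<Longrightarrow> w \<in> S \<Longrightarrow> w \<sim> f \<Longrightarrow>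
       \<exists>y\<in>set ?X \<union> set KA. w \<sim> y"
    by (rule private_nbrs_cover[OF X0(1) XX F]) blast
  obtain KB where KB: "length KB = k" "set KB \<subseteq> B"
    and coverB: "\<And>f w x. f \<in> pverts F \<Longrightarrow> f \<in> B \<Longrightarrow> x \<in> set ?Y \<Longrightarrow> f \<sim> x \<Longrightarrow> w \<in> S \<Longrightarrow> w \<sim> f \<Longrightarrow>
       \<exists>y\<in>set ?Y \<union> set KB. w \<sim> y"
    by (rule sw.private_nbrs_cover[OF Y0(1) YY F]) blast
  have XA: "set ?X \<subseteq> A" and YB: "set ?Y \<subseteq> B"
    using XX YY dominatorD(1)[OF X0(1)] sw.dominatorD(1)[OF Y0(1)] by blast+
  have qq: "q \<sim> q2" using sw.min_dominator_clique[OF Y0(1)] Q by auto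
  let ?Z = "{v \<in> ?V. shat adj ?V p q p2 q2 p3 q3 a b t1 t2 e r KA KB v}"
  have X0': "full_pair.min_dominator G S A X0" using X0 by simp
  have "S \<subseteq> ?Z"
  proof
    fix s assume s: "s \<in> S"
    have "shat adj ?V p q p2 q2 p3 q3 a b t1 t2 e r KA KB s"
    proof (cases "\<exists>x\<in>set ?X. s \<sim> x")
      case True
      then show ?thesis
        using side_complete[OF Y0(1) mem(10) XA KA(2) s] unfolding shat_def by blast
    next
      case nX: False
      show ?thesis
      proof (cases "\<exists>y\<in>set ?Y. s \<sim> y")
        case True
        then show ?thesis
          using sw.side_complete[OF X0' mem(7) YB KB(2) s] qq unfolding shat_def by blast
      next
        case False
        then show ?thesis using far_complete[OF s nX False] qq unfolding shat_def by blast
      qed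
    qed
    moreover have "s \<in> ?V" using s A(3) by (auto simp: nbhd_def)
    ultimately show "s \<in> ?Z" by blast
  qed
  moreover have "v \<in> S" if vZ: "v \<in> ?Z" and vF: "v \<in> pverts F" for v
  proof -
    consider "side adj ?V q ?X KA v" | "side adj ?V p ?Y KB v" | "far adj ?V p q ?X ?Y t1 t2 e r v"
      using vZ unfolding shat_def by blast
    then show ?thesis
    proof cases
      case 1
      then show ?thesis by (rule side_sound[OF mem(4) XA vF]) (rule coverA)
    next
      case 2
      then show ?thesis by (rule sw.side_sound[OF mem(1) YB vF]) (rule coverB)
    next
      case 3
      then show ?thesis by (rule far_sound)
    qed
  qed
  ultimately have "container F S ?Z" unfolding container_def by blast
  moreover have "set [p, q, p2, q2, p3, q3, a, b, t1, t2, e, r] \<union> set KA \<union> set KB \<subseteq> ?V"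
    using XA YB KA(2) KB(2) A(4) B(4) V by auto
  ultimately show ?thesis unfolding has_container_tuple_def using KA(1) KB(1) by blast
qed

theorem (in C_graph) container_tuple_exists:
  assumes "minimal_separator G S" "induced_subgraph (with_proj F) (with_proj G)" "colorable k F"
  shows "has_container_tuple k F S"
proof -
  obtain A B where "full_pair G S A B" using minimal_separator_full_pair assms by blast
  then interpret full_pair G S A B .
  interpret sw: full_pair G S B A by (rule swap)
  obtain X0 Y0 where XY: "min_dominator X0" "sw.min_dominator Y0"
    using min_dominator_exists sw.min_dominator_exists by blast
  show ?thesis
  proof (cases "card X0 \<le> 2 \<or> card Y0 \<le> 2")
    case True
    then show ?thesis using container_small[OF XY(1)] sw.container_small[OF XY(2)] by blast
  next
    case False
    then show ?thesis using container_big[OF XY(1) _ XY(2) _ assms(2,3)] by simp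
  qed
qed

section \<open>Polynomial-time functions on binary trees\<close>

fun dsize :: "data \<Rightarrow> nat" where
  "dsize DNil = 1"
| "dsize (DCons a b) = 1 + dsize a + dsize b"

fun dlist :: "data \<Rightarrow> data list" where
  "dlist DNil = []"
| "dlist (DCons a b) = a # dlist b"

lemma enc_list_Nil [simp]: "enc_list [] = DNil"
  and enc_list_Cons [simp]: "enc_list (x # xs) = DCons x (enc_list xs)"
  by (simp_all add: enc_list_def)

lemma enc_list_dlist [simp]: "enc_list (dlist d) = d"
  by (induction d) auto

lemma dlist_enc_list [simp]: "dlist (enc_list xs) = xs"
  by (induction xs) auto

lemma dsize_pos [simp]: "0 < dsize d" "Suc 0 \<le> dsize d"
  by (cases d; simp)+

lemma dsize_dhd: "dsize (dhd d) \<le> dsize d" and dsize_dtl: "dsize (dtl d) \<le> dsize d"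
  by (cases d; simp)+

lemma length_dlist: "length (dlist d) \<le> dsize d"
  by (induction d) auto

lemma dsize_mem_dlist: "e \<in> set (dlist d) \<Longrightarrow> dsize e \<le> dsize d"
  by (induction d) auto

text \<open>One constant serves as factor and exponent; nothing is lost, as sizes are at least
  one.\<close>

definition pbounded :: "(data \<Rightarrow> nat) \<Rightarrow> bool" where
  "pbounded g \<longleftrightarrow> (\<exists>K. \<forall>x. g x \<le> K * dsize x ^ K)"

lemma pbounded_mono: "pbounded h \<Longrightarrow> (\<And>x. g x \<le> h x) \<Longrightarrow> pbounded g"
  unfolding pbounded_def by (meson le_trans)

lemma pbounded_const: "pbounded (\<lambda>_. c)"
  unfolding pbounded_def by (rule exI[of _ c]) simp

lemma pbounded_dsize: "pbounded dsize"
  unfolding pbounded_def by (rule exI[of _ 1]) simp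

lemma pbounded_add: assumes "pbounded g" "pbounded h" shows "pbounded (\<lambda>x. g x + h x)"
proof -
  obtain K L where KL: "\<And>x. g x \<le> K * dsize x ^ K" "\<And>x. h x \<le> L * dsize x ^ L"
    using assms by (auto simp: pbounded_def)
  have "g x + h x \<le> (K + L) * dsize x ^ (K + L)" for x
  proof -
    have "g x \<le> K * dsize x ^ (K + L)" "h x \<le> L * dsize x ^ (K + L)"
      by (rule order.trans[OF KL(1)] order.trans[OF KL(2)], intro mult_le_mono2 power_increasing, simp_all)+
    then show ?thesis by (simp add: add_mult_distrib)
  qed
  then show ?thesis unfolding pbounded_def by blast
qed

lemma pbounded_mult: assumes "pbounded g" "pbounded h" shows "pbounded (\<lambda>x. g x * h x)"
proof -
  obtain K L where KL: "\<And>x. g x \<le> K * dsize x ^ K" "\<And>x. h x \<le> L * dsize x ^ L"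
    using assms by (auto simp: pbounded_def)
  have "g x * h x \<le> (K * L + K + L) * dsize x ^ (K * L + K + L)" for x
  proof -
    have "g x * h x \<le> (K * dsize x ^ K) * (L * dsize x ^ L)" using KL by (rule mult_le_mono)
    also have "\<dots> = K * L * dsize x ^ (K + L)" by (simp add: power_add)
    also have "\<dots> \<le> (K * L + K + L) * dsize x ^ (K * L + K + L)"
      by (intro mult_le_mono power_increasing) auto
    finally show ?thesis .
  qed
  then show ?thesis unfolding pbounded_def by blast
qed

lemma pbounded_power: "pbounded g \<Longrightarrow> pbounded (\<lambda>x. g x ^ k)"
  by (induction k) (auto intro: pbounded_mult pbounded_const[of 1, simplified])

lemma pbounded_comp:
  assumes "pbounded g" "pbounded h" "\<And>x. dsize (f x) \<le> h x"
  shows "pbounded (\<lambda>x. g (f x))"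
proof -
  obtain K where K: "\<And>x. g x \<le> K * dsize x ^ K" using assms(1) by (auto simp: pbounded_def)
  show ?thesis
  proof (rule pbounded_mono)
    show "pbounded (\<lambda>x. K * h x ^ K)" using assms(2) by (intro pbounded_mult pbounded_const pbounded_power)
    show "g (f x) \<le> K * h x ^ K" for x
      using K[of "f x"] assms(3)[of x] by (meson le_trans mult_le_mono2 power_mono le0)
  qed
qed

section \<open>Running times of programs\<close>

definition halts :: "com \<Rightarrow> store \<Rightarrow> nat \<Rightarrow> store \<Rightarrow> bool" where
  "halts c s T s' \<longleftrightarrow> (\<exists>t\<le>T. exec c s t s')"

lemma halts_mono: "halts c s T s' \<Longrightarrow> T \<le> U \<Longrightarrow> halts c s U s'"
  unfolding halts_def by (meson le_trans)

lemma halts_skip: "halts CSkip s 1 s"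
  unfolding halts_def using exec.skip by blast

lemma halts_assign: "halts (CAssign x e) s (1 + expr_cost e) (s(x := eval_expr e s))"
  unfolding halts_def using exec.assign by blast

lemma halts_seq:
  "halts c s T s' \<Longrightarrow> halts d s' U s'' \<Longrightarrow> halts (CSeq c d) s (1 + T + U) s''"
  unfolding halts_def by (meson exec.seq add_le_mono le_refl)

lemma halts_if_true:
  "eval_expr e s \<noteq> DNil \<Longrightarrow> halts c s T s' \<Longrightarrow> halts (CIf e c d) s (1 + expr_cost e + T) s'"
  unfolding halts_def by (meson exec.if_true add_le_mono le_refl)

lemma halts_if_false:
  "eval_expr e s = DNil \<Longrightarrow> halts d s T s' \<Longrightarrow> halts (CIf e c d) s (1 + expr_cost e + T) s'"
  unfolding halts_def by (meson exec.if_false add_le_mono le_refl)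

lemma halts_while_false: "eval_expr e s = DNil \<Longrightarrow> halts (CWhile e c) s (1 + expr_cost e) s"
  unfolding halts_def using exec.while_false by blast

lemma halts_while_true:
  "eval_expr e s \<noteq> DNil \<Longrightarrow> halts c s T s' \<Longrightarrow> halts (CWhile e c) s' U s'' \<Longrightarrow>
    halts (CWhile e c) s (1 + expr_cost e + T + U) s''"
  unfolding halts_def by (meson exec.while_true add_le_mono le_refl)

text \<open>Variable \<open>d\<close> is argument and result; the variables below \<open>d\<close> are kept, those above are scratch.\<close>

definition computes :: "com \<Rightarrow> nat \<Rightarrow> (data \<Rightarrow> data) \<Rightarrow> (data \<Rightarrow> nat) \<Rightarrow> bool" where
  "computes c d f T \<longleftrightarrow> (\<forall>s. \<exists>s'. halts c s (T (s d)) s' \<and> s' d = f (s d) \<and> (\<forall>i<d. s' i = s i))"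

text \<open>Time does not control size: consing a variable with itself doubles a tree at constant
  cost, so the size bound is a separate demand. A program is required for every \<open>d\<close> so
  that subprograms can be placed above variables still in use.\<close>

definition ptime :: "(data \<Rightarrow> data) \<Rightarrow> bool" where
  "ptime f \<longleftrightarrow> pbounded (\<lambda>x. dsize (f x)) \<and> (\<forall>d. \<exists>c T. pbounded T \<and> computes c d f T)"

lemma ptime_size: "ptime f \<Longrightarrow> pbounded (\<lambda>x. dsize (f x))"
  by (simp add: ptime_def)

lemma ptime_program:
  assumes "ptime f" obtains c T where "pbounded T" "computes c d f T"
  using assms unfolding ptime_def by blast

lemma computesD:
  assumes "computes c d f T"
  obtains s' where "halts c s (T (s d)) s'" "s' d = f (s d)" "\<And>i. i < d \<Longrightarrow> s' i = s i"
  using assms by (auto simp: computes_def)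

lemma ptime_id: "ptime (\<lambda>x. x)"
proof -
  have "computes CSkip d (\<lambda>x. x) (\<lambda>_. 1)" for d
    unfolding computes_def using halts_skip by blast
  then show ?thesis unfolding ptime_def using pbounded_dsize pbounded_const by blast
qed

lemma ptime_comp:
  assumes f: "ptime f" and g: "ptime g"
  shows "ptime (\<lambda>x. g (f x))"
  unfolding ptime_def
proof (intro conjI allI)
  show "pbounded (\<lambda>x. dsize (g (f x)))"
    using pbounded_comp[OF ptime_size[OF g] ptime_size[OF f]] by blast
  fix d
  obtain c T where c: "pbounded T" "computes c d f T" using f by (rule ptime_program)
  obtain c' T' where c': "pbounded T'" "computes c' d g T'" using g by (rule ptime_program)
  have "pbounded (\<lambda>x. 1 + T x + T' (f x))"
    using pbounded_comp[OF c'(1) ptime_size[OF f]] c(1) by (intro pbounded_add pbounded_const) auto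
  moreover have "computes (CSeq c c') d (\<lambda>x. g (f x)) (\<lambda>x. 1 + T x + T' (f x))"
    unfolding computes_def
  proof
    fix s
    obtain s1 where s1: "halts c s (T (s d)) s1" "s1 d = f (s d)" "\<And>i. i < d \<Longrightarrow> s1 i = s i"
      using c(2) by (rule computesD[where s = "s"]) blast
    obtain s2 where s2: "halts c' s1 (T' (s1 d)) s2" "s2 d = g (s1 d)" "\<And>i. i < d \<Longrightarrow> s2 i = s1 i"
      using c'(2) by (rule computesD[where s = "s1"]) blast
    then show "\<exists>s'. halts (CSeq c c') s (1 + T (s d) + T' (f (s d))) s' \<and> s' d = g (f (s d)) \<and> (\<forall>i<d. s' i = s i)"
      using halts_seq[OF s1(1) s2(1)] s1 by (intro exI[of _ s2]) auto
  qed
  ultimately show "\<exists>c T. pbounded T \<and> computes c d (\<lambda>x. g (f x)) T" by blast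
qed

lemma computes_assign:
  assumes "\<And>s. eval_expr e s = f (s d)" "\<And>x. 1 + expr_cost e \<le> T x"
  shows "computes (CAssign d e) d f T"
  unfolding computes_def
proof
  fix s
  show "\<exists>s'. halts (CAssign d e) s (T (s d)) s' \<and> s' d = f (s d) \<and> (\<forall>i<d. s' i = s i)"
    using halts_mono[OF halts_assign assms(2)[of "s d"]] assms(1)
    by (intro exI[of _ "s(d := eval_expr e s)"]) simp
qed

lemma ptime_nil: "ptime (\<lambda>_. DNil)"
proof -
  have "computes (CAssign d ENil) d (\<lambda>_. DNil) (\<lambda>_. 2)" for d by (rule computes_assign) auto
  then show ?thesis unfolding ptime_def using pbounded_const by blast
qed

lemma ptime_dhd: assumes "ptime f" shows "ptime (\<lambda>x. dhd (f x))"
proof (rule ptime_comp[OF assms])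
  have "pbounded (\<lambda>x. dsize (dhd x))" by (rule pbounded_mono[OF pbounded_dsize dsize_dhd])
  moreover have "computes (CAssign d (EHd (EVar d))) d dhd (\<lambda>_. 3)" for d by (rule computes_assign) auto
  ultimately show "ptime dhd" unfolding ptime_def using pbounded_const by blast
qed

lemma ptime_dtl: assumes "ptime f" shows "ptime (\<lambda>x. dtl (f x))"
proof (rule ptime_comp[OF assms])
  have "pbounded (\<lambda>x. dsize (dtl x))" by (rule pbounded_mono[OF pbounded_dsize dsize_dtl])
  moreover have "computes (CAssign d (ETl (EVar d))) d dtl (\<lambda>_. 3)" for d by (rule computes_assign) auto
  ultimately show "ptime dtl" unfolding ptime_def using pbounded_const by blast
qed

lemma ptime_cons:
  assumes f: "ptime f" and g: "ptime g"
  shows "ptime (\<lambda>x. DCons (f x) (g x))"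
  unfolding ptime_def
proof (intro conjI allI)
  show "pbounded (\<lambda>x. dsize (DCons (f x) (g x)))"
    using pbounded_add[OF pbounded_add[OF pbounded_const[of 1] ptime_size[OF f]] ptime_size[OF g]] by simp
  fix d
  obtain c T where c: "pbounded T" "computes c (d + 1) f T" using f by (rule ptime_program)
  obtain c' T' where c': "pbounded T'" "computes c' (d + 2) g T'" using g by (rule ptime_program)
  let ?p = "CSeq (CAssign (d + 1) (EVar d)) (CSeq c (CSeq (CAssign (d + 2) (EVar d))
      (CSeq c' (CAssign d (ECons (EVar (d + 1)) (EVar (d + 2)))))))"
  let ?T = "\<lambda>x. 12 + T x + T' x"
  have "pbounded ?T" using c(1) c'(1) by (intro pbounded_add pbounded_const)
  moreover have "computes ?p d (\<lambda>x. DCons (f x) (g x)) ?T"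
    unfolding computes_def
  proof
    fix s
    let ?s1 = "s(d + 1 := eval_expr (EVar d) s)"
    obtain s2 where s2: "halts c ?s1 (T (?s1 (d + 1))) s2" "s2 (d + 1) = f (?s1 (d + 1))"
      "\<And>i. i < d + 1 \<Longrightarrow> s2 i = ?s1 i"
      using c(2) by (rule computesD[where s = "?s1"]) blast
    let ?s3 = "s2(d + 2 := eval_expr (EVar d) s2)"
    obtain s4 where s4: "halts c' ?s3 (T' (?s3 (d + 2))) s4" "s4 (d + 2) = g (?s3 (d + 2))"
      "\<And>i. i < d + 2 \<Longrightarrow> s4 i = ?s3 i"
      using c'(2) by (rule computesD[where s = "?s3"]) blast
    let ?e = "ECons (EVar (d + 1)) (EVar (d + 2))"
    let ?s5 = "s4(d := eval_expr ?e s4)"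
    have "halts ?p s (1 + (1 + expr_cost (EVar d)) + (1 + T (?s1 (d + 1)) + (1 + (1 + expr_cost (EVar d)) +
        (1 + T' (?s3 (d + 2)) + (1 + expr_cost ?e))))) ?s5"
      by (intro halts_seq[OF halts_assign] halts_seq[OF s2(1)] halts_seq[OF s4(1)] halts_assign)
    then have "halts ?p s (?T (s d)) ?s5"
      by (rule halts_mono) (use s2(3)[of d] in simp)
    moreover have "?s5 d = DCons (f (s d)) (g (s d))"
      using s4(2) s4(3)[of "d + 1"] s2(2) s2(3)[of d] by simp
    moreover have "?s5 i = s i" if "i < d" for i
      using s4(3)[of i] s2(3)[of i] that by simp
    ultimately show "\<exists>s'. halts ?p s (?T (s d)) s' \<and> s' d = DCons (f (s d)) (g (s d)) \<and> (\<forall>i<d. s' i = s i)"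
      by blast
  qed
  ultimately show "\<exists>c T. pbounded T \<and> computes c d (\<lambda>x. DCons (f x) (g x)) T" by blast
qed

lemma ptime_const: "ptime (\<lambda>_. v)"
  by (induction v) (auto intro: ptime_nil ptime_cons)

lemma ptime_if:
  assumes b: "ptime b" and f: "ptime f" and g: "ptime g"
  shows "ptime (\<lambda>x. if b x \<noteq> DNil then f x else g x)"
  unfolding ptime_def
proof (intro conjI allI)
  show "pbounded (\<lambda>x. dsize (if b x \<noteq> DNil then f x else g x))"
    by (rule pbounded_mono[OF pbounded_add[OF ptime_size[OF f] ptime_size[OF g]]]) auto
  fix d
  obtain c0 T0 where c0: "pbounded T0" "computes c0 (d + 1) b T0" using b by (rule ptime_program)
  obtain c T where c: "pbounded T" "computes c d f T" using f by (rule ptime_program)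
  obtain c' T' where c': "pbounded T'" "computes c' d g T'" using g by (rule ptime_program)
  let ?p = "CSeq (CAssign (d + 1) (EVar d)) (CSeq c0 (CIf (EVar (d + 1)) c c'))"
  let ?T = "\<lambda>x. 6 + T0 x + T x + T' x"
  have "pbounded ?T" using c0(1) c(1) c'(1) by (intro pbounded_add pbounded_const)
  moreover have "computes ?p d (\<lambda>x. if b x \<noteq> DNil then f x else g x) ?T"
    unfolding computes_def
  proof
    fix s
    let ?s1 = "s(d + 1 := eval_expr (EVar d) s)"
    obtain s2 where s2: "halts c0 ?s1 (T0 (?s1 (d + 1))) s2" "s2 (d + 1) = b (?s1 (d + 1))"
      "\<And>i. i < d + 1 \<Longrightarrow> s2 i = ?s1 i"
      using c0(2) by (rule computesD[where s = "?s1"]) blast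
    have s2d: "s2 d = s d" "s2 (d + 1) = b (s d)" using s2 by simp_all
    obtain s3 where s3: "halts (CIf (EVar (d + 1)) c c') s2 (2 + T (s d) + T' (s d)) s3"
      "s3 d = (if b (s d) \<noteq> DNil then f (s d) else g (s d))" "\<And>i. i < d \<Longrightarrow> s3 i = s2 i"
    proof (cases "b (s d) = DNil")
      case True
      obtain s3 where "halts c' s2 (T' (s2 d)) s3" "s3 d = g (s2 d)" "\<And>i. i < d \<Longrightarrow> s3 i = s2 i"
        using c'(2) by (rule computesD[where s = "s2"]) blast
      moreover from this(1) have "halts (CIf (EVar (d + 1)) c c') s2 (1 + expr_cost (EVar (d + 1)) + T' (s2 d)) s3"
        using True s2d by (intro halts_if_false) auto
      then have "halts (CIf (EVar (d + 1)) c c') s2 (2 + T (s d) + T' (s d)) s3"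
        by (rule halts_mono) (use s2d in simp)
      ultimately show ?thesis using that True s2d by auto
    next
      case False
      obtain s3 where "halts c s2 (T (s2 d)) s3" "s3 d = f (s2 d)" "\<And>i. i < d \<Longrightarrow> s3 i = s2 i"
        using c(2) by (rule computesD[where s = "s2"]) blast
      moreover from this(1) have "halts (CIf (EVar (d + 1)) c c') s2 (1 + expr_cost (EVar (d + 1)) + T (s2 d)) s3"
        using False s2d by (intro halts_if_true) auto
      then have "halts (CIf (EVar (d + 1)) c c') s2 (2 + T (s d) + T' (s d)) s3"
        by (rule halts_mono) (use s2d in simp)
      ultimately show ?thesis using that False s2d by auto
    qed
    have "halts ?p s (1 + (1 + expr_cost (EVar d)) + (1 + T0 (?s1 (d + 1)) + (2 + T (s d) + T' (s d)))) s3"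
      by (intro halts_seq[OF halts_assign] halts_seq[OF s2(1)] s3(1))
    then have "halts ?p s (?T (s d)) s3" by (rule halts_mono) simp
    moreover have "s3 i = s i" if "i < d" for i using s3(3)[of i] s2(3)[of i] that by simp
    ultimately show "\<exists>s'. halts ?p s (?T (s d)) s' \<and> s' d = (if b (s d) \<noteq> DNil then f (s d) else g (s d)) \<and>
        (\<forall>i<d. s' i = s i)"
      using s3(2) by blast
  qed
  ultimately show "\<exists>c T. pbounded T \<and> computes c d (\<lambda>x. if b x \<noteq> DNil then f x else g x) T" by blast
qed

text \<open>Variable \<open>d\<close> holds the environment, \<open>d + 1\<close> the rest of the
  list, \<open>d + 2\<close> the accumulator, \<open>d + 3\<close> the argument and result of
  \<open>h\<close>. \<open>M\<close> has to bound the cost of \<open>ch\<close> only on the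
  arguments that occur; \<open>17\<close> is the cost of a round apart from
  \<open>ch\<close>.\<close>

lemma fold_loop:
  fixes d :: nat and h :: "data \<Rightarrow> data"
  defines "body \<equiv> \<lambda>ch. CSeq (CAssign (d + 3) (ECons (EVar d) (ECons (EHd (EVar (d + 1))) (EVar (d + 2)))))
      (CSeq ch (CSeq (CAssign (d + 2) (EVar (d + 3))) (CAssign (d + 1) (ETl (EVar (d + 1))))))"
  assumes ch: "computes ch (d + 3) h T"
    and "dlist (s (d + 1)) = ls"
    and "\<And>us e vs. ls = us @ e # vs \<Longrightarrow>
      T (DCons (s d) (DCons e (fold (\<lambda>e a. h (DCons (s d) (DCons e a))) us (s (d + 2))))) \<le> M"
  shows "\<exists>s'. halts (CWhile (EVar (d + 1)) (body ch)) s (2 + length ls * (M + 17)) s' \<and>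
      s' (d + 2) = fold (\<lambda>e a. h (DCons (s d) (DCons e a))) ls (s (d + 2)) \<and> (\<forall>i\<le>d. s' i = s i)"
  using assms(3,4)
proof (induction ls arbitrary: s)
  case Nil
  then have "s (d + 1) = DNil" by (metis enc_list_Nil enc_list_dlist)
  then have "halts (CWhile (EVar (d + 1)) (body ch)) s (1 + expr_cost (EVar (d + 1))) s"
    by (intro halts_while_false) simp
  then have "halts (CWhile (EVar (d + 1)) (body ch)) s (2 + length [] * (M + 17)) s"
    by (rule halts_mono) simp
  then show ?case by auto
next
  case (Cons e ls)
  have sd: "s (d + 1) = DCons e (enc_list ls)" by (metis Cons.prems(1) enc_list_Cons enc_list_dlist)
  let ?arg = "DCons (s d) (DCons e (s (d + 2)))"
  let ?e = "ECons (EVar d) (ECons (EHd (EVar (d + 1))) (EVar (d + 2)))"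
  define s1 where "s1 = s(d + 3 := eval_expr ?e s)"
  have s1: "s1 (d + 3) = ?arg" using sd by (simp add: s1_def)
  obtain s2 where s2: "halts ch s1 (T (s1 (d + 3))) s2" "s2 (d + 3) = h (s1 (d + 3))"
    "\<And>i. i < d + 3 \<Longrightarrow> s2 i = s1 i"
    using ch by (rule computesD[where s = s1]) blast
  have keep: "s2 i = s i" if "i < d + 3" for i using s2(3)[OF that] that by (simp add: s1_def)
  define s3 where "s3 = s2(d + 2 := eval_expr (EVar (d + 3)) s2)"
  define s4 where "s4 = s3(d + 1 := eval_expr (ETl (EVar (d + 1))) s3)"
  have s4: "s4 d = s d" "s4 (d + 1) = enc_list ls" "s4 (d + 2) = h ?arg" "\<And>i. i \<le> d \<Longrightarrow> s4 i = s i"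
    using keep[of "d + 1"] keep sd s2(2) s1 by (simp_all add: s3_def s4_def)
  have "T ?arg \<le> M" using Cons.prems(2)[of "[]" e ls] by simp
  have "halts (body ch) s (1 + (1 + expr_cost ?e) + (1 + T (s1 (d + 3)) +
      (1 + (1 + expr_cost (EVar (d + 3))) + (1 + expr_cost (ETl (EVar (d + 1))))))) s4"
    using s2(1) unfolding body_def s4_def s3_def s1_def
    by (intro halts_seq[OF halts_assign] halts_seq[where s' = s2] halts_assign)
  then have step: "halts (body ch) s (M + 15) s4"
    by (rule halts_mono) (use \<open>T ?arg \<le> M\<close> s1 in simp)
  have "\<exists>s'. halts (CWhile (EVar (d + 1)) (body ch)) s4 (2 + length ls * (M + 17)) s' \<and>
      s' (d + 2) = fold (\<lambda>e a. h (DCons (s4 d) (DCons e a))) ls (s4 (d + 2)) \<and> (\<forall>i\<le>d. s' i = s4 i)"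
  proof (rule Cons.IH)
    show "dlist (s4 (d + 1)) = ls" using s4 by simp
    show "T (DCons (s4 d) (DCons e' (fold (\<lambda>e a. h (DCons (s4 d) (DCons e a))) us (s4 (d + 2))))) \<le> M"
      if "ls = us @ e' # vs" for us e' vs
      using Cons.prems(2)[of "e # us" e' vs] that s4 by simp
  qed
  then obtain s' where s': "halts (CWhile (EVar (d + 1)) (body ch)) s4 (2 + length ls * (M + 17)) s'"
    "s' (d + 2) = fold (\<lambda>e a. h (DCons (s4 d) (DCons e a))) ls (s4 (d + 2))" "\<forall>i\<le>d. s' i = s4 i"
    by blast
  have "halts (CWhile (EVar (d + 1)) (body ch)) s
      (1 + expr_cost (EVar (d + 1)) + (M + 15) + (2 + length ls * (M + 17))) s'"
    using sd by (intro halts_while_true[OF _ step s'(1)]) simp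
  then have "halts (CWhile (EVar (d + 1)) (body ch)) s (2 + length (e # ls) * (M + 17)) s'"
    by (rule halts_mono) simp
  then show ?case using s' s4 by (intro exI[of _ s']) simp
qed

text \<open>The running time is polynomial in a bound \<open>M\<close> on all sizes involved; the accumulator may
  outgrow every polynomial in the input size.\<close>

lemma fold_program:
  assumes h: "ptime h"
  shows "\<exists>c K. \<forall>s env l a M. s d = DCons env (DCons l a) \<longrightarrow> dsize env \<le> M \<longrightarrow> dsize l \<le> M \<longrightarrow>
     (\<forall>us vs. dlist l = us @ vs \<longrightarrow> dsize (fold (\<lambda>e a. h (DCons env (DCons e a))) us a) \<le> M) \<longrightarrow>
     (\<exists>s'. halts c s (K * M ^ K) s' \<and> s' d = fold (\<lambda>e a. h (DCons env (DCons e a))) (dlist l) a \<and>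
        (\<forall>i<d. s' i = s i))"
proof -
  obtain ch T where ch: "pbounded T" "computes ch (d + 3) h T" using h by (rule ptime_program)
  obtain L where L: "\<And>x. T x \<le> L * dsize x ^ L" using ch(1) by (auto simp: pbounded_def)
  let ?W = "CWhile (EVar (d + 1)) (CSeq (CAssign (d + 3) (ECons (EVar d) (ECons (EHd (EVar (d + 1))) (EVar (d + 2)))))
      (CSeq ch (CSeq (CAssign (d + 2) (EVar (d + 3))) (CAssign (d + 1) (ETl (EVar (d + 1)))))))"
  let ?p = "CSeq (CAssign (d + 1) (EHd (ETl (EVar d)))) (CSeq (CAssign (d + 2) (ETl (ETl (EVar d))))
      (CSeq (CAssign d (EHd (EVar d))) (CSeq ?W (CAssign d (EVar (d + 2))))))"
  \<comment> \<open>The factor \<open>5 ^ L\<close> stems from arguments of size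
    \<open>5 * M\<close>: two nodes and three trees. \<open>40\<close> covers the remaining steps,
    and the exponent exceeds \<open>L\<close> because the loop runs up to \<open>M\<close>
    times.\<close>
  let ?K = "L * 5 ^ L + 40 + L"
  have "\<exists>s'. halts ?p s (?K * M ^ ?K) s' \<and> s' d = fold (\<lambda>e a. h (DCons env (DCons e a))) (dlist l) a \<and>
        (\<forall>i<d. s' i = s i)"
    if sd: "s d = DCons env (DCons l a)" and M: "dsize env \<le> M" "dsize l \<le> M"
      and acc: "\<And>us vs. dlist l = us @ vs \<Longrightarrow> dsize (fold (\<lambda>e a. h (DCons env (DCons e a))) us a) \<le> M"
    for s env l a M
  proof -
    have M1: "1 \<le> M" using M(1) dsize_pos(1)[of env] by linarith
    define s1 where "s1 = s(d + 1 := eval_expr (EHd (ETl (EVar d))) s)"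
    define s2 where "s2 = s1(d + 2 := eval_expr (ETl (ETl (EVar d))) s1)"
    define s3 where "s3 = s2(d := eval_expr (EHd (EVar d)) s2)"
    have s3: "s3 d = env" "s3 (d + 1) = l" "s3 (d + 2) = a" "\<And>i. i < d \<Longrightarrow> s3 i = s i"
      using sd by (simp_all add: s1_def s2_def s3_def)
    let ?B = "L * 5 ^ L * M ^ L"
    have bound: "T (DCons (s3 d) (DCons e (fold (\<lambda>e a. h (DCons (s3 d) (DCons e a))) us (s3 (d + 2))))) \<le> ?B"
      if us: "dlist l = us @ e # vs" for us e vs
    proof -
      let ?a = "fold (\<lambda>e a. h (DCons env (DCons e a))) us a"
      have "dsize e \<le> M" using dsize_mem_dlist[of e l] us M(2) by simp
      then have "dsize (DCons env (DCons e ?a)) \<le> 5 * M" using acc[OF us] M(1) M1 by simp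
      then have "T (DCons env (DCons e ?a)) \<le> L * (5 * M) ^ L"
        using L by (meson le_trans mult_le_mono2 power_mono le0)
      then show ?thesis using s3 by (simp add: power_mult_distrib)
    qed
    obtain s4 where s4: "halts ?W s3 (2 + length (dlist l) * (?B + 17)) s4"
      "s4 (d + 2) = fold (\<lambda>e a. h (DCons env (DCons e a))) (dlist l) a" "\<forall>i\<le>d. s4 i = s3 i"
      using fold_loop[OF ch(2), of s3 "dlist l" ?B] s3 bound by auto
    let ?s5 = "s4(d := eval_expr (EVar (d + 2)) s4)"
    have "halts ?p s (1 + (1 + expr_cost (EHd (ETl (EVar d)))) + (1 + (1 + expr_cost (ETl (ETl (EVar d)))) +
        (1 + (1 + expr_cost (EHd (EVar d))) + (1 + (2 + length (dlist l) * (?B + 17)) + (1 + expr_cost (EVar (d + 2))))))) ?s5"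
      using s4(1) unfolding s3_def s2_def s1_def
      by (intro halts_seq[OF halts_assign] halts_seq[where s' = s4] halts_assign)
    then have "halts ?p s (?K * M ^ ?K) ?s5"
    proof (rule halts_mono)
      have "length (dlist l) \<le> M" using length_dlist[of l] M(2) by linarith
      then have "length (dlist l) * (?B + 17) \<le> M * (?B + 17)" by (rule mult_le_mono1)
      also have "M * (?B + 17) \<le> M * ((L * 5 ^ L + 17) * M ^ L)"
        using M1 by (simp add: add_mult_distrib)
      also have "\<dots> = (L * 5 ^ L + 17) * M ^ (L + 1)" by simp
      finally have "length (dlist l) * (?B + 17) + 21 \<le> (L * 5 ^ L + 17) * M ^ (L + 1) + 21 * M ^ (L + 1)"
        using M1 by (intro add_mono) simp_all
      also have "\<dots> = (L * 5 ^ L + 38) * M ^ (L + 1)" by (simp add: add_mult_distrib)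
      also have "\<dots> \<le> ?K * M ^ ?K" using M1 by (intro mult_le_mono power_increasing) auto
      finally show "1 + (1 + expr_cost (EHd (ETl (EVar d)))) + (1 + (1 + expr_cost (ETl (ETl (EVar d)))) +
        (1 + (1 + expr_cost (EHd (EVar d))) + (1 + (2 + length (dlist l) * (?B + 17)) + (1 + expr_cost (EVar (d + 2)))))) \<le> ?K * M ^ ?K"
        by simp
    qed
    moreover have "?s5 i = s i" if "i < d" for i using s4(3) s3(4)[OF that] that by simp
    moreover have "?s5 d = fold (\<lambda>e a. h (DCons env (DCons e a))) (dlist l) a" using s4(2) by simp
    ultimately show ?thesis by blast
  qed
  then show ?thesis by blast
qed

text \<open>A polynomial-time step may double its accumulator in every round, so a fold of it can
  grow exponentially. Hence the bound \<open>q\<close> on all intermediate accumulators, which also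
  supplies the \<open>M\<close> of \<open>fold_program\<close>.\<close>

lemma ptime_fold:
  assumes H: "ptime (\<lambda>z. H (dhd z) (dhd (dtl z)) (dtl (dtl z)))" and l: "ptime l" and i: "ptime i"
    and q: "pbounded q" "\<And>x us vs. dlist (l x) = us @ vs \<Longrightarrow> dsize (fold (H x) us (i x)) \<le> q x"
  shows "ptime (\<lambda>x. fold (H x) (dlist (l x)) (i x))"
proof -
  let ?h = "\<lambda>z. H (dhd z) (dhd (dtl z)) (dtl (dtl z))"
  let ?M = "\<lambda>x. dsize x + dsize (l x) + q x"
  have "ptime (\<lambda>x. DCons x (DCons (l x) (i x)))" by (intro ptime_cons ptime_id l i)
  note prep = ptime_program[OF this]
  show ?thesis
    unfolding ptime_def
  proof (intro conjI allI)
    show "pbounded (\<lambda>x. dsize (fold (H x) (dlist (l x)) (i x)))"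
      by (rule pbounded_mono[OF q(1)]) (rule q(2)[of _ _ "[]"], simp)
    fix d
    obtain c T where c: "pbounded T" "computes c d (\<lambda>x. DCons x (DCons (l x) (i x))) T" by (rule prep)
    obtain c' K where c': "\<And>s env l a M. s d = DCons env (DCons l a) \<Longrightarrow> dsize env \<le> M \<Longrightarrow> dsize l \<le> M \<Longrightarrow>
      (\<forall>us vs. dlist l = us @ vs \<longrightarrow> dsize (fold (H env) us a) \<le> M) \<Longrightarrow>
      \<exists>s'. halts c' s (K * M ^ K) s' \<and> s' d = fold (H env) (dlist l) a \<and> (\<forall>i<d. s' i = s i)"
      using fold_program[OF H, of d] unfolding dhd.simps dtl.simps by blast
    let ?T = "\<lambda>x. 1 + T x + K * ?M x ^ K"
    have "pbounded ?T" by (intro pbounded_add pbounded_mult pbounded_power pbounded_const c(1) pbounded_dsize ptime_size[OF l] q(1))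
    moreover have "computes (CSeq c c') d (\<lambda>x. fold (H x) (dlist (l x)) (i x)) ?T"
      unfolding computes_def
    proof
      fix s
      obtain s1 where s1: "halts c s (T (s d)) s1" "s1 d = DCons (s d) (DCons (l (s d)) (i (s d)))"
        "\<And>i. i < d \<Longrightarrow> s1 i = s i"
        using c(2) by (rule computesD[where s = s]) blast
      have "\<forall>us vs. dlist (l (s d)) = us @ vs \<longrightarrow> dsize (fold (H (s d)) us (i (s d))) \<le> ?M (s d)"
        using q(2) by (meson le_trans le_add2)
      then obtain s2 where s2: "halts c' s1 (K * ?M (s d) ^ K) s2" "s2 d = fold (H (s d)) (dlist (l (s d))) (i (s d))"
        "\<forall>i<d. s2 i = s1 i"
        using c'[where s = s1, OF s1(2), of "?M (s d)"] by auto
      show "\<exists>s'. halts (CSeq c c') s (?T (s d)) s' \<and> s' d = fold (H (s d)) (dlist (l (s d))) (i (s d)) \<and>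
          (\<forall>i<d. s' i = s i)"
        using halts_seq[OF s1(1) s2(1)] s2(2,3) s1(3) by (intro exI[of _ s2]) simp
    qed
    ultimately show "\<exists>c T. pbounded T \<and> computes c d (\<lambda>x. fold (H x) (dlist (l x)) (i x)) T" by blast
  qed
qed

text \<open>Transformers of an accumulator whose size they increase by a polynomial in the environment only;
  folding such a transformer stays polynomial.\<close>

definition pacc :: "(data \<Rightarrow> data \<Rightarrow> data) \<Rightarrow> bool" where
  "pacc H \<longleftrightarrow> ptime (\<lambda>z. H (dhd z) (dtl z)) \<and> (\<exists>q. pbounded q \<and> (\<forall>x a. dsize (H x a) \<le> dsize a + q x))"

lemma pacc_run:
  assumes "pacc H" "ptime i"
  shows "ptime (\<lambda>x. H x (i x))"
proof -
  have "ptime (\<lambda>x. DCons x (i x))" by (intro ptime_cons ptime_id assms(2))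
  then show ?thesis using ptime_comp[of "\<lambda>x. DCons x (i x)" "\<lambda>z. H (dhd z) (dtl z)"] assms(1)
    by (simp add: pacc_def)
qed

lemma ptime_env: "ptime f \<Longrightarrow> ptime (\<lambda>z. f (dhd z))"
  by (rule ptime_comp[OF ptime_dhd[OF ptime_id]])

lemma pacc_cons: assumes "ptime f" shows "pacc (\<lambda>x a. DCons (f x) a)"
proof -
  have "ptime (\<lambda>z. DCons (f (dhd z)) (dtl z))"
    by (intro ptime_cons ptime_env assms ptime_dtl ptime_id)
  moreover have "pbounded (\<lambda>x. 1 + dsize (f x))"
    by (intro pbounded_add pbounded_const ptime_size assms)
  ultimately show ?thesis unfolding pacc_def by (auto intro!: exI[of _ "\<lambda>x. 1 + dsize (f x)"])
qed

lemma pacc_dtl: "pacc (\<lambda>x a. dtl a)"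
  unfolding pacc_def
  using ptime_dtl[OF ptime_dtl[OF ptime_id]] pbounded_const[of 0] dsize_dtl by fastforce

lemma pacc_id: "pacc (\<lambda>x a. a)"
  unfolding pacc_def using ptime_dtl[OF ptime_id] pbounded_const[of 0] by fastforce

lemma pacc_const: assumes "ptime f" shows "pacc (\<lambda>x a. f x)"
  unfolding pacc_def using ptime_env[OF assms] ptime_size[OF assms] by (meson le_add2)

lemma pacc_if:
  assumes "ptime b" "pacc F" "pacc H"
  shows "pacc (\<lambda>x a. if b x \<noteq> DNil then F x a else H x a)"
proof -
  obtain q q' where q: "pbounded q" "\<And>x a. dsize (F x a) \<le> dsize a + q x"
    "pbounded q'" "\<And>x a. dsize (H x a) \<le> dsize a + q' x"
    using assms(2,3) unfolding pacc_def by blast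
  have "ptime (\<lambda>z. if b (dhd z) \<noteq> DNil then F (dhd z) (dtl z) else H (dhd z) (dtl z))"
    using assms by (intro ptime_if ptime_env) (auto simp: pacc_def)
  moreover have "pbounded (\<lambda>x. q x + q' x)" using q by (intro pbounded_add)
  moreover have "dsize (if b x \<noteq> DNil then F x a else H x a) \<le> dsize a + (q x + q' x)" for x a
    using q(2)[of x a] q(4)[of x a] by auto
  ultimately show ?thesis unfolding pacc_def by blast
qed

text \<open>Each of at most \<open>dsize (l x)\<close> rounds adds a polynomial amount, so growth
  remains additive and folds can be nested. The list element is passed to the inner transformer as
  part of its environment, whence \<open>dhd z\<close> and \<open>dtl z\<close>.\<close>

lemma pacc_fold:
  assumes l: "ptime l" and H: "pacc (\<lambda>z a. H (dhd z) (dtl z) a)"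
  shows "pacc (\<lambda>x a. fold (\<lambda>e a. H x e a) (dlist (l x)) a)"
proof -
  obtain g where g: "pbounded g" "\<And>z a. dsize (H (dhd z) (dtl z) a) \<le> dsize a + g z"
    using H unfolding pacc_def by blast
  obtain K where K: "\<And>z. g z \<le> K * dsize z ^ K" using g(1) by (auto simp: pbounded_def)
  define q where "q x = K * (1 + dsize x + dsize (l x)) ^ K" for x
  have qb: "pbounded q" unfolding q_def
    by (intro pbounded_mult pbounded_const pbounded_power pbounded_add pbounded_dsize ptime_size[OF l])
  have step: "dsize (H x e a) \<le> dsize a + q x" if "e \<in> set (dlist (l x))" for x e a
  proof -
    have "dsize (DCons x e) \<le> 1 + dsize x + dsize (l x)" using dsize_mem_dlist[OF that] by simp
    then have "g (DCons x e) \<le> q x"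
      unfolding q_def by (intro le_trans[OF K] mult_le_mono2 power_mono) auto
    then show ?thesis using g(2)[of "DCons x e" a] by simp
  qed
  have bound: "dsize (fold (H x) us a) \<le> dsize a + length us * q x"
    if "set us \<subseteq> set (dlist (l x))" for x us a
    using that
  proof (induction us arbitrary: a)
    case (Cons e us)
    have "dsize (fold (H x) us (H x e a)) \<le> dsize (H x e a) + length us * q x" using Cons by simp
    then show ?case using step[of e x a] Cons.prems by simp
  qed simp
  let ?Q = "\<lambda>x. dsize (l x) * q x"
  have Qb: "pbounded ?Q" by (intro pbounded_mult ptime_size[OF l] qb)
  have pre: "dsize (fold (H x) us a) \<le> dsize a + ?Q x" if "dlist (l x) = us @ vs" for x us vs a
  proof -
    have "length us \<le> dsize (l x)" using length_dlist[of "l x"] that by simp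
    then have "length us * q x \<le> ?Q x" by (rule mult_le_mono1)
    moreover have "set us \<subseteq> set (dlist (l x))" using that by simp
    ultimately show ?thesis using bound[of us x a] by linarith
  qed
  have "ptime (\<lambda>z. fold (\<lambda>e a. H (dhd z) e a) (dlist (l (dhd z))) (dtl z))"
  proof (rule ptime_fold)
    have "ptime (\<lambda>z. DCons (DCons (dhd (dhd z)) (dhd (dtl z))) (dtl (dtl z)))"
      by (intro ptime_cons ptime_dhd ptime_dtl ptime_id)
    from ptime_comp[OF this, of "\<lambda>z. H (dhd (dhd z)) (dtl (dhd z)) (dtl z)"] H
    show "ptime (\<lambda>z. H (dhd (dhd z)) (dhd (dtl z)) (dtl (dtl z)))" by (simp add: pacc_def)
    show "ptime (\<lambda>z. l (dhd z))" by (rule ptime_env[OF l])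
    show "ptime dtl" using ptime_dtl[OF ptime_id] .
    have "pbounded (\<lambda>z. ?Q (dhd z))"
      by (rule pbounded_comp[OF Qb pbounded_dsize]) (rule dsize_dhd)
    then show "pbounded (\<lambda>z. dsize z + ?Q (dhd z))" by (intro pbounded_add pbounded_dsize)
    fix z us vs assume "dlist (l (dhd z)) = us @ vs"
    from pre[OF this, of "dtl z"] show "dsize (fold (\<lambda>e a. H (dhd z) e a) us (dtl z)) \<le> dsize z + ?Q (dhd z)"
      using dsize_dtl[of z] by linarith
  qed
  moreover have "dsize (fold (H x) (dlist (l x)) a) \<le> dsize a + ?Q x" for x a
    by (rule pre[of _ _ "[]"]) simp
  ultimately show ?thesis unfolding pacc_def using Qb by blast
qed

section \<open>Evaluating the container formula\<close>

lemma enc_bool_simps [simp]: "enc_bool True = DCons DNil DNil" "enc_bool False = DNil"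
  by (simp_all add: enc_bool_def)

lemma enc_bool_eq_DNil [simp]: "enc_bool b = DNil \<longleftrightarrow> \<not> b"
  by (simp add: enc_bool_def)

definition pdec :: "(data \<Rightarrow> bool) \<Rightarrow> bool" where
  "pdec P \<longleftrightarrow> ptime (\<lambda>x. enc_bool (P x))"

lemma pdec_nonempty: assumes "ptime f" shows "pdec (\<lambda>x. f x \<noteq> DNil)"
proof -
  have "ptime (\<lambda>x. if f x \<noteq> DNil then DCons DNil DNil else DNil)"
    by (intro ptime_if assms ptime_const)
  moreover have "(\<lambda>x. if f x \<noteq> DNil then DCons DNil DNil else DNil) = (\<lambda>x. enc_bool (f x \<noteq> DNil))"
    by (auto simp: enc_bool_def)
  ultimately show ?thesis by (simp add: pdec_def)
qed

lemma pdec_not: assumes "pdec P" shows "pdec (\<lambda>x. \<not> P x)"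
proof -
  have "ptime (\<lambda>x. if enc_bool (P x) \<noteq> DNil then DNil else DCons DNil DNil)"
    using assms by (intro ptime_if ptime_const) (simp add: pdec_def)
  moreover have "(\<lambda>x. if enc_bool (P x) \<noteq> DNil then DNil else DCons DNil DNil) = (\<lambda>x. enc_bool (\<not> P x))"
    by (auto simp: enc_bool_def)
  ultimately show ?thesis by (simp add: pdec_def)
qed

lemma pdec_conj: assumes "pdec P" "pdec Q" shows "pdec (\<lambda>x. P x \<and> Q x)"
proof -
  have "ptime (\<lambda>x. if enc_bool (P x) \<noteq> DNil then enc_bool (Q x) else DNil)"
    using assms by (intro ptime_if ptime_const) (simp_all add: pdec_def)
  moreover have "(\<lambda>x. if enc_bool (P x) \<noteq> DNil then enc_bool (Q x) else DNil) = (\<lambda>x. enc_bool (P x \<and> Q x))"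
    by (auto simp: enc_bool_def)
  ultimately show ?thesis by (simp add: pdec_def)
qed

lemma pdec_disj: assumes "pdec P" "pdec Q" shows "pdec (\<lambda>x. P x \<or> Q x)"
proof -
  have "pdec (\<lambda>x. \<not> (\<not> P x \<and> \<not> Q x))" using assms by (intro pdec_not pdec_conj)
  then show ?thesis by simp
qed

text \<open>The quantifier is a fold whose accumulator is set to true at a witness and passed on
  otherwise.\<close>

lemma pdec_bex:
  assumes P: "pdec (\<lambda>z. P (dhd z) (dtl z))" and l: "ptime l"
  shows "pdec (\<lambda>x. \<exists>e\<in>set (dlist (l x)). P x e)"
proof -
  let ?H = "\<lambda>x e a. if enc_bool (P x e) \<noteq> DNil then DCons DNil DNil else a"
  have "pacc (\<lambda>x a. fold (\<lambda>e a. ?H x e a) (dlist (l x)) a)"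
    using P by (intro pacc_fold[where H = ?H] l pacc_if pacc_const ptime_const pacc_id) (simp add: pdec_def)
  from pacc_run[OF this ptime_nil]
  have "ptime (\<lambda>x. fold (\<lambda>e a. ?H x e a) (dlist (l x)) DNil)" .
  moreover have "fold (\<lambda>e a. ?H x e a) es a = (if \<exists>e\<in>set es. P x e then DCons DNil DNil else a)" for x es a
    by (induction es arbitrary: a) auto
  then have "(\<lambda>x. fold (\<lambda>e a. ?H x e a) (dlist (l x)) DNil) = (\<lambda>x. enc_bool (\<exists>e\<in>set (dlist (l x)). P x e))"
    by (auto simp: enc_bool_def)
  ultimately show ?thesis by (simp add: pdec_def)
qed

text \<open>A vertex is represented by its index and its row of the adjacency matrix.\<close>

definition vtx :: "nat \<Rightarrow> nat pair_pre_digraph \<Rightarrow> nat \<Rightarrow> data" where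
  "vtx n G i = DCons (enc_nat i) (enc_vset n {j. (i, j) \<in> parcs G})"

text \<open>Lookup without arithmetic: the unary index of \<open>v\<close> drives one tail step per
  unit along the row of \<open>u\<close>.\<close>

definition dadj :: "data \<Rightarrow> data \<Rightarrow> bool" where
  "dadj u v \<longleftrightarrow> dhd (fold (\<lambda>_ r. dtl r) (dlist (dhd v)) (dtl u)) \<noteq> DNil"

lemma pdec_dadj: assumes "ptime f" "ptime g" shows "pdec (\<lambda>x. dadj (f x) (g x))"
proof -
  have "pacc (\<lambda>x a. fold (\<lambda>_ a. dtl a) (dlist (dhd (g x))) a)"
    by (intro pacc_fold[where H = "\<lambda>_ _ a. dtl a"] ptime_dhd assms pacc_dtl)
  from pacc_run[OF this ptime_dtl[OF assms(1)]] show ?thesis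
    unfolding dadj_def by (intro pdec_nonempty ptime_dhd)
qed

lemma dlist_enc_nat [simp]: "dlist (enc_nat k) = replicate k DNil"
  by (simp add: enc_nat_def)

lemma dadj_vtx:
  assumes "j < n"
  shows "dadj (vtx n G i) (vtx n G j) \<longleftrightarrow> (i, j) \<in> parcs G"
proof -
  have "fold (\<lambda>_ r. dtl r) (replicate m e) (enc_list xs) = enc_list (drop m xs)" for m :: nat and e :: data and xs
  proof (induction m arbitrary: xs)
    case (Suc m)
    have "dtl (enc_list xs) = enc_list (tl xs)" by (cases xs) auto
    then show ?case using Suc[of "tl xs"] by (simp add: drop_Suc)
  qed simp
  moreover have "dhd (enc_list (drop j xs)) = xs ! j" if "j < length xs" for xs
    by (simp add: that flip: Cons_nth_drop_Suc)
  ultimately show ?thesis using assms by (simp add: dadj_def vtx_def enc_vset_def)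
qed

text \<open>A tuple is a list of pairs: six for the twelve fixed parameters, then \<open>k\<close>
  whose first and second components form \<open>KA\<close> and \<open>KB\<close>. So one program
  serves every \<open>k\<close>.\<close>

definition tuple_shat :: "data \<Rightarrow> data \<Rightarrow> data \<Rightarrow> bool" where
  "tuple_shat V T v \<longleftrightarrow> shat dadj (set (dlist V))
     (dhd (dhd T)) (dtl (dhd T)) (dhd (dhd (dtl T))) (dtl (dhd (dtl T)))
     (dhd (dhd (dtl (dtl T)))) (dtl (dhd (dtl (dtl T))))
     (dhd (dhd (dtl (dtl (dtl T))))) (dtl (dhd (dtl (dtl (dtl T)))))
     (dhd (dhd (dtl (dtl (dtl (dtl T)))))) (dtl (dhd (dtl (dtl (dtl (dtl T))))))
     (dhd (dhd (dtl (dtl (dtl (dtl (dtl T))))))) (dtl (dhd (dtl (dtl (dtl (dtl (dtl T)))))))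
     (map dhd (dlist (dtl (dtl (dtl (dtl (dtl (dtl T))))))))
     (map dtl (dlist (dtl (dtl (dtl (dtl (dtl (dtl T))))))))  v"

lemma pdec_tuple_shat: "pdec (\<lambda>x. tuple_shat (dhd (dhd x)) (dtl (dhd x)) (dtl x))"
proof -
  \<comment> \<open>Quantifiers over explicit lists become disjunctions, the others range over
    members of a list computed from the input; afterwards the rules for \<open>pdec\<close> follow
    the shape of the formula.\<close>
  have bex: "(\<exists>x\<in>f ` A. P x) \<longleftrightarrow> (\<exists>x\<in>A. P (f x))" "(\<exists>x\<in>insert b B. Q x) \<longleftrightarrow> Q b \<or> (\<exists>x\<in>B. Q x)"
      "(\<exists>x\<in>{}. Q x) \<longleftrightarrow> False"
    for f :: "data \<Rightarrow> data" and A P b B and Q :: "data \<Rightarrow> bool" by auto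
  have false: "pdec (\<lambda>_. False)" using ptime_nil by (simp add: pdec_def)
  show ?thesis
    unfolding tuple_shat_def shat_def side_def far_def set_map list.set bex
    by (intro false pdec_disj pdec_conj pdec_not pdec_bex pdec_dadj ptime_dhd ptime_dtl ptime_id)
qed

text \<open>Vertices occur in the formulas only through adjacency, so a map that preserves and
  reflects it carries them over, here from indices to their trees.\<close>

lemma side_transfer:
  assumes E: "\<And>i j. i \<in> V \<Longrightarrow> j \<in> V \<Longrightarrow> E' (f i) (f j) \<longleftrightarrow> E i j"
    and "q \<in> V" "set X \<subseteq> V" "set K \<subseteq> V" "v \<in> V"
  shows "side E' (f ` V) (f q) (map f X) (map f K) (f v) \<longleftrightarrow> side E V q X K v"
proof -
  have "(\<exists>x\<in>set (map f Z). E' (f u) x) \<longleftrightarrow> (\<exists>x\<in>set Z. E u x)" if "u \<in> V" "set Z \<subseteq> V" for u Z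
    using that E by auto
  moreover have im: "(\<exists>x\<in>f ` V. P x) \<longleftrightarrow> (\<exists>i\<in>V. P (f i))" for P by blast
  ultimately show ?thesis unfolding side_def im
    using assms(2-5) by (simp only: E cong: bex_cong)
qed

lemma far_transfer:
  assumes E: "\<And>i j. i \<in> V \<Longrightarrow> j \<in> V \<Longrightarrow> E' (f i) (f j) \<longleftrightarrow> E i j"
    and "p \<in> V" "q \<in> V" "set X \<subseteq> V" "set Y \<subseteq> V" "t1 \<in> V" "t2 \<in> V" "e \<in> V" "r \<in> V" "v \<in> V"
  shows "far E' (f ` V) (f p) (f q) (map f X) (map f Y) (f t1) (f t2) (f e) (f r) (f v) \<longleftrightarrow>
    far E V p q X Y t1 t2 e r v"
proof -
  have nb: "(\<exists>x\<in>set (map f Z). E' (f u) x) \<longleftrightarrow> (\<exists>x\<in>set Z. E u x)" if "u \<in> V" "set Z \<subseteq> V" for u Z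
    using that E by auto
  have im: "(\<exists>x\<in>f ` V. P x) \<longleftrightarrow> (\<exists>i\<in>V. P (f i))" for P by blast
  show ?thesis
    unfolding far_def im using assms(2-10) by (simp only: E nb cong: bex_cong)
qed

lemma shat_transfer:
  assumes E: "\<And>i j. i \<in> V \<Longrightarrow> j \<in> V \<Longrightarrow> E' (f i) (f j) \<longleftrightarrow> E i j"
    and "set [p, q, p2, q2, p3, q3, a, b, t1, t2, e, r] \<union> set KA \<union> set KB \<subseteq> V" "v \<in> V"
  shows "shat E' (f ` V) (f p) (f q) (f p2) (f q2) (f p3) (f q3) (f a) (f b) (f t1) (f t2) (f e) (f r)
      (map f KA) (map f KB) (f v) \<longleftrightarrow> shat E V p q p2 q2 p3 q3 a b t1 t2 e r KA KB v"
proof -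
  have "side E' (f ` V) (f q) (map f [p, p2, p3, a]) (map f KA) (f v) \<longleftrightarrow> side E V q [p, p2, p3, a] KA v"
    using assms by (intro side_transfer) auto
  moreover have "side E' (f ` V) (f p) (map f [q, q2, q3, b]) (map f KB) (f v) \<longleftrightarrow> side E V p [q, q2, q3, b] KB v"
    using assms by (intro side_transfer) auto
  moreover have "far E' (f ` V) (f p) (f q) (map f [p, p2, p3, a]) (map f [q, q2, q3, b]) (f t1) (f t2) (f e) (f r) (f v)
      \<longleftrightarrow> far E V p q [p, p2, p3, a] [q, q2, q3, b] t1 t2 e r v"
    using assms by (intro far_transfer) auto
  moreover have "E' (f q) (f q2) \<longleftrightarrow> E q q2" using assms by auto
  ultimately show ?thesis unfolding shat_def list.map by blast
qed

section \<open>Listing vertices and parameter tuples\<close>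

lemma dsize_enc_list:
  assumes "\<And>x. x \<in> set xs \<Longrightarrow> dsize x \<le> q"
  shows "dsize (enc_list xs) \<le> 1 + length xs * (1 + q)"
  using assms
proof (induction xs)
  case (Cons a xs)
  have "dsize (enc_list xs) \<le> 1 + length xs * (1 + q)" "dsize a \<le> q" using Cons by auto
  then show ?case by simp
qed simp

lemma dsize_enc_nat [simp]: "dsize (enc_nat k) = 1 + 2 * k"
  by (induction k) (simp_all add: enc_nat_def)

lemma dlist_fold_append:
  assumes "\<And>e a. dlist (H e a) = F e @ dlist a"
  shows "dlist (fold H es a) = concat (rev (map F es)) @ dlist a"
  using assms by (induction es arbitrary: a) auto

text \<open>The vertex list is built in reverse, with a counter in the head of the accumulator.\<close>

definition vtx_step :: "data \<Rightarrow> data \<Rightarrow> data" where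
  "vtx_step row a = DCons (DCons DNil (dhd a)) (DCons (DCons (dhd a) row) (dtl a))"

lemma fold_vtx_step:
  "fold vtx_step (map g [0..<m]) (DCons DNil DNil) =
    DCons (enc_nat m) (enc_list (rev (map (\<lambda>i. DCons (enc_nat i) (g i)) [0..<m])))"
proof (induction m)
  case (Suc m)
  then show ?case by (simp add: vtx_step_def enc_nat_def)
qed (simp add: enc_nat_def)

definition vertices :: "data \<Rightarrow> data" where
  "vertices g = dtl (fold vtx_step (dlist g) (DCons DNil DNil))"

lemma dlist_vertices: "dlist (vertices (enc_graph n G)) = rev (map (vtx n G) [0..<n])"
  by (simp add: vertices_def enc_graph_def fold_vtx_step vtx_def[abs_def])

lemma ptime_vertices: assumes "ptime f" shows "ptime (\<lambda>x. vertices (f x))"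
  unfolding vertices_def
proof (rule ptime_dtl, rule ptime_fold[where H = "\<lambda>_. vtx_step", OF _ assms ptime_const])
  show "ptime (\<lambda>z. vtx_step (dhd (dtl z)) (dtl (dtl z)))"
    unfolding vtx_step_def by (intro ptime_cons ptime_dhd ptime_dtl ptime_id ptime_const)
  let ?q = "\<lambda>x. 2 + (1 + 2 * dsize (f x)) + (1 + dsize (f x) * (1 + (2 + 2 * dsize (f x) + dsize (f x))))"
  show "pbounded ?q"
    by (intro pbounded_add pbounded_mult pbounded_const ptime_size[OF assms])
  fix x us vs assume us: "dlist (f x) = us @ vs"
  let ?m = "length us" and ?D = "dsize (f x)"
  let ?L = "rev (map (\<lambda>i. DCons (enc_nat i) (us ! i)) [0..<?m])"
  have eq: "fold vtx_step us (DCons DNil DNil) = DCons (enc_nat ?m) (enc_list ?L)"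
    using fold_vtx_step[of "(!) us" ?m] by (simp add: map_nth)
  have m: "?m \<le> ?D" using length_dlist[of "f x"] us by simp
  have "dsize (enc_list ?L) \<le> 1 + length ?L * (1 + (2 + 2 * ?D + ?D))"
  proof (rule dsize_enc_list)
    fix y assume "y \<in> set ?L"
    then obtain i where i: "i < ?m" "y = DCons (enc_nat i) (us ! i)" by auto
    have "dsize (us ! i) \<le> ?D" using dsize_mem_dlist[of "us ! i" "f x"] us i by simp
    then show "dsize y \<le> 2 + 2 * ?D + ?D" using i m by simp
  qed
  also have "\<dots> \<le> 1 + ?D * (1 + (2 + 2 * ?D + ?D))"
    using m by (intro add_mono mult_le_mono) auto
  finally show "dsize (fold vtx_step us (DCons DNil DNil)) \<le> ?q x" using eq m by simp
qed

text \<open>A round prepends a pair, so \<open>k\<close> rounds supply both \<open>KA\<close> and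
  \<open>KB\<close>, and each round multiplies the number of tuples by the square of the number of
  vertices.\<close>

definition extend_tuples :: "data \<Rightarrow> data \<Rightarrow> data" where
  "extend_tuples V L = fold (\<lambda>u a. fold (\<lambda>w b. fold (\<lambda>t c. DCons (DCons (DCons u w) t) c) (dlist L) b) (dlist V) a)
     (dlist V) DNil"

lemma ptime_extend_tuples: assumes "ptime f" "ptime g" shows "ptime (\<lambda>x. extend_tuples (f x) (g x))"
proof -
  have "pacc (\<lambda>x a. fold (\<lambda>u a. fold (\<lambda>w b. fold (\<lambda>t c. DCons (DCons (DCons u w) t) c) (dlist (g x)) b) (dlist (f x)) a)
     (dlist (f x)) a)"
    by (rule pacc_fold[OF assms(1)], rule pacc_fold[OF ptime_env[OF assms(1)]],
        rule pacc_fold[OF ptime_env[OF ptime_env[OF assms(2)]]], rule pacc_cons)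
      (intro ptime_cons ptime_dhd ptime_dtl ptime_id)
  from pacc_run[OF this ptime_nil] show ?thesis by (simp add: extend_tuples_def)
qed

lemma dlist_extend_tuples:
  "dlist (extend_tuples V L) = concat (rev (map (\<lambda>u. concat (rev (map (\<lambda>w.
     rev (map (\<lambda>t. DCons (DCons u w) t) (dlist L))) (dlist V)))) (dlist V)))"
proof -
  have "dlist (fold (\<lambda>t c. DCons (g t) c) ts b) = rev (map g ts) @ dlist b" for g :: "data \<Rightarrow> data" and ts b
    by (induction ts arbitrary: b) auto
  then show ?thesis unfolding extend_tuples_def by (simp add: dlist_fold_append)
qed

lemma set_extend_tuples:
  "set (dlist (extend_tuples V L)) = {DCons (DCons u w) t | u w t. u \<in> set (dlist V) \<and> w \<in> set (dlist V) \<and> t \<in> set (dlist L)}"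
  unfolding dlist_extend_tuples by (auto simp: image_iff)

lemma length_extend_tuples: "length (dlist (extend_tuples V L)) = length (dlist V) ^ 2 * length (dlist L)"
proof -
  have "sum_list (map (\<lambda>_. c) xs) = length xs * c" for c :: nat and xs :: "data list"
    by (induction xs) auto
  then show ?thesis
    unfolding dlist_extend_tuples by (simp add: length_concat rev_map[symmetric] power2_eq_square comp_def)
qed

definition tuples :: "data \<Rightarrow> nat \<Rightarrow> data" where
  "tuples V m = (extend_tuples V ^^ m) (DCons DNil DNil)"

lemma fold_extend_tuples: "fold (\<lambda>_. extend_tuples V) us (DCons DNil DNil) = tuples V (length us)"
proof -
  have "fold (\<lambda>_. f) us a = (f ^^ length us) a" for f :: "data \<Rightarrow> data" and a
    by (induction us arbitrary: a) (auto simp: funpow_swap1)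
  then show ?thesis by (simp add: tuples_def)
qed

lemma set_tuples:
  "set (dlist (tuples V m)) = {t. length (dlist t) = m \<and>
     (\<forall>e\<in>set (dlist t). \<exists>u\<in>set (dlist V). \<exists>w\<in>set (dlist V). e = DCons u w)}" (is "_ = ?S m")
proof (induction m)
  case 0
  have "dlist t = [] \<longleftrightarrow> t = DNil" for t by (cases t) auto
  then show ?case by (auto simp: tuples_def)
next
  case (Suc m)
  have "set (dlist (tuples V (Suc m))) =
      {DCons (DCons u w) t | u w t. u \<in> set (dlist V) \<and> w \<in> set (dlist V) \<and> t \<in> ?S m}"
    using set_extend_tuples[of V "tuples V m"] Suc by (simp add: tuples_def)
  also have "\<dots> = ?S (Suc m)"
  proof (intro set_eqI iffI)
    fix t assume "t \<in> ?S (Suc m)"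
    moreover from this obtain e t' where "t = DCons e t'" by (cases t) auto
    ultimately show "t \<in> {DCons (DCons u w) t | u w t. u \<in> set (dlist V) \<and> w \<in> set (dlist V) \<and> t \<in> ?S m}"
      by auto
  qed auto
  finally show ?case .
qed

lemma length_tuples: "length (dlist (tuples V m)) = length (dlist V) ^ (2 * m)"
proof (induction m)
  case (Suc m)
  then show ?case using length_extend_tuples[of V "tuples V m"]
    by (simp add: tuples_def power2_eq_square)
qed (simp add: tuples_def)

lemma dsize_tuples:
  "dsize (tuples V m) \<le> 1 + length (dlist V) ^ (2 * m) * (2 + m * (2 + 2 * dsize V))"
proof -
  have "dsize t \<le> 1 + m * (2 + 2 * dsize V)" if t: "t \<in> set (dlist (tuples V m))" for t
  proof -
    have "dsize (enc_list (dlist t)) \<le> 1 + length (dlist t) * (1 + (1 + 2 * dsize V))"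
    proof (rule dsize_enc_list)
      fix e assume "e \<in> set (dlist t)"
      then obtain u w where "u \<in> set (dlist V)" "w \<in> set (dlist V)" "e = DCons u w"
        using t unfolding set_tuples by auto
      then show "dsize e \<le> 1 + 2 * dsize V" using dsize_mem_dlist[of u V] dsize_mem_dlist[of w V] by simp
    qed
    moreover have "length (dlist t) = m" using t unfolding set_tuples by simp
    ultimately show ?thesis by simp
  qed
  then have "dsize (enc_list (dlist (tuples V m))) \<le> 1 + length (dlist (tuples V m)) * (1 + (1 + m * (2 + 2 * dsize V)))"
    by (rule dsize_enc_list)
  then show ?thesis by (simp add: length_tuples)
qed

definition family :: "data \<Rightarrow> data" where
  "family z = fold (\<lambda>T a. DCons (fold (\<lambda>v b. DCons (enc_bool (tuple_shat (dhd z) T v)) b) (dlist (dhd z)) DNil) a)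
     (dlist (dtl z)) DNil"

lemma ptime_family: "ptime family"
proof -
  have 1: "ptime (\<lambda>y. enc_bool (tuple_shat (dhd (dhd (dhd y))) (dtl (dhd y)) (dtl y)))"
  proof -
    have "ptime (\<lambda>y. DCons (DCons (dhd (dhd (dhd y))) (dtl (dhd y))) (dtl y))"
      by (intro ptime_cons ptime_dhd ptime_dtl ptime_id)
    from ptime_comp[OF this, of "\<lambda>x. enc_bool (tuple_shat (dhd (dhd x)) (dtl (dhd x)) (dtl x))"]
    show ?thesis using pdec_tuple_shat by (simp add: pdec_def)
  qed
  have "pacc (\<lambda>x b. fold (\<lambda>v b. DCons (enc_bool (tuple_shat (dhd (dhd x)) (dtl x) v)) b) (dlist (dhd (dhd x))) b)"
    by (rule pacc_fold, intro ptime_dhd ptime_id, rule pacc_cons[OF 1])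
  from pacc_run[OF this ptime_nil]
  have "pacc (\<lambda>z a. fold (\<lambda>T a. DCons (fold (\<lambda>v b. DCons (enc_bool (tuple_shat (dhd z) T v)) b) (dlist (dhd z)) DNil) a)
     (dlist (dtl z)) a)"
    by (intro pacc_fold[OF ptime_dtl[OF ptime_id]] pacc_cons)
  from pacc_run[OF this ptime_nil] show ?thesis unfolding family_def[abs_def] .
qed

lemma family_eq:
  "family (DCons V L) = enc_list (rev (map (\<lambda>T. enc_list (rev (map (\<lambda>v. enc_bool (tuple_shat V T v)) (dlist V)))) (dlist L)))"
proof -
  have "fold (\<lambda>e a. DCons (g e) a) es (enc_list bs) = enc_list (rev (map g es) @ bs)"
    for g :: "data \<Rightarrow> data" and es bs
    by (induction es arbitrary: bs) (auto simp flip: enc_list_Cons)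
  from this[of _ _ "[]"] show ?thesis unfolding family_def by simp
qed

text \<open>The bounds of the form n to the O(k), with \<open>k + 1\<close> to include
  \<open>k = 0\<close>. From \<open>n = 2\<close> on, powers of \<open>n\<close> absorb constants,
  sums and \<open>k\<close> itself.\<close>

definition nk_bounded :: "(nat \<Rightarrow> nat \<Rightarrow> nat) \<Rightarrow> bool" where
  "nk_bounded g \<longleftrightarrow> (\<exists>c. \<forall>n k. 2 \<le> n \<longrightarrow> g n k \<le> n ^ (c * (k + 1)))"

lemma nk_bounded_const: "nk_bounded (\<lambda>_ _. C)"
proof -
  have "C \<le> n ^ (C * (k + 1))" if "2 \<le> n" for n k :: nat
  proof -
    have "C \<le> 2 ^ C" using less_exp[of C] by simp
    also have "\<dots> \<le> n ^ C" using that by (rule power_mono) simp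
    also have "\<dots> \<le> n ^ (C * (k + 1))" using that by (intro power_increasing) auto
    finally show ?thesis .
  qed
  then show ?thesis unfolding nk_bounded_def by blast
qed

lemma nk_bounded_mult:
  assumes "nk_bounded g" "nk_bounded h" shows "nk_bounded (\<lambda>n k. g n k * h n k)"
proof -
  obtain c c' where "\<And>n k. 2 \<le> n \<Longrightarrow> g n k \<le> n ^ (c * (k + 1))" "\<And>n k. 2 \<le> n \<Longrightarrow> h n k \<le> n ^ (c' * (k + 1))"
    using assms unfolding nk_bounded_def by blast
  then have "g n k * h n k \<le> n ^ ((c + c') * (k + 1))" if "2 \<le> n" for n k
    unfolding add_mult_distrib power_add using that by (intro mult_le_mono)
  then show ?thesis unfolding nk_bounded_def by blast
qed

lemma nk_bounded_add:
  assumes "nk_bounded g" "nk_bounded h" shows "nk_bounded (\<lambda>n k. g n k + h n k)"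
proof -
  obtain c c' where c: "\<And>n k. 2 \<le> n \<Longrightarrow> g n k \<le> n ^ (c * (k + 1))" "\<And>n k. 2 \<le> n \<Longrightarrow> h n k \<le> n ^ (c' * (k + 1))"
    using assms unfolding nk_bounded_def by blast
  have "g n k + h n k \<le> n ^ ((c + c' + 1) * (k + 1))" if n: "2 \<le> n" for n k
  proof -
    let ?N = "n ^ ((c + c') * (k + 1))"
    have "n ^ (c * (k + 1)) \<le> ?N" "n ^ (c' * (k + 1)) \<le> ?N" using n by (intro power_increasing mult_le_mono1; simp)+
    then have "g n k + h n k \<le> 2 * ?N" using c(1)[OF n, of k] c(2)[OF n, of k] by linarith
    also have "\<dots> \<le> n ^ (k + 1) * ?N"
    proof (rule mult_le_mono1)
      have "n ^ 1 \<le> n ^ (k + 1)" by (rule power_increasing) (use n in auto)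
      then show "2 \<le> n ^ (k + 1)" using n unfolding power_one_right by linarith
    qed
    also have "\<dots> = n ^ ((k + 1) + (c + c') * (k + 1))" by (rule power_add[symmetric])
    also have "(k + 1) + (c + c') * (k + 1) = (c + c' + 1) * (k + 1)" by simp
    finally show ?thesis .
  qed
  then show ?thesis unfolding nk_bounded_def by blast
qed

lemma nk_bounded_power: "nk_bounded g \<Longrightarrow> nk_bounded (\<lambda>n k. g n k ^ m)"
  by (induction m) (auto intro: nk_bounded_mult nk_bounded_const)

lemma nk_bounded_n: "nk_bounded (\<lambda>n _. n)"
proof -
  have "n \<le> n ^ (1 * (k + 1))" if "2 \<le> n" for n k :: nat using that by simp
  then show ?thesis unfolding nk_bounded_def by blast
qed

lemma nk_bounded_k: "nk_bounded (\<lambda>_ k. k)"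
proof -
  have "k \<le> n ^ (1 * (k + 1))" if "2 \<le> n" for n k :: nat
  proof -
    have "k \<le> 2 ^ (k + 1)" using less_exp[of "k + 1"] by linarith
    also have "\<dots> \<le> n ^ (k + 1)" using that by (rule power_mono) simp
    finally show ?thesis by simp
  qed
  then show ?thesis unfolding nk_bounded_def by blast
qed

lemma nk_bounded_tuple_count: "nk_bounded (\<lambda>n k. n ^ (2 * (k + 6)))"
proof -
  have "n ^ (2 * (k + 6)) \<le> n ^ (12 * (k + 1))" if "2 \<le> n" for n k :: nat
    using that by (intro power_increasing) auto
  then show ?thesis unfolding nk_bounded_def by blast
qed

lemma dsize_enc_input: "dsize (enc_input n G k) \<le> 3 + n * (2 + 4 * n) + 2 * k"
proof -
  have row: "dsize (enc_vset n A) \<le> 1 + n * 4" for A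
  proof -
    have "dsize (enc_vset n A) \<le> 1 + length (map (\<lambda>i. enc_bool (i \<in> A)) [0..<n]) * (1 + 3)"
      unfolding enc_vset_def by (rule dsize_enc_list) (auto simp: enc_bool_def)
    then show ?thesis by simp
  qed
  have "dsize (enc_graph n G) \<le> 1 + length (map (\<lambda>i. enc_vset n {j. (i, j) \<in> parcs G}) [0..<n]) * (1 + (1 + n * 4))"
    unfolding enc_graph_def by (rule dsize_enc_list) (use row in auto)
  then show ?thesis by (simp add: enc_input_def algebra_simps)
qed

text \<open>Preparation and evaluation are polynomial in their own inputs, but the tuple list
  between them is not polynomial in the graph. Its loop is therefore run through
  \<open>fold_program\<close> with an explicit size \<open>M\<close>.\<close>

lemma program_exists:
  obtains P c where
    "\<And>n k G. n \<le> 1 \<Longrightarrow> \<exists>t\<le>6. runs_in P (enc_input n G k) t DNil"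
    "\<And>n k G. 2 \<le> n \<Longrightarrow> \<exists>t\<le>n ^ (c * (k + 1)). runs_in P (enc_input n G k) t
       (family (DCons (vertices (enc_graph n G)) (tuples (vertices (enc_graph n G)) (k + 6))))"
proof -
  \<comment> \<open>Six more unary digits make the counter run for \<open>k + 6\<close> rounds, one
    per pair of parameters.\<close>
  define six where "six x = DCons DNil (DCons DNil (DCons DNil (DCons DNil (DCons DNil (DCons DNil x)))))" for x
  define prep where "prep x = DCons (vertices (dhd x)) (DCons (six (dtl x)) (DCons DNil DNil))" for x
  have "ptime prep" unfolding prep_def six_def
    by (intro ptime_cons ptime_vertices ptime_dhd ptime_dtl ptime_id ptime_const)
  then obtain c1 T1 where c1: "pbounded T1" "computes c1 0 prep T1" by (rule ptime_program)
  obtain K1 where K1: "\<And>x. dsize (prep x) \<le> K1 * dsize x ^ K1"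
    using ptime_size[OF \<open>ptime prep\<close>] by (auto simp: pbounded_def)
  obtain KT where KT: "\<And>x. T1 x \<le> KT * dsize x ^ KT" using c1(1) by (auto simp: pbounded_def)
  have "ptime (\<lambda>z. extend_tuples (dhd z) (dtl (dtl z)))" by (intro ptime_extend_tuples ptime_dhd ptime_dtl ptime_id)
  \<comment> \<open>Working from variable \<open>1\<close> upwards preserves variable
    \<open>0\<close>, from which the vertex list is read again for \<open>family\<close>.\<close>
  from fold_program[OF this, of 1]
  obtain c2 K2 where c2: "\<And>s env l a M. s 1 = DCons env (DCons l a) \<Longrightarrow> dsize env \<le> M \<Longrightarrow> dsize l \<le> M \<Longrightarrow>
     (\<forall>us vs. dlist l = us @ vs \<longrightarrow> dsize (fold (\<lambda>_. extend_tuples env) us a) \<le> M) \<Longrightarrow>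
     \<exists>s'. halts c2 s (K2 * M ^ K2) s' \<and> s' 1 = fold (\<lambda>_. extend_tuples env) (dlist l) a \<and> (\<forall>i<1. s' i = s i)"
    unfolding dhd.simps dtl.simps by blast
  obtain c3 T3 where c3: "pbounded T3" "computes c3 0 family T3" using ptime_family by (rule ptime_program)
  obtain K3 where K3: "\<And>x. T3 x \<le> K3 * dsize x ^ K3" using c3(1) by (auto simp: pbounded_def)
  let ?e = "ECons (EHd (EVar 0)) (EVar 1)"
  let ?main = "CSeq c1 (CSeq (CAssign 1 (EVar 0)) (CSeq c2 (CSeq (CAssign 0 ?e) c3)))"
  \<comment> \<open>The tail of the adjacency matrix is empty exactly if \<open>n \<le> 1\<close>;
    the output is then the empty family.\<close>
  let ?P = "CIf (ETl (EHd (EVar 0))) ?main (CAssign 0 ENil)"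
  define X where "X n k = 3 + n * (2 + 4 * n) + 2 * k" for n k :: nat
  define D where "D n k = K1 * X n k ^ K1" for n k
  \<comment> \<open>\<open>D\<close> bounds the vertex list and the counter; the product bounds
    every partial tuple list, as in \<open>dsize_tuples\<close>.\<close>
  define M where "M n k = 1 + D n k + n ^ (2 * (k + 6)) * (2 + (k + 6) * (2 + 2 * D n k))" for n k
  define B where "B n k = 30 + KT * X n k ^ KT + K2 * M n k ^ K2 + K3 * (3 * M n k) ^ K3" for n k
  have "nk_bounded X" unfolding X_def
    by (intro nk_bounded_add nk_bounded_mult nk_bounded_const nk_bounded_n nk_bounded_k)
  then have "nk_bounded D" unfolding D_def
    by (intro nk_bounded_mult nk_bounded_power nk_bounded_const)
  then have "nk_bounded M" unfolding M_def
    by (intro nk_bounded_add nk_bounded_mult nk_bounded_const nk_bounded_tuple_count nk_bounded_k)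
  then have "nk_bounded B" unfolding B_def
    by (intro nk_bounded_add nk_bounded_mult nk_bounded_power nk_bounded_const \<open>nk_bounded X\<close>)
  then obtain c where c: "\<And>n k. 2 \<le> n \<Longrightarrow> B n k \<le> n ^ (c * (k + 1))" unfolding nk_bounded_def by blast
  have small: "\<exists>t\<le>6. runs_in ?P (enc_input n G k) t DNil" if "n \<le> 1" for n k G
  proof -
    let ?s = "(\<lambda>_. DNil)(0 := enc_input n G k)"
    have "n = 0 \<or> n = 1" using that by linarith
    then have "eval_expr (ETl (EHd (EVar 0))) ?s = DNil" by (auto simp: enc_input_def enc_graph_def)
    then have "halts ?P ?s (1 + expr_cost (ETl (EHd (EVar 0))) + (1 + expr_cost ENil)) (?s(0 := eval_expr ENil ?s))"
      by (intro halts_if_false halts_assign)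
    then have "halts ?P ?s 6 (?s(0 := eval_expr ENil ?s))" by (rule halts_mono) simp
    then obtain t where "t \<le> 6" "exec ?P ?s t (?s(0 := eval_expr ENil ?s))" unfolding halts_def by blast
    then show ?thesis unfolding runs_in_def by (metis eval_expr.simps(2) fun_upd_same)
  qed
  have big: "\<exists>t\<le>n ^ (c * (k + 1)). runs_in ?P (enc_input n G k) t
       (family (DCons (vertices (enc_graph n G)) (tuples (vertices (enc_graph n G)) (k + 6))))"
    if n: "2 \<le> n" for n k G
  proof -
    let ?x = "enc_input n G k" and ?V = "vertices (enc_graph n G)"
    let ?L = "tuples ?V (k + 6)" and ?l = "six (enc_nat k)"
    define s0 :: store where "s0 = (\<lambda>_. DNil)(0 := ?x)"
    have s0: "s0 0 = ?x" by (simp add: s0_def)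
    have x: "dsize ?x \<le> X n k" using dsize_enc_input by (simp add: X_def)
    have lenV: "length (dlist ?V) = n" by (simp add: dlist_vertices)
    have lenl: "length (dlist ?l) = k + 6" by (simp add: six_def)
    have prep: "prep ?x = DCons ?V (DCons ?l (DCons DNil DNil))" by (simp add: prep_def enc_input_def)
    have "dsize (prep ?x) \<le> D n k" unfolding D_def
      using K1[of ?x] x by (meson le_trans mult_le_mono2 power_mono le0)
    then have V: "dsize ?V \<le> D n k" "dsize ?l \<le> D n k" unfolding prep by auto
    have tup: "dsize (tuples ?V m) \<le> M n k" if "m \<le> k + 6" for m
    proof -
      have "dsize (tuples ?V m) \<le> 1 + n ^ (2 * m) * (2 + m * (2 + 2 * dsize ?V))"
        using dsize_tuples[of ?V m] lenV by simp
      also have "\<dots> \<le> 1 + n ^ (2 * (k + 6)) * (2 + (k + 6) * (2 + 2 * D n k))"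
        using that n V by (intro add_mono mult_le_mono power_increasing) auto
      also have "\<dots> \<le> M n k" by (simp add: M_def)
      finally show ?thesis .
    qed
    have VM: "dsize ?V \<le> M n k" "dsize ?l \<le> M n k" using V by (auto simp: M_def)
    have "n = Suc (Suc (n - 2))" using n by simp
    then have "[0..<n] = 0 # 1 # [2..<n]" by (metis One_nat_def Suc_1 upt_conv_Cons zero_less_Suc lessI less_Suc_eq_0_disj)
    then have cond: "eval_expr (ETl (EHd (EVar 0))) s0 \<noteq> DNil" by (simp add: s0 enc_input_def enc_graph_def)
    obtain s1 where s1: "halts c1 s0 (T1 (s0 0)) s1" "s1 0 = prep (s0 0)"
      using c1(2)[unfolded computes_def, THEN spec, of s0] by blast
    define s2 where "s2 = s1(1 := eval_expr (EVar 0) s1)"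
    have s2: "s2 1 = DCons ?V (DCons ?l (DCons DNil DNil))" "s2 0 = prep ?x" using s1 s0 prep by (simp_all add: s2_def)
    have "\<forall>us vs. dlist ?l = us @ vs \<longrightarrow> dsize (fold (\<lambda>_. extend_tuples ?V) us (DCons DNil DNil)) \<le> M n k"
    proof (intro allI impI)
      fix us vs assume "dlist ?l = us @ vs"
      then have "length us \<le> k + 6" using lenl by (metis le_add1 length_append)
      then show "dsize (fold (\<lambda>_. extend_tuples ?V) us (DCons DNil DNil)) \<le> M n k" unfolding fold_extend_tuples by (rule tup)
    qed
    then obtain s3 where s3: "halts c2 s2 (K2 * M n k ^ K2) s3" "s3 1 = ?L" "s3 0 = prep ?x"
      using c2[where s = s2, OF s2(1) VM] s2(2) unfolding fold_extend_tuples lenl by auto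
    define s4 where "s4 = s3(0 := eval_expr ?e s3)"
    have s4: "s4 0 = DCons ?V ?L" using s3 prep by (simp add: s4_def)
    obtain s5 where s5: "halts c3 s4 (T3 (s4 0)) s5" "s5 0 = family (s4 0)"
      using c3(2)[unfolded computes_def, THEN spec, of s4] by blast
    have "halts ?P s0 (1 + expr_cost (ETl (EHd (EVar 0))) + (1 + T1 (s0 0) + (1 + (1 + expr_cost (EVar 0)) +
        (1 + K2 * M n k ^ K2 + (1 + (1 + expr_cost ?e) + T3 (s4 0)))))) s5"
      using s3(1) s5(1) unfolding s2_def s4_def
      by (intro halts_if_true[OF cond] halts_seq[OF s1(1)] halts_seq[OF halts_assign] halts_seq[where s' = s3])
    then have "halts ?P s0 (B n k) s5"
    proof (rule halts_mono)
      have "T1 (s0 0) \<le> KT * X n k ^ KT"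
        unfolding s0 using KT[of ?x] x by (meson le_trans mult_le_mono2 power_mono le0)
      moreover have "dsize (s4 0) \<le> 3 * M n k" using s4 VM(1) tup[of "k + 6"] by (simp add: M_def)
      then have "T3 (s4 0) \<le> K3 * (3 * M n k) ^ K3"
        using K3[of "s4 0"] by (meson le_trans mult_le_mono2 power_mono le0)
      ultimately show "1 + expr_cost (ETl (EHd (EVar 0))) + (1 + T1 (s0 0) + (1 + (1 + expr_cost (EVar 0)) +
        (1 + K2 * M n k ^ K2 + (1 + (1 + expr_cost ?e) + T3 (s4 0))))) \<le> B n k"
        unfolding B_def by simp
    qed
    then obtain t where "t \<le> B n k" "exec ?P s0 t s5" unfolding halts_def by blast
    moreover have "s5 0 = family (DCons ?V ?L)" using s5(2) s4 by simp
    ultimately show ?thesis unfolding runs_in_def s0_def using c[OF n, of k] by (meson le_trans)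
  qed
  show ?thesis using that[of ?P c] small big by blast
qed

lemma minimal_separator_two_vertices:
  fixes n :: nat
  assumes "class_C G" "pverts G = {..<n}" "minimal_separator G S"
  shows "2 \<le> n"
proof -
  interpret C_graph G using assms(1) by unfold_locales
  obtain A B where "full_pair G S A B" using minimal_separator_full_pair assms(3) by blast
  then interpret full_pair G S A B .
  obtain a b where "a \<in> A" "b \<in> B" using A(2) B(2) by blast
  then have "a < n" "b < n" "a \<noteq> b" using A(4) B(4) AB assms(2) by auto
  then show ?thesis by linarith
qed

text \<open>The vertex list is decreasing, and writing a vector by a fold reverses it once more, so
  the entries appear in the order of \<open>enc_vset\<close>.\<close>

lemma family_members:
  fixes n :: nat and G :: "nat pair_pre_digraph"
  defines "V \<equiv> vertices (enc_graph n G)"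
  shows "family (DCons V L) =
    enc_list (map (enc_vset n) (rev (map (\<lambda>T. {i. i < n \<and> tuple_shat V T (vtx n G i)}) (dlist L))))"
proof -
  have "enc_list (rev (map (\<lambda>v. enc_bool (tuple_shat V T v)) (dlist V))) =
      enc_vset n {i. i < n \<and> tuple_shat V T (vtx n G i)}" for T
    unfolding V_def dlist_vertices enc_vset_def
    by (auto simp: rev_map comp_def enc_list_inject)
  then show ?thesis unfolding family_eq by (simp add: rev_map comp_def)
qed

lemma container_in_family:
  fixes n :: nat and G :: "nat pair_pre_digraph"
  assumes G: "class_C G" "pverts G = {..<n}"
    and F: "induced_subgraph (with_proj F) (with_proj G)" "colorable k F" and S: "minimal_separator G S"
  defines "V \<equiv> vertices (enc_graph n G)"
  shows "\<exists>T\<in>set (dlist (tuples V (k + 6))). container F S {i. i < n \<and> tuple_shat V T (vtx n G i)}"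
proof -
  interpret C_graph G using G(1) by unfold_locales
  have "has_container_tuple k F S" using container_tuple_exists[OF S F] .
  then obtain p q p2 q2 p3 q3 a b t1 t2 e r KA KB where
    V': "set [p, q, p2, q2, p3, q3, a, b, t1, t2, e, r] \<union> set KA \<union> set KB \<subseteq> pverts G"
    and len: "length KA = k" "length KB = k" and
    cont: "container F S {v \<in> pverts G. shat adj (pverts G) p q p2 q2 p3 q3 a b t1 t2 e r KA KB v}"
    unfolding has_container_tuple_def by blast
  let ?f = "vtx n G"
  let ?K = "map2 (\<lambda>u w. DCons (?f u) (?f w)) KA KB"
  let ?T = "enc_list ([DCons (?f p) (?f q), DCons (?f p2) (?f q2), DCons (?f p3) (?f q3),
      DCons (?f a) (?f b), DCons (?f t1) (?f t2), DCons (?f e) (?f r)] @ ?K)"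
  have setV: "set (dlist V) = ?f ` pverts G" by (auto simp: V_def dlist_vertices G(2))
  have "map dhd ?K = map ?f (map fst (zip KA KB))" "map dtl ?K = map ?f (map snd (zip KA KB))"
    by (auto simp: comp_def)
  \<comment> \<open>Both lists have length \<open>k\<close>, so zipping them loses nothing.\<close>
  then have K: "map dhd ?K = map ?f KA" "map dtl ?K = map ?f KB" using len by simp_all
  have "tuple_shat V ?T (?f v) \<longleftrightarrow> shat adj (pverts G) p q p2 q2 p3 q3 a b t1 t2 e r KA KB v"
    if "v \<in> pverts G" for v
  proof -
    have "dadj (?f i) (?f j) \<longleftrightarrow> i \<sim> j" if "i \<in> pverts G" "j \<in> pverts G" for i j
      using that G(2) by (simp add: dadj_vtx)
    from shat_transfer[where E' = dadj and f = ?f, OF this V' that]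
    show ?thesis unfolding tuple_shat_def setV by (simp add: K del: map_map)
  qed
  then have eq: "{i. i < n \<and> tuple_shat V ?T (?f i)} =
      {v \<in> pverts G. shat adj (pverts G) p q p2 q2 p3 q3 a b t1 t2 e r KA KB v}"
    using G(2) by auto
  have "?T \<in> set (dlist (tuples V (k + 6)))"
  proof -
    have "\<exists>u\<in>set (dlist V). \<exists>w\<in>set (dlist V). y = DCons u w" if y: "y \<in> set ?K" for y
    proof -
      obtain i j where ij: "(i, j) \<in> set (zip KA KB)" "y = DCons (?f i) (?f j)" using y by auto
      then have "i \<in> pverts G" "j \<in> pverts G"
        using V' set_zip_leftD[OF ij(1)] set_zip_rightD[OF ij(1)] by auto
      then show ?thesis using ij(2) unfolding setV by blast
    qed
    moreover have "\<exists>u\<in>set (dlist V). \<exists>w\<in>set (dlist V). DCons (?f i) (?f j) = DCons u w"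
      if "i \<in> pverts G" "j \<in> pverts G" for i j using that unfolding setV by blast
    ultimately show ?thesis unfolding set_tuples using V' len by auto
  qed
  then show ?thesis by (rule bexI[rotated]) (simp only: eq cont)
qed

theorem theorem3p8:
  shows "\<exists>(P :: com) (c :: nat) (C :: nat).
    \<forall>(n :: nat) (k :: nat) (G :: nat pair_pre_digraph).
      class_C G \<and> pverts G = {..<n} \<longrightarrow>
      (\<exists>(t :: nat) (out :: data) (\<F> :: nat set set).
         runs_in P (enc_input n G k) t out \<and>
         t \<le> c * max 1 n ^ (c * max 1 k) \<and>
         encodes_family n \<F> out \<and>
         card \<F> \<le> C * n ^ (2 * k + 12) \<and>
         (\<forall>(F :: nat pair_pre_digraph) (S :: nat set).
            induced_subgraph (with_proj F) (with_proj G) \<and> colorable k F \<and> minimal_separator G S \<longrightarrow>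
            (\<exists>A\<in>\<F>. container F S A)))"
proof -
  obtain P c where small: "\<And>n k G. n \<le> 1 \<Longrightarrow> \<exists>t\<le>6. runs_in P (enc_input n G k) t DNil"
    and big: "\<And>n k G. 2 \<le> n \<Longrightarrow> \<exists>t\<le>n ^ (c * (k + 1)). runs_in P (enc_input n G k) t
       (family (DCons (vertices (enc_graph n G)) (tuples (vertices (enc_graph n G)) (k + 6))))"
    by (rule program_exists) blast
  \<comment> \<open>\<open>2 * c\<close> compensates for replacing \<open>k + 1\<close> by
    \<open>max 1 k\<close>; the \<open>6\<close> pays for \<open>n \<le> 1\<close>, where the power
    is \<open>1\<close>.\<close>
  let ?c = "2 * c + 6"
  have "\<exists>t out \<F>. runs_in P (enc_input n G k) t out \<and> t \<le> ?c * max 1 n ^ (?c * max 1 k) \<and>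
         encodes_family n \<F> out \<and> card \<F> \<le> 1 * n ^ (2 * k + 12) \<and>
         (\<forall>F S. induced_subgraph (with_proj F) (with_proj G) \<and> colorable k F \<and> minimal_separator G S \<longrightarrow>
            (\<exists>A\<in>\<F>. container F S A))"
    if G: "class_C G" "pverts G = {..<n}" for n k and G :: "nat pair_pre_digraph"
  proof (cases "n \<le> 1")
    case True
    then obtain t where t: "t \<le> 6" "runs_in P (enc_input n G k) t DNil" using small by blast
    have "t \<le> ?c * max 1 n ^ (?c * max 1 k)" using t(1) True by (simp add: max_def)
    \<comment> \<open>With at most one vertex there is no minimal separator to contain, and the
      empty family also meets the size bound \<open>0\<close> for \<open>n = 0\<close>.\<close>
    moreover have "encodes_family n {} DNil" by (simp add: encodes_family_def)
    moreover have "\<not> minimal_separator G S" for S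
      using minimal_separator_two_vertices[OF G, of S] True by linarith
    ultimately show ?thesis using t(2) by (intro exI[of _ t] exI[of _ DNil] exI[of _ "{}"]) simp
  next
    case False
    then have n: "2 \<le> n" by simp
    let ?V = "vertices (enc_graph n G)"
    let ?L = "tuples ?V (k + 6)"
    let ?As = "rev (map (\<lambda>T. {i. i < n \<and> tuple_shat ?V T (vtx n G i)}) (dlist ?L))"
    obtain t where t: "t \<le> n ^ (c * (k + 1))" "runs_in P (enc_input n G k) t (family (DCons ?V ?L))"
      using big[OF n] by blast
    have "n ^ (c * (k + 1)) \<le> n ^ (?c * max 1 k)"
    proof (rule power_increasing)
      have "c * (k + 1) \<le> c * (2 * max 1 k)" by (intro mult_le_mono2) simp
      also have "\<dots> \<le> ?c * max 1 k" by simp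
      finally show "c * (k + 1) \<le> ?c * max 1 k" .
    qed (use n in simp)
    also have "\<dots> \<le> ?c * max 1 n ^ (?c * max 1 k)" using n by (simp add: max_def)
    finally have time: "t \<le> ?c * max 1 n ^ (?c * max 1 k)" using t(1) by linarith
    have "encodes_family n (set ?As) (family (DCons ?V ?L))"
      unfolding encodes_family_def
    proof (intro conjI exI)
      show "set ?As \<subseteq> Pow {..<n}" by auto
    qed (rule refl, rule family_members)
    moreover have "card (set ?As) \<le> 1 * n ^ (2 * k + 12)"
    proof -
      have "card (set ?As) \<le> length ?As" by (rule card_length)
      also have "\<dots> = n ^ (2 * (k + 6))" by (simp add: length_tuples dlist_vertices)
      also have "2 * (k + 6) = 2 * k + 12" by simp
      finally show ?thesis by simp
    qed
    moreover have "\<exists>A\<in>set ?As. container F S A"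
      if "induced_subgraph (with_proj F) (with_proj G)" "colorable k F" "minimal_separator G S" for F S
      using container_in_family[OF G that] by auto
    ultimately show ?thesis using t(2) time by blast
  qed
  then show ?thesis by blast
qed

end
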